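(* Over $\mathbb{Q}(v)$, the $q$-Schur algebra $\mathbf{S}(n,d)$ is isomorphic with the associative algebra (with $1$) with generators $E_i,F_i$ ($1\le i\le n-1$), $K_i,K_i^{-1}$ ($1\le i\le n$) and relations (Q1) $K_iK_j=K_jK_i$, $\;K_iK_i^{-1}=K_i^{-1}K_i=1$; (Q2) $E_iF_j-F_jE_i=\delta_{ij}\dfrac{K_iK_{i+1}^{-1}-K_i^{-1}K_{i+1}}{v-v^{-1}}$; (Q3) $K_iE_j=v^{(\varepsilon_i,\alpha_j)}E_jK_i$, $\;K_iF_j=v^{-(\varepsilon_i,\alpha_j)}F_jK_i$; (Q4) $E_i^2E_j-(v+v^{-1})E_iE_jE_i+E_jE_i^2=0$ if $|i-j|=1$, and $E_iE_j-E_jE_i=0$ otherwise; (Q5) $F_i^2F_j-(v+v^{-1})F_iF_jF_i+F_jF_i^2=0$ if $|i-j|=1$, and $F_iF_j-F_jF_i=0$ otherwise; (Q6) $K_1K_2\cdots K_n=v^d$; (Q7) $(K_i-1)(K_i-v)(K_i-v^2)\cdots(K_i-v^d)=0$.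
   Context: $n\ge1$, $d\ge0$ are integers and $v$ is an indeterminate. $\varepsilon_1,\dots,\varepsilon_n$ is the standard orthonormal basis of $\mathbb{R}^n$ with inner product $(\ ,\ )$; $\alpha_j=\varepsilon_j-\varepsilon_{j+1}$. The quantized enveloping algebra $\mathbf{U}=\mathbf{U}(\mathfrak{gl}_n)$ is the $\mathbb{Q}(v)$-algebra on generators $E_i,F_i,K_i^{\pm1}$ subject to relations (Q1)–(Q5) of the claim. Let $\mathbf{V}$ be the natural $\mathbf{U}$-module: the $\mathbb{Q}(v)$-vector space with basis $w_1,\dots,w_n$ and $K_iw_j=v^{\delta_{ij}}w_j$, $E_iw_j=\delta_{j,i+1}w_i$, $F_iw_j=\delta_{ij}w_{i+1}$. $\mathbf{U}$ acts on $\mathbf{V}^{\otimes d}$ through a standard comultiplication, e.g. $\Delta(K_i)=K_i\otimes K_i$, $\Delta(E_i)=E_i\otimes K_iK_{i+1}^{-1}+1\otimes E_i$, $\Delta(F_i)=F_i\otimes1+K_i^{-1}K_{i+1}\otimes F_i$. The $q$-Schur algebra $\mathbf{S}(n,d)$ is the image of $\mathbf{U}\to\operatorname{End}(\mathbf{V}^{\otimes d})$; equivalently it is the commuting algebra of the action of the Hecke algebra $\mathbf{H}(\Sigma_d)$ on $\mathbf{V}^{\otimes d}$. *)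

theory Defs
  imports
    "HOL-Library.FuncSet"
    "HOL-Library.Poly_Mapping"
    "HOL-Computational_Algebra.Polynomial"
    "HOL-Computational_Algebra.Fraction_Field"
    "HOL-Algebra.Module"
    "HOL-Algebra.QuotRing"
begin

section \<open>The field of rational functions and free vector spaces\<close>

type_synonym qv = "rat poly fract"

definition v :: qv where
  "v = Fract [:0, 1:] 1"

text \<open>Here \<^typ>\<open>'b \<Rightarrow>\<^sub>0 qv\<close> is the vector space with basis \<^typ>\<open>'b\<close>; the basis vector of
  \<open>b\<close> is \<^term>\<open>Poly_Mapping.single b 1\<close>.\<close>

definition scale :: "qv \<Rightarrow> ('b \<Rightarrow>\<^sub>0 qv) \<Rightarrow> ('b \<Rightarrow>\<^sub>0 qv)" where
  "scale c x = Poly_Mapping.map ((*) c) x"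

definition lin_ext :: "('b \<Rightarrow> ('c \<Rightarrow>\<^sub>0 qv)) \<Rightarrow> ('b \<Rightarrow>\<^sub>0 qv) \<Rightarrow> ('c \<Rightarrow>\<^sub>0 qv)" where
  "lin_ext f x = (\<Sum>b\<in>Poly_Mapping.keys x. scale (Poly_Mapping.lookup x b) (f b))"


section \<open>Associative algebras, quotients and isomorphisms\<close>

text \<open>An associative unital algebra is represented by a record of type
  \<^typ>\<open>(qv, 'a) module\<close>, which has ring operations and a scalar multiplication. (The library's
  locale for algebras is for commutative ones only.)\<close>

definition quot_alg :: "(qv, 'a) module \<Rightarrow> 'a set \<Rightarrow> (qv, 'a set) module" where
  "quot_alg A I = ring.extend (A Quot I)
     (module.fields (\<lambda>c X. \<Union>x\<in>X. I +>\<^bsub>A\<^esub> (c \<odot>\<^bsub>A\<^esub> x)))"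

definition alg_iso :: "(qv, 'a) module \<Rightarrow> (qv, 'b) module \<Rightarrow> ('a \<Rightarrow> 'b) set" where
  "alg_iso A B = {\<phi> \<in> ring_iso A B. \<forall>c. \<forall>x\<in>carrier A. \<phi> (c \<odot>\<^bsub>A\<^esub> x) = c \<odot>\<^bsub>B\<^esub> \<phi> x}"

definition alg_isomorphic :: "(qv, 'a) module \<Rightarrow> (qv, 'b) module \<Rightarrow> bool" where
  "alg_isomorphic A B \<longleftrightarrow> alg_iso A B \<noteq> {}"


section \<open>Free algebras\<close>

text \<open>Multiplication in \<^typ>\<open>'k \<Rightarrow>\<^sub>0 qv\<close> is convolution with respect to an additively written
  monoid \<^typ>\<open>'k\<close>. For the free algebra this is the monoid of words under concatenation.\<close>

datatype 'g free_monoid = Word (letters: "'g list")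

instantiation free_monoid :: (type) monoid_add
begin

definition zero_free_monoid :: "'a free_monoid" where
  "0 = Word []"

definition plus_free_monoid :: "'a free_monoid \<Rightarrow> 'a free_monoid \<Rightarrow> 'a free_monoid" where
  "x + y = Word (letters x @ letters y)"

instance
  by standard (simp_all add: zero_free_monoid_def plus_free_monoid_def)

end

text \<open>The free associative algebra with \<open>1\<close> on the set \<open>G\<close> of generators.\<close>

definition free_alg :: "'g set \<Rightarrow> (qv, 'g free_monoid \<Rightarrow>\<^sub>0 qv) module" where
  "free_alg G = \<lparr>carrier = {p. \<forall>w\<in>Poly_Mapping.keys p. set (letters w) \<subseteq> G},
     monoid.mult = (*), one = 1, zero = 0, add = (+), smult = scale\<rparr>"

definition gen :: "'g \<Rightarrow> ('g free_monoid \<Rightarrow>\<^sub>0 qv)" where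
  "gen g = Poly_Mapping.single (Word [g]) 1"

definition scalar :: "qv \<Rightarrow> ('g free_monoid \<Rightarrow>\<^sub>0 qv)" where
  "scalar c = scale c 1"

text \<open>The algebra with generators \<open>G\<close> and relations \<open>r = 0\<close> for \<open>r \<in> R\<close>; note that
  \<^const>\<open>genideal\<close> yields the generated two-sided ideal.\<close>

definition presented_alg ::
    "'g set \<Rightarrow> ('g free_monoid \<Rightarrow>\<^sub>0 qv) set \<Rightarrow> (qv, ('g free_monoid \<Rightarrow>\<^sub>0 qv) set) module" where
  "presented_alg G R = quot_alg (free_alg G) (Idl\<^bsub>free_alg G\<^esub> R)"

lemma keys_times_subset:
  fixes p q :: "'g free_monoid \<Rightarrow>\<^sub>0 qv"
  assumes "w \<in> Poly_Mapping.keys (p * q)"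
  shows "\<exists>a\<in>Poly_Mapping.keys p. \<exists>b\<in>Poly_Mapping.keys q. w = a + b"
  using keys_mult[of p q] assms by blast

text \<open>By this fact the ideal generated by the relations is indeed an ideal (\<open>ring.genideal_ideal\<close>).\<close>

lemma ring_free_alg: "ring (free_alg G)"
proof (rule ringI)
  show "abelian_group (free_alg G)"
  proof (rule abelian_groupI)
    fix x assume "x \<in> carrier (free_alg G)"
    then show "\<exists>y\<in>carrier (free_alg G). y \<oplus>\<^bsub>free_alg G\<^esub> x = \<zero>\<^bsub>free_alg G\<^esub>"
      by (intro bexI[of _ "- x"]) (auto simp: free_alg_def)
  qed (use Poly_Mapping.keys_add in \<open>fastforce simp: free_alg_def add.assoc add.commute\<close>)+
  show "monoid (free_alg G)"
  proof (rule monoidI)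
    fix x y assume "x \<in> carrier (free_alg G)" "y \<in> carrier (free_alg G)"
    then show "x \<otimes>\<^bsub>free_alg G\<^esub> y \<in> carrier (free_alg G)"
      by (auto simp: free_alg_def plus_free_monoid_def dest!: keys_times_subset) blast+
  qed (auto simp: free_alg_def mult.assoc zero_free_monoid_def)
qed (auto simp: free_alg_def algebra_simps)


section \<open>The quantized enveloping algebra of \<open>gl\<^sub>n\<close>\<close>

datatype gl_gen = GenE nat | GenF nat | GenK nat | GenKinv nat

definition gl_gens :: "nat \<Rightarrow> gl_gen set" where
  "gl_gens n = GenE ` {1..<n} \<union> GenF ` {1..<n} \<union> GenK ` {1..n} \<union> GenKinv ` {1..n}"

type_synonym gl_free = "gl_gen free_monoid \<Rightarrow>\<^sub>0 qv"

abbreviation E :: "nat \<Rightarrow> gl_free" where "E i \<equiv> gen (GenE i)"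
abbreviation F :: "nat \<Rightarrow> gl_free" where "F i \<equiv> gen (GenF i)"
abbreviation K :: "nat \<Rightarrow> gl_free" where "K i \<equiv> gen (GenK i)"
abbreviation Kinv :: "nat \<Rightarrow> gl_free" where "Kinv i \<equiv> gen (GenKinv i)"

text \<open>Only integral vectors of \<open>\<real>\<^sup>n\<close> occur; they are given by their coordinates \<open>1, \<dots>, n\<close>.\<close>

definition eps :: "nat \<Rightarrow> nat \<Rightarrow> int" where
  "eps i k = (if k = i then 1 else 0)"

definition alpha :: "nat \<Rightarrow> nat \<Rightarrow> int" where
  "alpha j k = eps j k - eps (j + 1) k"

definition inner_prod :: "nat \<Rightarrow> (nat \<Rightarrow> int) \<Rightarrow> (nat \<Rightarrow> int) \<Rightarrow> int" where
  "inner_prod n x y = (\<Sum>k=1..n. x k * y k)"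

definition Q1 :: "nat \<Rightarrow> gl_free set" where
  "Q1 n = {K i * K j - K j * K i | i j. i \<in> {1..n} \<and> j \<in> {1..n}}
        \<union> {K i * Kinv i - 1 | i. i \<in> {1..n}}
        \<union> {Kinv i * K i - 1 | i. i \<in> {1..n}}"

definition Q2 :: "nat \<Rightarrow> gl_free set" where
  "Q2 n = {E i * F j - F j * E i
             - (if i = j
                then scale (1 / (v - inverse v)) (K i * Kinv (i + 1) - Kinv i * K (i + 1))
                else 0) | i j. i \<in> {1..<n} \<and> j \<in> {1..<n}}"

definition Q3 :: "nat \<Rightarrow> gl_free set" where
  "Q3 n = {K i * E j - scale (v powi (inner_prod n (eps i) (alpha j))) (E j * K i)
             | i j. i \<in> {1..n} \<and> j \<in> {1..<n}}
        \<union> {K i * F j - scale (v powi (- inner_prod n (eps i) (alpha j))) (F j * K i)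
             | i j. i \<in> {1..n} \<and> j \<in> {1..<n}}"

definition serre :: "nat \<Rightarrow> (nat \<Rightarrow> gl_free) \<Rightarrow> gl_free set" where
  "serre n X =
     {X i ^ 2 * X j - scale (v + inverse v) (X i * X j * X i) + X j * X i ^ 2
        | i j. i \<in> {1..<n} \<and> j \<in> {1..<n} \<and> \<bar>int i - int j\<bar> = 1}
   \<union> {X i * X j - X j * X i
        | i j. i \<in> {1..<n} \<and> j \<in> {1..<n} \<and> \<bar>int i - int j\<bar> \<noteq> 1}"

definition Q4 :: "nat \<Rightarrow> gl_free set" where
  "Q4 n = serre n E"

definition Q5 :: "nat \<Rightarrow> gl_free set" where
  "Q5 n = serre n F"

definition Q6 :: "nat \<Rightarrow> nat \<Rightarrow> gl_free set" where
  "Q6 n d = {(\<Prod>i\<leftarrow>[1..<n+1]. K i) - scalar (v ^ d)}"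

definition Q7 :: "nat \<Rightarrow> nat \<Rightarrow> gl_free set" where
  "Q7 n d = {(\<Prod>t\<leftarrow>[0..<d+1]. K i - scalar (v ^ t)) | i. i \<in> {1..n}}"

definition U_gl :: "nat \<Rightarrow> (qv, gl_free set) module" where
  "U_gl n = presented_alg (gl_gens n) (Q1 n \<union> Q2 n \<union> Q3 n \<union> Q4 n \<union> Q5 n)"


section \<open>Tensor space\<close>

text \<open>The basis vector \<open>w\<^sub>j\<close> of the natural module \<open>V\<close> is \<^term>\<open>Poly_Mapping.single j 1\<close>, where
  \<open>1 \<le> j \<le> n\<close>; the basis vector \<open>w\<^sub>j \<otimes> w\<^sub>k \<otimes> \<dots>\<close> of the \<open>d\<close>-th tensor power of \<open>V\<close> is
  \<^term>\<open>Poly_Mapping.single js 1\<close> where \<open>js = [j, k, \<dots>]\<close> has length \<open>d\<close>.\<close>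

definition tensor_space :: "nat \<Rightarrow> nat \<Rightarrow> (nat list \<Rightarrow>\<^sub>0 qv) set" where
  "tensor_space n d =
     {x. \<forall>js\<in>Poly_Mapping.keys x. length js = d \<and> set js \<subseteq> {1..n}}"

definition tensor_vec :: "(nat \<Rightarrow>\<^sub>0 qv) \<Rightarrow> (nat list \<Rightarrow>\<^sub>0 qv) \<Rightarrow> (nat list \<Rightarrow>\<^sub>0 qv)" where
  "tensor_vec x y = lin_ext (\<lambda>j. lin_ext (\<lambda>js. Poly_Mapping.single (j # js) 1) y) x"

text \<open>The tensor product of an operator on \<open>V\<close> and an operator on the \<open>d\<close>-th tensor power, as an
  operator on the power \<open>d + 1\<close> (where the empty word does not occur).\<close>

definition tensor_op :: "((nat \<Rightarrow>\<^sub>0 qv) \<Rightarrow> (nat \<Rightarrow>\<^sub>0 qv))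
    \<Rightarrow> ((nat list \<Rightarrow>\<^sub>0 qv) \<Rightarrow> (nat list \<Rightarrow>\<^sub>0 qv)) \<Rightarrow> ((nat list \<Rightarrow>\<^sub>0 qv) \<Rightarrow> (nat list \<Rightarrow>\<^sub>0 qv))" where
  "tensor_op f g = lin_ext (\<lambda>js. tensor_vec (f (Poly_Mapping.single (hd js) 1))
                                            (g (Poly_Mapping.single (tl js) 1)))"

fun nat_basis_act :: "gl_gen \<Rightarrow> nat \<Rightarrow> (nat \<Rightarrow>\<^sub>0 qv)" where
  "nat_basis_act (GenE i) j = (if j = i + 1 then Poly_Mapping.single i 1 else 0)"
| "nat_basis_act (GenF i) j = (if j = i then Poly_Mapping.single (i + 1) 1 else 0)"
| "nat_basis_act (GenK i) j = Poly_Mapping.single j (if j = i then v else 1)"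
| "nat_basis_act (GenKinv i) j = Poly_Mapping.single j (if j = i then inverse v else 1)"

definition nat_act :: "gl_gen \<Rightarrow> (nat \<Rightarrow>\<^sub>0 qv) \<Rightarrow> (nat \<Rightarrow>\<^sub>0 qv)" where
  "nat_act g = lin_ext (nat_basis_act g)"

fun counit :: "gl_gen \<Rightarrow> qv" where
  "counit (GenE i) = 0"
| "counit (GenF i) = 0"
| "counit (GenK i) = 1"
| "counit (GenKinv i) = 1"

text \<open>The action of the generators on tensor powers: the trivial module in degree \<open>0\<close>, and in
  degree \<open>d + 1\<close> the action on the tensor product of \<open>V\<close> with the \<open>d\<close>-th power through
  \<open>\<Delta>(K\<^sub>i) = K\<^sub>i \<otimes> K\<^sub>i\<close>, \<open>\<Delta>(E\<^sub>i) = E\<^sub>i \<otimes> K\<^sub>i K\<^sub>i\<^sub>+\<^sub>1\<inverse> + 1 \<otimes> E\<^sub>i\<close> and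
  \<open>\<Delta>(F\<^sub>i) = F\<^sub>i \<otimes> 1 + K\<^sub>i\<inverse> K\<^sub>i\<^sub>+\<^sub>1 \<otimes> F\<^sub>i\<close>. By coassociativity the bracketing is immaterial.\<close>

fun gen_act :: "nat \<Rightarrow> gl_gen \<Rightarrow> (nat list \<Rightarrow>\<^sub>0 qv) \<Rightarrow> (nat list \<Rightarrow>\<^sub>0 qv)" where
  "gen_act 0 g = scale (counit g)"
| "gen_act (Suc d) (GenK i) = tensor_op (nat_act (GenK i)) (gen_act d (GenK i))"
| "gen_act (Suc d) (GenKinv i) = tensor_op (nat_act (GenKinv i)) (gen_act d (GenKinv i))"
| "gen_act (Suc d) (GenE i) = (\<lambda>x.
     tensor_op (nat_act (GenE i)) (gen_act d (GenK i) \<circ> gen_act d (GenKinv (i + 1))) x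
   + tensor_op id (gen_act d (GenE i)) x)"
| "gen_act (Suc d) (GenF i) = (\<lambda>x.
     tensor_op (nat_act (GenF i)) id x
   + tensor_op (nat_act (GenKinv i) \<circ> nat_act (GenK (i + 1))) (gen_act d (GenF i)) x)"


section \<open>The \<open>q\<close>-Schur algebra\<close>

text \<open>The endomorphism algebra of the tensor power; operators are restricted to it in the sense of
  \<^const>\<open>restrict\<close>, so that they are determined by their values there.\<close>

definition End_alg :: "nat \<Rightarrow> nat \<Rightarrow> (qv, (nat list \<Rightarrow>\<^sub>0 qv) \<Rightarrow> (nat list \<Rightarrow>\<^sub>0 qv)) module" where
  "End_alg n d = (let T = tensor_space n d in
     \<lparr>carrier = {f \<in> T \<rightarrow>\<^sub>E T. (\<forall>x\<in>T. \<forall>y\<in>T. f (x + y) = f x + f y) \<and>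
                              (\<forall>c. \<forall>x\<in>T. f (scale c x) = scale c (f x))},
      monoid.mult = (\<lambda>f g. compose T f g), one = (\<lambda>x\<in>T. x),
      zero = (\<lambda>x\<in>T. 0), add = (\<lambda>f g. \<lambda>x\<in>T. f x + g x),
      smult = (\<lambda>c f. \<lambda>x\<in>T. scale c (f x))\<rparr>)"

definition word_act :: "nat \<Rightarrow> gl_gen free_monoid \<Rightarrow> (nat list \<Rightarrow>\<^sub>0 qv) \<Rightarrow> (nat list \<Rightarrow>\<^sub>0 qv)" where
  "word_act d w = foldr (gen_act d) (letters w)"

definition free_act :: "nat \<Rightarrow> nat \<Rightarrow> gl_free \<Rightarrow> (nat list \<Rightarrow>\<^sub>0 qv) \<Rightarrow> (nat list \<Rightarrow>\<^sub>0 qv)" where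
  "free_act n d p = (\<lambda>x\<in>tensor_space n d. lin_ext (\<lambda>w. word_act d w x) p)"

text \<open>Elements of \<^const>\<open>U_gl\<close> are cosets, on which \<^const>\<open>free_act\<close> is constant.\<close>

definition U_act :: "nat \<Rightarrow> nat \<Rightarrow> gl_free set \<Rightarrow> (nat list \<Rightarrow>\<^sub>0 qv) \<Rightarrow> (nat list \<Rightarrow>\<^sub>0 qv)" where
  "U_act n d X = the_elem (free_act n d ` X)"

definition q_Schur :: "nat \<Rightarrow> nat \<Rightarrow> (qv, (nat list \<Rightarrow>\<^sub>0 qv) \<Rightarrow> (nat list \<Rightarrow>\<^sub>0 qv)) module" where
  "q_Schur n d = (End_alg n d)\<lparr>carrier := U_act n d ` carrier (U_gl n)\<rparr>"

end

theory Submission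
  imports Defs
begin

text \<open>Write \<open>T\<close> for the presented algebra. The point is that \<open>T\<close> acts faithfully on tensor space.
  A quadratic Casimir element \<open>C\<close> is built from the triangular \<open>L\<close>-operators of \<open>U\<close>; it is
  central and acts on a singular vector of weight \<open>\<mu>\<close> by a scalar that determines the partition
  \<open>\<mu>\<close>. By (Q6) and (Q7) the weights of \<open>T\<close>-modules are compositions of \<open>d\<close>. If the kernel \<open>J\<close> of the
  action were nonzero, it would contain an element \<open>u\<close> that is singular from the left and from the
  right, and centrality of \<open>C\<close> forces both weights to be the same partition \<open>\<mu>\<close>. A polynomial in \<open>C\<close>
  and the \<open>K\<^sub>i\<close> yields a left singular \<open>y\<close> of weight \<open>\<mu>\<close> such that \<open>u y\<close> is a nonzero multiple of
  \<open>u\<close>; since \<open>T y\<close> is spanned by the images of \<open>y\<close> under words in the \<open>F\<^sub>i\<close>, \<open>u y\<close> is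
  also a multiple of \<open>y\<close>. So \<open>y\<close> lies in \<open>J\<close>, although it acts by a nonzero scalar on the
  singular vector of weight \<open>\<mu>\<close> in tensor space that is a product of quantum exterior powers.\<close>

section \<open>Quantum root vectors\<close>

text \<open>Two points decide the form of the argument. First, (Q7) has the distinct roots 1, v,
  ..., v^d, so nonzero left and right modules contain weight vectors with exponents between 0 and d;
  raising by the E_k must therefore stop, which gives singular vectors on either side. To build y,
  take the projection of 1 to the weight \<mu> and apply factors C - c, where c runs through scalars
  of strictly higher partitions: they kill what the E_k make of this projection, while they act on u
  by nonzero scalars because C separates partitions. Second, T consists of cosets, whereas the
  computations take place in a ring type. T is therefore realized as the corner of an endomorphism
  ring cut out by an idempotent e, with (Q1)-(Q5) valid in the whole ring and (Q6), (Q7) only after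
  multiplication with e. Because y must be compared in this ring and on tensor space, C and y are
  also written as elements of the free algebra.\<close>

hide_const (open) Defs.E Defs.F Defs.K Defs.Kinv

abbreviation (input) single where "single \<equiv> Poly_Mapping.single"
abbreviation (input) lookup where "lookup \<equiv> Poly_Mapping.lookup"
abbreviation (input) keys where "keys \<equiv> Poly_Mapping.keys"

section \<open>Powers of v in the field of rational functions\<close>

lemma v_nonzero [simp]: "v \<noteq> 0"
  unfolding v_def by (simp add: Zero_fract_def eq_fract)

lemma v_power: "v ^ m = Fract (monom 1 m) 1"
  by (induction m) (simp_all add: v_def One_fract_def monom_Suc monom_0 pCons_one)

lemma v_power_inj: "v ^ a = v ^ b \<longleftrightarrow> a = b"
proof -
  have "v ^ a = v ^ b \<longleftrightarrow> monom (1::rat) a = monom 1 b"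
    by (simp add: v_power eq_fract)
  thus ?thesis by (metis degree_monom_eq one_neq_zero)
qed

lemma v_powi_inj: "v powi a = v powi b \<longleftrightarrow> a = b"
proof
  assume eq: "v powi a = v powi b"
  define m where "m = nat (max 0 (max (- a) (- b)))"
  have "v powi (a + int m) = v powi (b + int m)"
    using eq by (simp add: power_int_add)
  moreover have "a + int m \<ge> 0" "b + int m \<ge> 0" unfolding m_def by auto
  ultimately have "v ^ nat (a + int m) = v ^ nat (b + int m)"
    by (simp add: power_int_def)
  thus "a = b" using \<open>a + int m \<ge> 0\<close> \<open>b + int m \<ge> 0\<close> by (simp add: v_power_inj)
qed simp

lemma v_minus_inverse [simp]: "v - inverse v \<noteq> 0"
  using v_powi_inj[of 1 "-1"] by (simp add: power_int_minus)

lemma v_plus_inverse [simp]: "v + inverse v \<noteq> 0"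
proof
  assume "v + inverse v = 0"
  hence "v * v + 1 = 0" by (metis distrib_left mult_zero_right right_inverse v_nonzero)
  hence "v * v = - 1" by (simp add: eq_neg_iff_add_eq_0)
  moreover have "v ^ 4 = (v * v) * (v * v)" by (simp add: eval_nat_numeral)
  ultimately have "v ^ 4 = v ^ 0" by simp
  thus False using v_power_inj[of 4 0] by simp
qed

text \<open>The commutator of E_k and F_k produces both v and v^{-1} over v - v^{-1}. Rewriting the
  first through the second exposes their difference 1 to the simplifier.\<close>

lemma v_quotient: "v / (v - inverse v) = 1 + inverse v / (v - inverse v)"
proof -
  have "v / (v - inverse v) = ((v - inverse v) + inverse v) / (v - inverse v)" by simp
  thus ?thesis
    by (metis add_divide_distrib divide_self v_minus_inverse)
qed

lemma sum_v_power:
  "finite A \<Longrightarrow> (\<Sum>a\<in>A. v ^ f a) = Fract (\<Sum>a\<in>A. monom 1 (f a)) 1"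
  by (induction A rule: finite_induct) (simp_all add: v_power Zero_fract_def)

definition dl :: "nat \<Rightarrow> nat \<Rightarrow> int" where
  "dl i j = (if i = j then 1 else 0)"

text \<open>The entries of the upper triangular \<open>L\<close>-operator, one half of the universal \<open>R\<close>-matrix
  evaluated in \<open>End V \<otimes> U\<close>. The lemmas \<open>L_E\<close> and \<open>L_F\<close> below are the entries of the identity
  \<open>L \<Delta>(x) = \<Delta>\<^sup>o\<^sup>p(x) L\<close> in \<open>End V \<otimes> U\<close>.\<close>

primrec lop :: "(qv \<Rightarrow> 'a \<Rightarrow> 'a) \<Rightarrow> (nat \<Rightarrow> 'a) \<Rightarrow> (nat \<Rightarrow> 'a) \<Rightarrow> nat \<Rightarrow> nat \<Rightarrow> 'a::ring_1" where
  "lop sc K F i 0 = K i"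
| "lop sc K F i (Suc m) = F (i + m) * lop sc K F i m - sc (inverse v) (lop sc K F i m * F (i + m))"

text \<open>The scaling and the generators are parameters because the same formula is used in three
  places: in the algebra, with E and F exchanged for the lower triangular matrix \<open>M\<close>,
  and in the free algebra for \<open>Casimir\<close>.\<close>

definition Lop :: "(qv \<Rightarrow> 'a \<Rightarrow> 'a) \<Rightarrow> (nat \<Rightarrow> 'a) \<Rightarrow> (nat \<Rightarrow> 'a) \<Rightarrow> nat \<Rightarrow> nat \<Rightarrow> 'a::ring_1" where
  "Lop sc K F i j = (if i \<le> j then lop sc K F i (j - i) else 0)"

section \<open>Algebras on a ring type and the relations (Q1)-(Q5)\<close>

locale scaled_algebra =
  fixes sc :: "qv \<Rightarrow> 'a \<Rightarrow> 'a::ring_1"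
  assumes sc_add_right: "sc c (x + y) = sc c x + sc c y"
    and sc_add_left: "sc (a + b) x = sc a x + sc b x"
    and sc_sc [simp]: "sc a (sc b x) = sc (a * b) x"
    and sc_one [simp]: "sc 1 x = x"
    and sc_mult_left [simp]: "sc c x * y = sc c (x * y)"
    and sc_mult_right [simp]: "x * sc c y = sc c (x * y)"
begin

sublocale vs: vector_space sc
  by standard (simp_all add: sc_add_right sc_add_left)

lemma sc_zero [simp]: "sc c 0 = 0" "sc 0 x = 0"
  by simp_all

lemma sc_minus: "sc c (- x) = - sc c x" "sc (- c) x = - sc c x"
  "sc c (x - y) = sc c x - sc c y" "sc (a - b) x = sc a x - sc b x"
  by (simp_all add: vs.scale_right_diff_distrib vs.scale_left_diff_distrib)

lemmas sc_expand = sc_add_right sc_add_left sc_minus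

lemma qcomm_assoc: "x * y = sc c (y * x) \<Longrightarrow> x * (y * z) = sc c (y * (x * z))"
  by (metis mult.assoc sc_mult_left)

lemma comm_assoc: "x * y = y * x \<Longrightarrow> x * (y * z) = y * (x * z)"
  for x y z :: 'a by (metis mult.assoc)

lemma inverse_qcomm:
  assumes "k * k' = 1" "k' * k = 1" "k * x = sc c (x * k)" "c \<noteq> 0"
  shows "k' * x = sc (inverse c) (x * k')"
proof -
  have "k' * (k * x) * k' = sc c (k' * x * (k * k'))"
    unfolding assms(3) by (simp add: mult.assoc)
  hence "x * k' = sc c (k' * x)"
    using assms(1,2) by (simp add: mult.assoc[symmetric])
  thus ?thesis using assms(4) by simp
qed

lemma qcomm_flip: "x * y = sc c (y * x) \<Longrightarrow> c \<noteq> 0 \<Longrightarrow> y * x = sc (inverse c) (x * y)"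
  by simp

end

text \<open>The exponent \<open>dl i j - dl i (j + 1)\<close> is the inner product of \<epsilon>_i
  and \<alpha>_j. (Q6) and (Q7) are left out so that the locale covers all tensor powers at once as
  well as the ring in which the quotient is only a corner.\<close>

locale quantum_gl = scaled_algebra sc
  for sc :: "qv \<Rightarrow> 'a \<Rightarrow> 'a::ring_1" +
  fixes n :: nat and E F K K' :: "nat \<Rightarrow> 'a"
  assumes KK: "\<lbrakk>i \<in> {1..n}; j \<in> {1..n}\<rbrakk> \<Longrightarrow> K i * K j = K j * K i"
    and KK': "i \<in> {1..n} \<Longrightarrow> K i * K' i = 1"
    and K'K: "i \<in> {1..n} \<Longrightarrow> K' i * K i = 1"
    and EF: "\<lbrakk>i \<in> {1..<n}; j \<in> {1..<n}\<rbrakk> \<Longrightarrow> E i * F j = F j * E i +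
       (if i = j then sc (1 / (v - inverse v)) (K i * K' (i + 1) - K' i * K (i + 1)) else 0)"
    and KE: "\<lbrakk>i \<in> {1..n}; j \<in> {1..<n}\<rbrakk> \<Longrightarrow>
       K i * E j = sc (v powi (dl i j - dl i (j + 1))) (E j * K i)"
    and KF: "\<lbrakk>i \<in> {1..n}; j \<in> {1..<n}\<rbrakk> \<Longrightarrow>
       K i * F j = sc (v powi (dl i (j + 1) - dl i j)) (F j * K i)"
    and EE: "\<lbrakk>i \<in> {1..<n}; j \<in> {1..<n}; \<bar>int i - int j\<bar> = 1\<rbrakk> \<Longrightarrow>
       E i * (E i * E j) + E j * (E i * E i) = sc (v + inverse v) (E i * (E j * E i))"
    and EE_comm: "\<lbrakk>i \<in> {1..<n}; j \<in> {1..<n}; \<bar>int i - int j\<bar> \<noteq> 1\<rbrakk> \<Longrightarrow> E i * E j = E j * E i"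
    and FF: "\<lbrakk>i \<in> {1..<n}; j \<in> {1..<n}; \<bar>int i - int j\<bar> = 1\<rbrakk> \<Longrightarrow>
       F i * (F i * F j) + F j * (F i * F i) = sc (v + inverse v) (F i * (F j * F i))"
    and FF_comm: "\<lbrakk>i \<in> {1..<n}; j \<in> {1..<n}; \<bar>int i - int j\<bar> \<noteq> 1\<rbrakk> \<Longrightarrow> F i * F j = F j * F i"
begin

lemma inv_comm:
  "\<lbrakk>i \<in> {1..n}; K i * x = sc c (x * K i); c \<noteq> 0\<rbrakk> \<Longrightarrow> K' i * x = sc (inverse c) (x * K' i)"
  by (rule inverse_qcomm[OF KK' K'K])

lemma K'K_comm: "\<lbrakk>i \<in> {1..n}; j \<in> {1..n}\<rbrakk> \<Longrightarrow> K' i * K j = K j * K' i"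
  using inv_comm[of i "K j" 1] KK by simp

lemma K'K': "\<lbrakk>i \<in> {1..n}; j \<in> {1..n}\<rbrakk> \<Longrightarrow> K' i * K' j = K' j * K' i"
  using inv_comm[of i "K' j" 1] K'K_comm by simp

definition kk where "kk k = K k * K' (k + 1)"
definition kk' where "kk' k = K' k * K (k + 1)"

lemma K_weight:
  assumes "a \<in> {1..n}" "K a * x = sc (v powi w) (x * K a)"
  shows "K' a * x = sc (v powi (- w)) (x * K' a)"
  using inv_comm[OF assms] by (simp add: power_int_minus)

lemma kk_weight:
  assumes "k \<in> {1..<n}" and x: "\<And>a. a \<in> {1..n} \<Longrightarrow> K a * x = sc (v powi (w a)) (x * K a)"
  shows "kk k * x = sc (v powi (w k - w (k + 1))) (x * kk k)"
    and "kk' k * x = sc (v powi (w (k + 1) - w k)) (x * kk' k)"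
proof -
  have *: "k \<in> {1..n}" "k + 1 \<in> {1..n}" using assms(1) by auto
  note r = x[OF *(1)] x[OF *(2)] K_weight[OF *(1) x[OF *(1)]] K_weight[OF *(2) x[OF *(2)]]
  note r' = r[THEN qcomm_assoc]
  show "kk k * x = sc (v powi (w k - w (k + 1))) (x * kk k)"
    unfolding kk_def mult.assoc r r' by (simp add: power_int_add power_int_diff power_int_minus divide_inverse mult.assoc r r')
  show "kk' k * x = sc (v powi (w (k + 1) - w k)) (x * kk' k)"
    unfolding kk'_def mult.assoc r r' by (simp add: power_int_add power_int_diff power_int_minus divide_inverse mult.assoc r r')
qed

lemma kk'_K: "k \<in> {1..<n} \<Longrightarrow> kk' k * K k = K (Suc k)"
  using KK[of "Suc k" k] K'K[of k] by (simp add: kk'_def mult.assoc) (simp flip: mult.assoc)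

lemma EF': "\<lbrakk>i \<in> {1..<n}; j \<in> {1..<n}\<rbrakk> \<Longrightarrow>
   E i * F j = F j * E i + (if i = j then sc (1 / (v - inverse v)) (kk i - kk' i) else 0)"
  using EF[of i j] by (simp add: kk_def kk'_def)

lemma kk_F: "\<lbrakk>k \<in> {1..<n}; j \<in> {1..<n}\<rbrakk> \<Longrightarrow>
    kk k * F j = sc (v powi (dl k (j + 1) - dl k j - (dl (k+1) (j+1) - dl (k+1) j))) (F j * kk k)"
  using kk_weight(1)[of k "F j" "\<lambda>a. dl a (j + 1) - dl a j"] KF by simp

lemma kk'_F: "\<lbrakk>k \<in> {1..<n}; j \<in> {1..<n}\<rbrakk> \<Longrightarrow>
    kk' k * F j = sc (v powi (dl (k+1) (j+1) - dl (k+1) j - (dl k (j + 1) - dl k j))) (F j * kk' k)"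
  using kk_weight(2)[of k "F j" "\<lambda>a. dl a (j + 1) - dl a j"] KF by simp

definition "L = Lop sc K F"

lemma L_diag [simp]: "L i i = K i" by (simp add: L_def Lop_def)

lemma L_zero: "j < i \<Longrightarrow> L i j = 0" by (simp add: L_def Lop_def)

lemma L_step: "i \<le> j \<Longrightarrow> L i (Suc j) = F j * L i j - sc (inverse v) (L i j * F j)"
  by (simp add: L_def Lop_def Suc_diff_le)

lemma L_induct [consumes 1, case_names diag step]:
  assumes "i \<le> j" "P i" "\<And>j. i \<le> j \<Longrightarrow> P j \<Longrightarrow> P (Suc j)"
  shows "P (j::nat)"
  using assms(1) by (induction j rule: dec_induct) (use assms in auto)

lemma K_L:
  assumes "a \<in> {1..n}" "1 \<le> i" "j \<le> n" "i \<le> j"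
  shows "K a * L i j = sc (v powi (dl a j - dl a i)) (L i j * K a)"
  using assms(4,3)
proof (induction j rule: L_induct)
  case diag
  then show ?case using KK assms by simp
next
  case (step j)
  have IH: "K a * L i j = sc (v powi (dl a j - dl a i)) (L i j * K a)" using step by simp
  have F: "K a * F j = sc (v powi (dl a (j + 1) - dl a j)) (F j * K a)"
    using KF assms step by simp
  have "v powi (dl a (j + 1) - dl a j) * v powi (dl a j - dl a i) = v powi (dl a (j+1) - dl a i)"
    by (simp flip: power_int_add)
  then show ?case
    by (simp add: L_step step algebra_simps IH F qcomm_assoc[OF IH] qcomm_assoc[OF F] sc_expand mult.commute[of "v powi _" "v powi _"])
qed

lemma kk_L:
  assumes "k \<in> {1..<n}" "1 \<le> i" "j \<le> n" "i \<le> j"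
  shows "kk k * L i j = sc (v powi (dl k j - dl k i - (dl (k+1) j - dl (k+1) i))) (L i j * kk k)"
    and "kk' k * L i j = sc (v powi (dl (k+1) j - dl (k+1) i - (dl k j - dl k i))) (L i j * kk' k)"
  using kk_weight[of k "L i j" "\<lambda>a. dl a j - dl a i"] K_L assms by auto

lemma comm_L:
  assumes "i \<le> j" "x * K i = K i * x" "\<And>m. i \<le> m \<Longrightarrow> m < j \<Longrightarrow> x * F m = F m * x"
  shows "x * L i j = L i j * x"
  using assms(1,3)
proof (induction j rule: L_induct)
  case (step j)
  have IH: "x * L i j = L i j * x" and F: "x * F j = F j * x" using step by auto
  show ?case by (simp add: L_step step algebra_simps IH F comm_assoc[OF IH] comm_assoc[OF F])
qed (use assms in auto)

section \<open>Commutation of the entries of L with the F_k\<close>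

lemma F_L_far:
  assumes "k \<in> {1..<n}" "1 \<le> i" "j \<le> n" "i \<le> j" "j < k \<or> k + 1 < i"
  shows "F k * L i j = L i j * F k"
proof (rule comm_L)
  show "F k * K i = K i * F k" using KF[of i k] assms by (auto simp: dl_def)
qed (use assms in \<open>auto intro!: FF_comm\<close>)

text \<open>After expansion of \<open>L i (Suc k)\<close> the claim is the Serre relation of F_k
  with \<open>L i k\<close> in the place of F_{k-1}. It is inherited from F_{k-1}, because
  \<open>L i k\<close> is a q-commutator of F_{k-1} with an element that commutes with F_k.\<close>

lemma F_L_end:
  assumes "1 \<le> i" "i \<le> k" "k < n"
  shows "F k * L i (Suc k) = sc v (L i (Suc k) * F k)"
proof (cases "i = k")
  case True
  have "K k * F k = sc (inverse v) (F k * K k)" using KF[of k k] assms by (simp add: dl_def power_int_minus)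
  note KF = this qcomm_assoc[OF this]
  show ?thesis using True by (simp add: L_step algebra_simps KF sc_expand)
next
  case False
  then obtain l where l: "k = Suc l" "i \<le> l" using assms by (cases k) auto
  define X where "X = L i l"
  have com: "F k * X = X * F k" unfolding X_def using assms l by (intro F_L_far) auto
  have S: "F k * (F k * F l) = sc (v + inverse v) (F k * (F l * F k)) - F l * (F k * F k)"
    using FF[of k l] assms l by (simp add: eq_diff_eq)
  note S' = S[THEN arg_cong, of "\<lambda>t. t * X", simplified mult.assoc]
  define Y where "Y = L i k"
  have Y: "Y = F l * X - sc (inverse v) (X * F l)" unfolding Y_def X_def l(1) using l by (simp add: L_step)
  have "F k * (F k * Y) - sc (v + inverse v) (F k * (Y * F k)) + Y * (F k * F k) = 0"
    unfolding Y by (simp add: algebra_simps S S' com comm_assoc[OF com] sc_expand)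
  thus ?thesis unfolding L_step[OF assms(2)] Y_def[symmetric]
    by (simp add: algebra_simps sc_expand)
qed

lemma F_L_mid:
  assumes "1 \<le> i" "i \<le> k" "Suc k < j" "j \<le> n"
  shows "F k * L i j = L i j * F k"
proof -
  have "Suc (Suc k) \<le> j" using assms by simp
  thus ?thesis using assms(4)
  proof (induction j rule: dec_induct)
    case base
    define X a b where "X = L i k" and "a = F k" and "b = F (Suc k)"
    define Y Z where "Y = L i (Suc k)" and "Z = L i (Suc (Suc k))"
    have Y: "Y = a * X - sc (inverse v) (X * a)" and Z: "Z = b * Y - sc (inverse v) (Y * b)"
      using assms by (simp_all add: X_def a_def b_def Y_def Z_def L_step)
    have bX: "b * X = X * b" unfolding b_def X_def using base assms by (intro F_L_far) auto
    have aY: "a * Y = sc v (Y * a)" unfolding Y_def a_def using base assms by (intro F_L_end) auto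
    \<comment> \<open>Dividing by v + v^{-1} solves the Serre relation and \<open>F_L_end\<close>
      for the middle terms \<open>a * (b * a)\<close> and \<open>a * (X * a)\<close>. Everything
      then reduces to the words \<open>p\<close>, \<open>q\<close>, \<open>r\<close>,
      \<open>s\<close>, whose coefficients can be compared.\<close>
    define u where "u = inverse (v + inverse v)"
    have u: "u * (v + inverse v) = 1" by (simp add: u_def)
    have "sc (v + inverse v) (a * (b * a)) = a * (a * b) + b * (a * a)"
      using FF[of k "Suc k"] base assms unfolding a_def b_def by simp
    hence S: "a * (b * a) = sc u (a * (a * b)) + sc u (b * (a * a))"
      using u by (metis sc_add_right sc_one sc_sc)
    have "sc (v + inverse v) (a * (X * a)) = a * (a * X) + X * (a * a)"
      using aY unfolding Y by (simp add: algebra_simps sc_expand)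
    hence SX: "a * (X * a) = sc u (a * (a * X)) + sc u (X * (a * a))"
      using u by (metis sc_add_right sc_one sc_sc)
    note Sa = arg_cong[OF S, of "\<lambda>t. t * X", unfolded distrib_right sc_mult_left mult.assoc]
      and SXa = arg_cong[OF SX, of "\<lambda>t. t * b", unfolded distrib_right sc_mult_left mult.assoc]
    define p q r s where "p = a * (a * (X * b))" and "q = b * (a * (a * X))"
      and "r = X * (a * (a * b))" and "s = X * (b * (a * a))"
    have "a * Z - Z * a = sc (u - inverse v + inverse v * inverse v * u) p +
        sc (inverse v - u - inverse v * inverse v * u) s"
      unfolding Y Z by (simp add: algebra_simps S Sa SX SXa bX comm_assoc[OF bX] sc_expand
        flip: p_def q_def r_def s_def)
    moreover have "u - inverse v + inverse v * inverse v * u = 0"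
    proof -
      have "inverse v * (u * (v + inverse v)) = u + inverse v * inverse v * u"
        by (simp add: algebra_simps)
      thus ?thesis unfolding u by simp
    qed
    moreover from this have "inverse v - u - inverse v * inverse v * u = 0"
      by (simp add: algebra_simps)
    ultimately show ?case unfolding Z_def a_def by simp
  next
    case (step j)
    have IH: "F k * L i j = L i j * F k" using step by simp
    have F: "F k * F j = F j * F k" using assms step by (intro FF_comm) auto
    show ?case using assms step by (simp add: L_step algebra_simps IH F comm_assoc[OF IH] comm_assoc[OF F])
  qed
qed

lemma F_L_start:
  assumes "1 \<le> k" "Suc k \<le> j" "j \<le> n"
  shows "sc (if j = Suc k then v else 1) (L (Suc k) j * F k) = F k * L (Suc k) j + kk' k * L k j"
  using assms(2,3)
proof (induction j rule: L_induct)
  case diag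
  have k: "k \<in> {1..<n}" using assms by auto
  have K: "K k * F k = sc (inverse v) (F k * K k)" "K (Suc k) * F k = sc v (F k * K (Suc k))"
    using KF[of k k] KF[of "Suc k" k] k by (simp_all add: dl_def power_int_minus)
  have kF: "kk' k * F k = sc (v * v) (F k * kk' k)"
    using kk'_F[OF k k] by (simp add: dl_def power_int_def eval_nat_numeral)
  have kK: "kk' k * K k = K (Suc k)" using kk'_K k by simp
  show ?case by (simp add: L_step algebra_simps K kF qcomm_assoc[OF kF] kK sc_expand)
next
  case (step j)
  have k: "k \<in> {1..<n}" "j \<in> {1..<n}" using assms step by auto
  have IH: "sc (if j = Suc k then v else 1) (L (Suc k) j * F k) = F k * L (Suc k) j + kk' k * L k j"
    using step by auto
  show ?case
  proof (cases "j = Suc k")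
    case False
    have F: "F j * F k = F k * F j" using False step k by (intro FF_comm) auto
    have kF: "kk' k * F j = F j * kk' k" using kk'_F[OF k] False step by (simp add: dl_def)
    have IH': "F k * L (Suc k) j = L (Suc k) j * F k - kk' k * L k j"
      using IH False by (simp add: algebra_simps)
    note IHa = arg_cong[OF IH', of "\<lambda>t. t * F j", unfolded left_diff_distrib mult.assoc]
    show ?thesis using step(1) by (simp add: L_step algebra_simps F[symmetric] comm_assoc[OF F[symmetric]] kF comm_assoc[OF kF] IH' IHa sc_expand)
  next
    case True
    \<comment> \<open>For \<open>j = Suc k\<close> the elements F_j and F_k do not commute, and the
      induction hypothesis only speaks of K_j. Both sides are instead expanded into words in
      \<open>a\<close>, \<open>b\<close> and the K's.\<close>
    define a b where "a = F j" and "b = F k"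
    have K: "K k * b = sc (inverse v) (b * K k)" "K j * b = sc v (b * K j)"
      "K k * a = a * K k" "K j * a = sc (inverse v) (a * K j)"
      using KF[of k k] KF[of "Suc k" k] KF[of k "Suc k"] KF[of "Suc k" "Suc k"] k True
      by (simp_all add: a_def b_def dl_def power_int_minus)
    have kF: "kk' k * b = sc (v * v) (b * kk' k)" "kk' k * a = sc (inverse v) (a * kk' k)"
      using kk'_F[OF k(1) k(1)] kk'_F[OF k] True by (simp_all add: a_def b_def dl_def power_int_minus power_int_def eval_nat_numeral)
    have kK: "kk' k * K k = K (Suc k)" using kk'_K k by simp
    have s: "L j (Suc j) = a * K j - sc (inverse v) (K j * a)"
      "L k (Suc j) = a * L k j - sc (inverse v) (L k j * a)"
      "L k j = b * K k - sc (inverse v) (K k * b)"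
      using step(1) True by (simp_all add: L_step a_def b_def)
    have "L j (Suc j) * b = b * L j (Suc j) + kk' k * L k (Suc j)"
      by (simp add: s K kK[folded True] algebra_simps sc_expand qcomm_assoc[OF K(1)] qcomm_assoc[OF K(2)]
          comm_assoc[OF K(3)] qcomm_assoc[OF K(4)] kF qcomm_assoc[OF kF(1)] qcomm_assoc[OF kF(2)])
    thus ?thesis using True by (simp add: b_def)
  qed
qed

lemma L_F:
  assumes "i \<in> {1..n}" "j \<in> {1..n}" "k \<in> {1..<n}"
  shows "(if j = k then L i (Suc k) else 0) + sc (v powi (dl j (Suc k) - dl j k)) (L i j * F k) =
         F k * L i j + (if i = Suc k then kk' k * L k j else 0)"
proof (cases "i \<le> j")
  case False
  have "kk' k * K k = K (Suc k)"
    using kk'_K assms by simp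
  with False show ?thesis by (auto simp: L_zero)
next
  case True
  consider "j < k" | "Suc k < i" | "j = k" | "i = Suc k" | "j = Suc k" "i \<le> k" | "i \<le> k" "Suc k < j"
    using True by atomize_elim auto
  then show ?thesis
  proof cases
    case 1
    then show ?thesis using F_L_far[of k i j] assms True by (simp add: dl_def)
  next
    case 2
    then show ?thesis using F_L_far[of k i j] assms True by (simp add: dl_def)
  next
    case 3
    then show ?thesis using L_step[OF True] assms True by (simp add: dl_def power_int_minus)
  next
    case 4
    then show ?thesis using F_L_start[of k j] assms True by (auto simp: dl_def L_zero)
  next
    case 5
    then show ?thesis using F_L_end[of i k] assms by (simp add: dl_def)
  next
    case 6
    then show ?thesis using F_L_mid[of i k j] assms by (simp add: dl_def)
  qed
qed

section \<open>Commutation of the entries of L with the E_k\<close>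

lemma E_L_end:
  assumes "1 \<le> i" "i \<le> k" "k < n"
  shows "L i k * kk k + L i (Suc k) * E k = sc (if i = k then v else 1) (E k * L i (Suc k)) + L (Suc i) (Suc k) * (if i = k then 1 else 0)"
proof (cases "i = k")
  case True
  have k: "k \<in> {1..<n}" using assms by auto
  have K: "K k * F k = sc (inverse v) (F k * K k)" "K k * E k = sc v (E k * K k)"
    using KF[of k k] KE[of k k] k by (simp_all add: dl_def power_int_minus)
  have kK: "K k * kk k = kk k * K k" "kk' k * K k = K (Suc k)"
    using kk_weight(1)[OF k, of "K k" "\<lambda>_. 0"] KK[of _ k] k kk'_K[OF k] by simp_all
  have EF: "E k * F k = F k * E k + sc (1 / (v - inverse v)) (kk k - kk' k)" using EF'[OF k k] by simp
  note EFK = arg_cong[OF EF, of "\<lambda>t. t * K k", unfolded distrib_right left_diff_distrib sc_mult_left mult.assoc kK]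
  note c = v_quotient
  have vvv: "v * (inverse v * inverse v) = inverse v" by (simp flip: mult.assoc)
  show ?thesis using True
    by (simp add: L_step K algebra_simps EFK qcomm_assoc[OF K(1)] qcomm_assoc[OF K(2)] kK sc_expand c vvv)
next
  case False
  have k: "k \<in> {1..<n}" using assms by auto
  define X where "X = L i k"
  have X: "E k * X = X * E k" unfolding X_def
    by (rule comm_L) (use assms False KE[of i k] EF in \<open>auto simp: dl_def\<close>)
  have kX: "kk k * X = sc v (X * kk k)" "kk' k * X = sc (inverse v) (X * kk' k)"
    using kk_L[of k i k] assms False by (auto simp: dl_def X_def power_int_minus)
  have EF: "E k * F k = F k * E k + sc (1 / (v - inverse v)) (kk k - kk' k)" using EF'[OF k k] by simp
  note EFX = arg_cong[OF EF, of "\<lambda>t. t * X", unfolded distrib_right left_diff_distrib sc_mult_left mult.assoc]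
  note c = v_quotient
  \<comment> \<open>In the commutator of E_k and F_k the part with \<open>kk' k\<close> cancels
    because of its weight against X; the part with \<open>kk k\<close> survives with coefficient (v
    - v^{-1})/(v - v^{-1}) = 1.\<close>
  show ?thesis using False assms
    by (simp add: L_step algebra_simps EFX EF X comm_assoc[OF X] kX sc_expand c flip: X_def)
qed

lemma E_L_start:
  assumes "1 \<le> k" "Suc (Suc k) \<le> j" "j \<le> n"
  shows "L k j * E k = sc v (E k * L k j) + L (Suc k) j"
  using assms(2,3)
proof (induction j rule: L_induct)
  case diag
  define j where "j = Suc k"
  have k: "k \<in> {1..<n}" "j \<in> {1..<n}" using assms diag by (auto simp: j_def)
  have IH: "L k j * E k = sc v (E k * L k j) + K j - K k * kk k"
    using E_L_end[of k k] assms diag by (simp add: j_def algebra_simps)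
  have EF: "E k * F j = F j * E k" using EF[OF k] by (simp add: j_def)
  note IHF = arg_cong[OF IH, of "\<lambda>t. t * F j", unfolded distrib_right left_diff_distrib sc_mult_left mult.assoc]
  have kF: "kk k * F j = sc v (F j * kk k)" "K k * F j = F j * K k"
    using kk_F[OF k] KF[of k j] k by (auto simp: dl_def j_def)
  have s: "L k (Suc j) = F j * L k j - sc (inverse v) (L k j * F j)"
    "L j (Suc j) = F j * K j - sc (inverse v) (K j * F j)"
    by (simp_all add: L_step j_def)
  have "L k (Suc j) * E k = sc v (E k * L k (Suc j)) + L j (Suc j)"
    by (simp add: s algebra_simps EF[symmetric] comm_assoc[OF EF[symmetric]]
       IH IHF sc_expand kF comm_assoc[OF kF(2)])
  thus ?case by (simp add: j_def)
next
  case (step j)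
  have k: "k \<in> {1..<n}" "j \<in> {1..<n}" using assms step by auto
  have IH: "L k j * E k = sc v (E k * L k j) + L (Suc k) j" using step by auto
  have EF: "E k * F j = F j * E k" using EF[OF k] step by simp
  note IHF = arg_cong[OF IH, of "\<lambda>t. t * F j", unfolded distrib_right left_diff_distrib sc_mult_left mult.assoc]
  show ?case using step(1)
    by (simp add: L_step algebra_simps EF[symmetric] comm_assoc[OF EF[symmetric]] IH IHF sc_expand)
qed

text \<open>E_k fails to commute with \<open>L i (Suc k)\<close> by the term
  \<open>L i k * kk k\<close>. This term dies in the next q-commutator, since \<open>L i k\<close>
  commutes with F_{k+1} and \<open>kk k\<close> does so up to the factor v.\<close>

lemma E_L_mid:
  assumes "1 \<le> i" "i < k" "Suc (Suc k) \<le> j" "j \<le> n"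
  shows "E k * L i j = L i j * E k"
  using assms(3,4)
proof (induction j rule: L_induct)
  case diag
  define j where "j = Suc k"
  have k: "k \<in> {1..<n}" "j \<in> {1..<n}" using assms diag by (auto simp: j_def)
  have IH: "E k * L i j = L i j * E k + L i k * kk k"
    using E_L_end[of i k] assms diag by (simp add: j_def algebra_simps)
  have EF: "E k * F j = F j * E k" using EF[OF k] by (simp add: j_def)
  note IHF = arg_cong[OF IH, of "\<lambda>t. t * F j", unfolded distrib_right left_diff_distrib sc_mult_left mult.assoc]
  have kF: "kk k * F j = sc v (F j * kk k)"
    using kk_F[OF k] by (auto simp: dl_def j_def)
  have LF: "F j * L i k = L i k * F j" using assms diag by (intro F_L_far) (auto simp: j_def)
  have s: "L i (Suc j) = F j * L i j - sc (inverse v) (L i j * F j)"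
    using assms(2) by (simp add: L_step j_def)
  have "E k * L i (Suc j) = L i (Suc j) * E k"
    by (simp add: s algebra_simps EF comm_assoc[OF EF] IH IHF sc_expand kF LF comm_assoc[OF LF])
  thus ?case by (simp add: j_def)
next
  case (step j)
  have k: "k \<in> {1..<n}" "j \<in> {1..<n}" using assms step by auto
  have IH: "E k * L i j = L i j * E k" using step by auto
  have EF: "E k * F j = F j * E k" using EF[OF k] step by simp
  show ?case using step(1) assms
    by (simp add: L_step algebra_simps EF comm_assoc[OF EF] IH comm_assoc[OF IH])
qed

lemma L_E:
  assumes "i \<in> {1..n}" "j \<in> {1..n}" "k \<in> {1..<n}"
  shows "(if j = Suc k then L i k * kk k else 0) + L i j * E k =
         sc (v powi (dl i k - dl i (Suc k))) (E k * L i j) + (if i = k then L (Suc k) j else 0)"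
proof (cases "i \<le> j")
  case False
  thus ?thesis by (auto simp: L_zero)
next
  case True
  consider "i = j" "i \<noteq> k" "i \<noteq> Suc k" | "i = j" "i = k" | "i = j" "i = Suc k" | "i < j" "j \<le> k" | "i < j" "Suc k < i" | "i < j" "i = Suc k"
    | "i \<le> k" "j = Suc k" | "i = k" "Suc k < j" | "i < k" "Suc k < j"
    using True by atomize_elim (auto simp: not_less not_le less_Suc_eq_le le_less Suc_le_eq)
  then show ?thesis
  proof cases
    case 6
    have com: "F m * E k = E k * F m" if "Suc k \<le> m" "m < j" for m using EF[of k m] assms that by simp
    have "L (Suc k) j * E k = sc (inverse v) (E k * L (Suc k) j)"
      using True[unfolded 6] com
    proof (induction j rule: L_induct)
      case diag
      show ?case using KE[of "Suc k" k] assms by (auto simp: dl_def power_int_minus)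
    next
      case (step l)
      have IH: "L (Suc k) l * E k = sc (inverse v) (E k * L (Suc k) l)"
        and F: "F l * E k = E k * F l" using step by auto
      show ?case using step(1) by (simp add: L_step algebra_simps IH qcomm_assoc[OF IH] F comm_assoc[OF F] sc_expand)
    qed
    then show ?thesis using 6 by (auto simp: dl_def power_int_minus)
  next
    case 4
    have "E k * L i j = L i j * E k" by (rule comm_L) (use assms 4 KE[of i k] EF in \<open>auto simp: dl_def\<close>)
    then show ?thesis using 4 by (auto simp: dl_def)
  next
    case 5
    have "E k * L i j = L i j * E k" by (rule comm_L) (use assms 5 KE[of i k] EF in \<open>auto simp: dl_def\<close>)
    then show ?thesis using 5 by (auto simp: dl_def)
  next
    case 7
    then show ?thesis using E_L_end[of i k] assms by (auto simp: dl_def)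
  next
    case 8
    then show ?thesis using E_L_start[of k j] assms by (auto simp: dl_def)
  next
    case 9
    then show ?thesis using E_L_mid[of i k j] assms by (auto simp: dl_def)
  next
    case 1
    then show ?thesis using KE[of i k] assms by (auto simp: dl_def L_zero)
  next
    case 2
    then show ?thesis using KE[of i k] assms by (auto simp: dl_def L_zero)
  next
    case 3
    then show ?thesis using KE[of i k] assms by (auto simp: dl_def L_zero power_int_minus)
  qed
qed

end

section \<open>The Casimir element\<close>

text \<open>Eliminates the common middle term b, such as \<open>L i r * E k * M r j\<close>, from a
  relation for L and a relation for M.\<close>

lemma sum_exchange:
  fixes a :: "'a::ab_group_add"
  assumes "a + b = c + d" "p + q = b + r"
  shows "c + d + r = q + p + a"
proof -
  have "c + d + r = a + (b + r)" by (simp add: assms(1)[symmetric] add.assoc)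
  thus ?thesis by (simp add: assms(2)[symmetric] add.commute)
qed

lemma sum_if_const: "(\<Sum>x\<in>A. if b then f x else 0) = (if b then sum f A else 0)"
  by simp

context quantum_gl
begin

lemma L_annihilates_left:
  assumes "\<And>k. k \<in> {1..<n} \<Longrightarrow> F k * x = 0" "K i * x = sc c x" "1 \<le> i" "i < j" "j \<le> n"
  shows "L i j * x = 0"
proof -
  have "Suc i \<le> j" using assms by simp
  thus ?thesis using assms(5)
  proof (induction j rule: L_induct)
    case diag
    then show ?case using assms by (simp add: L_step left_diff_distrib mult.assoc)
  next
    case (step j)
    then show ?case using assms by (simp add: L_step left_diff_distrib mult.assoc)
  qed
qed

lemma L_annihilates_right:
  assumes "\<And>k. k \<in> {1..<n} \<Longrightarrow> x * F k = 0" "x * K i = sc c x" "1 \<le> i" "i < j" "j \<le> n"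
  shows "x * L i j = 0"
proof -
  have "Suc i \<le> j" using assms by simp
  thus ?thesis using assms(5)
  proof (induction j rule: L_induct)
    case diag
    then show ?case using assms by (simp add: L_step right_diff_distrib flip: mult.assoc)
  next
    case (step j)
    then show ?case using assms by (simp add: L_step right_diff_distrib flip: mult.assoc)
  qed
qed

text \<open>Exchanging E and F negates the weights, and so does reversing the indices, which sends
  \<alpha>_k to -\<alpha>_{n-k}; hence (Q3) is preserved. In (Q2) both sides change sign.\<close>

lemma reversed: "quantum_gl sc n (\<lambda>i. F (n - i)) (\<lambda>i. E (n - i)) (\<lambda>i. K (Suc n - i)) (\<lambda>i. K' (Suc n - i))"
proof (unfold_locales, goal_cases)
  case (4 i j)
  then have m: "n - i \<in> {1..<n}" "n - j \<in> {1..<n}" by auto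
  have ni: "Suc n - i = Suc (n - i)" "Suc n - (i + 1) = n - i" using 4 by auto
  have eq: "n - j = n - i \<longleftrightarrow> i = j" using 4 by auto
  have c: "K (Suc (n - i)) * K' (n - i) = kk' (n - i)" "K' (Suc (n - i)) * K (n - i) = kk (n - i)"
    using m K'K_comm[of "n - i" "Suc (n - i)"] K'K_comm[of "Suc (n - i)" "n - i"] by (auto simp: kk_def kk'_def)
  show ?case unfolding ni c using EF'[OF m(2,1)] eq by (auto simp: algebra_simps sc_minus)
next
  case (5 i j)
  have "Suc n - i = n - j \<longleftrightarrow> i = j + 1" "Suc n - i = n - j + 1 \<longleftrightarrow> i = j" using 5 by auto
  moreover have "Suc n - i \<in> {1..n}" "n - j \<in> {1..<n}" using 5 by auto
  ultimately show ?case using KF[of "Suc n - i" "n - j"] unfolding dl_def by simp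
next
  case (6 i j)
  have "Suc n - i = n - j \<longleftrightarrow> i = j + 1" "Suc n - i = n - j + 1 \<longleftrightarrow> i = j" using 6 by auto
  moreover have "Suc n - i \<in> {1..n}" "n - j \<in> {1..<n}" using 6 by auto
  ultimately show ?case using KE[of "Suc n - i" "n - j"] unfolding dl_def by simp
qed (auto intro!: KK KK' K'K FF EE FF_comm EE_comm)

interpretation rev: quantum_gl sc n "\<lambda>i. F (n - i)" "\<lambda>i. E (n - i)" "\<lambda>i. K (Suc n - i)" "\<lambda>i. K' (Suc n - i)"
  by (rule reversed)

text \<open>The automorphism \<open>E\<^sub>i \<mapsto> F\<^sub>n\<^sub>-\<^sub>i\<close>, \<open>F\<^sub>i \<mapsto> E\<^sub>n\<^sub>-\<^sub>i\<close>, \<open>K\<^sub>i \<mapsto> K\<^sub>n\<^sub>+\<^sub>1\<^sub>-\<^sub>i\<close> turns \<open>L\<close> into a lower triangular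
  matrix with \<open>\<Delta>(x) M = M \<Delta>\<^sup>o\<^sup>p(x)\<close>. So \<open>Z = L M\<close> commutes with \<open>\<Delta>\<^sup>o\<^sup>p(x)\<close>, and its quantum trace
  \<open>C\<close> is central. In \<open>Z\<close> the \<open>F\<close>'s stand to the left of the \<open>E\<close>'s.\<close>

definition M :: "nat \<Rightarrow> nat \<Rightarrow> 'a" where
  "M i k = Lop sc (\<lambda>i. K (Suc n - i)) (\<lambda>i. E (n - i)) (Suc n - i) (Suc n - k)"

lemma M_rev: "M i k = rev.L (Suc n - i) (Suc n - k)"
  unfolding M_def rev.L_def ..

lemma rev_kk: assumes "k \<in> {1..<n}" shows "rev.kk (n - k) = kk' k" "rev.kk' (n - k) = kk k"
proof -
  have "Suc n - (n - k) = Suc k" "Suc n - (n - k + 1) = k" using assms by auto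
  thus "rev.kk (n - k) = kk' k" "rev.kk' (n - k) = kk k"
    unfolding rev.kk_def rev.kk'_def kk_def kk'_def
    using K'K_comm[of k "Suc k"] K'K_comm[of "Suc k" k] assms by auto
qed

lemma M_E:
  assumes "i \<in> {1..n}" "j \<in> {1..n}" "k \<in> {1..<n}"
  shows "(if j = Suc k then M i k else 0) + sc (v powi (dl j k - dl j (Suc k))) (M i j * E k) =
         E k * M i j + (if i = k then kk k * M (Suc k) j else 0)"
proof -
  have e: "Suc n - j = n - k \<longleftrightarrow> j = Suc k" "Suc n - j = Suc (n - k) \<longleftrightarrow> j = k"
    "Suc n - i = Suc (n - k) \<longleftrightarrow> i = k" "n - (n - k) = k" "Suc n - k = Suc (n - k)"
    "Suc n - Suc k = n - k" using assms by auto
  have r: "Suc n - i \<in> {1..n}" "Suc n - j \<in> {1..n}" "n - k \<in> {1..<n}" using assms by auto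
  show ?thesis
    using rev.L_F[OF r] unfolding M_rev e dl_def rev_kk[OF assms(3)] .
qed

lemma M_F:
  assumes "i \<in> {1..n}" "j \<in> {1..n}" "k \<in> {1..<n}"
  shows "(if j = k then M i (Suc k) * kk' k else 0) + M i j * F k =
         sc (v powi (dl i (Suc k) - dl i k)) (F k * M i j) + (if i = Suc k then M k j else 0)"
proof -
  have e: "Suc n - j = Suc (n - k) \<longleftrightarrow> j = k" "Suc n - i = n - k \<longleftrightarrow> i = Suc k"
    "Suc n - i = Suc (n - k) \<longleftrightarrow> i = k" "n - (n - k) = k" "Suc n - k = Suc (n - k)"
    "Suc n - Suc k = n - k" using assms by auto
  have r: "Suc n - i \<in> {1..n}" "Suc n - j \<in> {1..n}" "n - k \<in> {1..<n}" using assms by auto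
  show ?thesis
    using rev.L_E[OF r] unfolding M_rev e dl_def rev_kk[OF assms(3)] .
qed

lemma M_diag [simp]: "M i i = K i" if "i \<in> {1..n}"
  using that unfolding M_rev by simp

lemma M_zero: "\<lbrakk>i \<in> {1..n}; j \<in> {1..n}; i < j\<rbrakk> \<Longrightarrow> M i j = 0"
  unfolding M_rev by (rule rev.L_zero) auto

lemma K_M:
  assumes "a \<in> {1..n}" "j \<in> {1..n}" "i \<in> {1..n}" "j \<le> i"
  shows "K a * M i j = sc (v powi (dl a j - dl a i)) (M i j * K a)"
proof -
  have "Suc n - a = Suc n - j \<longleftrightarrow> a = j" "Suc n - a = Suc n - i \<longleftrightarrow> a = i" "Suc n - (Suc n - a) = a"
    using assms by auto
  moreover have r: "Suc n - a \<in> {1..n}" "1 \<le> Suc n - i" "Suc n - j \<le> n" "Suc n - i \<le> Suc n - j"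
    using assms by auto
  ultimately show ?thesis using rev.K_L[OF r] unfolding M_rev dl_def by simp
qed

lemma M_annihilates_left:
  assumes "\<And>k. k \<in> {1..<n} \<Longrightarrow> E k * x = 0" "K i * x = sc c x" "j < i" "i \<in> {1..n}" "j \<in> {1..n}"
  shows "M i j * x = 0"
  unfolding M_rev by (rule rev.L_annihilates_left) (use assms in auto)

definition Z where "Z i j = (\<Sum>r=1..n. L i r * M r j)"

lemma Z_E:
  assumes "i \<in> {1..n}" "j \<in> {1..n}" "k \<in> {1..<n}"
  shows "sc (v powi (dl i k - dl i (Suc k))) (E k * Z i j) + (if i = k then Z (Suc k) j else 0) =
         sc (v powi (dl j k - dl j (Suc k))) (Z i j * E k) + (if j = Suc k then Z i k else 0)"
proof -
  have "sc (v powi (dl i k - dl i (Suc k))) (E k * (L i r * M r j)) + (if i = k then L (Suc k) r * M r j else 0)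
      + (if r = k then L i k * kk k * M (Suc k) j else 0)
    = sc (v powi (dl j k - dl j (Suc k))) (L i r * M r j * E k) + (if j = Suc k then L i r * M r k else 0)
      + (if r = Suc k then L i k * kk k * M (Suc k) j else 0)" (is "?l r = ?r r") if r: "r \<in> {1..n}" for r
  proof -
    have 1: "(if r = Suc k then L i k * kk k * M (Suc k) j else 0) + L i r * E k * M r j =
        sc (v powi (dl i k - dl i (Suc k))) (E k * (L i r * M r j)) + (if i = k then L (Suc k) r * M r j else 0)"
      using arg_cong[OF L_E[OF assms(1) r assms(3)], of "\<lambda>t. t * M r j"]
      unfolding distrib_right if_distrib[of "\<lambda>t. t * _"] mult_zero_left sc_mult_left by (cases "r = Suc k"; cases "i = k") (simp_all add: mult.assoc)
    have 2: "(if j = Suc k then L i r * M r k else 0) + sc (v powi (dl j k - dl j (Suc k))) (L i r * M r j * E k) =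
        L i r * E k * M r j + (if r = k then L i k * kk k * M (Suc k) j else 0)"
      using arg_cong[OF M_E[OF r assms(2,3)], of "\<lambda>t. L i r * t"]
      unfolding distrib_left if_distrib[of "\<lambda>t. L i r * t"] mult_zero_right sc_mult_right by (cases "r = k"; cases "j = Suc k") (simp_all add: mult.assoc)
    show ?thesis by (rule sum_exchange[OF 1 2])
  qed
  hence "(\<Sum>r=1..n. ?l r) = (\<Sum>r=1..n. ?r r)" by (intro sum.cong) auto
  \<comment> \<open>The correction terms of the two sides sit at \<open>r = k\<close> and at
    \<open>r = Suc k\<close> but are equal, so they cancel once r is summed out. The same happens in
    \<open>Z_F\<close>.\<close>
  moreover have "(\<Sum>r=1..n. if r = k then L i k * kk k * M (Suc k) j else 0) = L i k * kk k * M (Suc k) j"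
    "(\<Sum>r=1..n. if r = Suc k then L i k * kk k * M (Suc k) j else 0) = L i k * kk k * M (Suc k) j"
    using assms by simp_all
  ultimately show ?thesis
    by (cases "i = k"; cases "j = Suc k") (simp_all add: sum.distrib sum_if_const Z_def sum_distrib_left sum_distrib_right vs.scale_sum_right)
qed

lemma Z_F:
  assumes "i \<in> {1..n}" "j \<in> {1..n}" "k \<in> {1..<n}"
  shows "F k * Z i j + (if i = Suc k then kk' k * Z k j else 0) =
         Z i j * F k + (if j = k then Z i (Suc k) * kk' k else 0)"
proof -
  have "F k * (L i r * M r j) + (if i = Suc k then kk' k * (L k r * M r j) else 0)
      + (if r = Suc k then L i (Suc k) * M k j else 0)
    = L i r * M r j * F k + (if j = k then L i r * M r (Suc k) * kk' k else 0)
      + (if r = k then L i (Suc k) * M k j else 0)" (is "?l r = ?r r") if r: "r \<in> {1..n}" for r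
  proof -
    have 1: "(if r = k then L i (Suc k) * M k j else 0) + sc (v powi (dl r (Suc k) - dl r k)) (L i r * F k * M r j) =
        F k * (L i r * M r j) + (if i = Suc k then kk' k * (L k r * M r j) else 0)"
      using arg_cong[OF L_F[OF assms(1) r assms(3)], of "\<lambda>t. t * M r j"]
      unfolding distrib_right if_distrib[of "\<lambda>t. t * _"] mult_zero_left sc_mult_left by (cases "r = k"; cases "i = Suc k") (simp_all add: mult.assoc)
    have 2: "(if j = k then L i r * M r (Suc k) * kk' k else 0) + L i r * M r j * F k =
         sc (v powi (dl r (Suc k) - dl r k)) (L i r * F k * M r j) + (if r = Suc k then L i (Suc k) * M k j else 0)"
      using arg_cong[OF M_F[OF r assms(2,3)], of "\<lambda>t. L i r * t"]
      unfolding distrib_left if_distrib[of "\<lambda>t. L i r * t"] mult_zero_right sc_mult_right by (cases "r = Suc k"; cases "j = k") (simp_all add: mult.assoc)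
    show ?thesis by (rule sum_exchange[OF 1 2])
  qed
  hence "(\<Sum>r=1..n. ?l r) = (\<Sum>r=1..n. ?r r)" by (intro sum.cong) auto
  moreover have "(\<Sum>r=1..n. if r = k then L i (Suc k) * M k j else 0) = L i (Suc k) * M k j"
    "(\<Sum>r=1..n. if r = Suc k then L i (Suc k) * M k j else 0) = L i (Suc k) * M k j"
    using assms by simp_all
  ultimately show ?thesis
    by (cases "i = Suc k"; cases "j = k") (simp_all add: sum.distrib sum_if_const Z_def sum_distrib_left sum_distrib_right vs.scale_sum_right)
qed

text \<open>The weights drop by the factor v^2 from i = k to i = k + 1. This is the ratio for which
  the commutators of E_k and F_k with \<open>Z k k\<close> and \<open>Z (Suc k) (Suc k)\<close>
  cancel.\<close>

definition C where "C = (\<Sum>i=1..n. sc (v ^ (2 * (n - i))) (Z i i))"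

lemma K_Z:
  assumes a: "a \<in> {1..n}" and i: "i \<in> {1..n}" and j: "j \<in> {1..n}"
  shows "K a * Z i j = sc (v powi (dl a j - dl a i)) (Z i j * K a)"
proof -
  have "K a * (L i r * M r j) = sc (v powi (dl a j - dl a i)) (L i r * M r j * K a)" if r: "r \<in> {1..n}" for r
  proof (cases "i \<le> r \<and> j \<le> r")
    case True
    note 1 = K_L[of a i r] and 2 = K_M[of a j r]
    have "K a * (L i r * M r j) = sc (v powi (dl a r - dl a i) * v powi (dl a j - dl a r)) (L i r * M r j * K a)"
      using 1 2 qcomm_assoc[OF 1] a i j r True by (simp add: mult.assoc)
    thus ?thesis by (simp flip: power_int_add)
  qed (use L_zero M_zero[OF r j] in \<open>auto simp: not_le\<close>)
  thus ?thesis by (simp add: Z_def sum_distrib_left sum_distrib_right vs.scale_sum_right)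
qed

lemma K_C: "a \<in> {1..n} \<Longrightarrow> K a * C = C * K a"
  by (simp add: C_def sum_distrib_left sum_distrib_right K_Z)

lemma K'_C: "a \<in> {1..n} \<Longrightarrow> K' a * C = C * K' a"
  using inv_comm[of a C 1] K_C by simp

lemma C_remove:
  assumes "k \<in> {1..<n}"
  shows "C = sc (v ^ (2 * (n - k))) (Z k k) + sc (v ^ (2 * (n - Suc k))) (Z (Suc k) (Suc k))
     + (\<Sum>i\<in>{1..n} - {k, Suc k}. sc (v ^ (2 * (n - i))) (Z i i))"
proof -
  have "C = sum (\<lambda>i. sc (v ^ (2 * (n - i))) (Z i i)) {k, Suc k} + (\<Sum>i\<in>{1..n} - {k, Suc k}. sc (v ^ (2 * (n - i))) (Z i i))"
    unfolding C_def using assms by (subst sum.subset_diff[of "{k, Suc k}"]) (auto simp: add.commute)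
  thus ?thesis by simp
qed

lemma C_commute:
  assumes k: "k \<in> {1..<n}" and *: "\<And>i. i \<in> {1..n} - {k, Suc k} \<Longrightarrow> x * Z i i = Z i i * x"
    and **: "sc (v * v) (x * Z k k) + x * Z (Suc k) (Suc k) = sc (v * v) (Z k k * x) + Z (Suc k) (Suc k) * x"
  shows "x * C = C * x"
proof -
  define t where "t = v ^ (2 * (n - Suc k))"
  have t: "v ^ (2 * (n - k)) = t * (v * v)"
  proof -
    have "n - k = Suc (n - Suc k)" using k by auto
    thus ?thesis by (simp add: t_def mult_ac)
  qed
  have "x * (\<Sum>i\<in>{1..n} - {k, Suc k}. sc (v ^ (2 * (n - i))) (Z i i)) = (\<Sum>i\<in>{1..n} - {k, Suc k}. sc (v ^ (2 * (n - i))) (Z i i)) * x"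
    unfolding sum_distrib_left sum_distrib_right by (intro sum.cong) (simp_all add: *)
  thus ?thesis
    unfolding C_remove[OF k] t t_def[symmetric] distrib_left distrib_right
    using arg_cong[OF **, of "sc t"] by (simp add: sc_add_right)
qed

lemma E_C:
  assumes "k \<in> {1..<n}"
  shows "E k * C = C * E k"
proof (rule C_commute[OF assms])
  have k: "k \<in> {1..n}" "Suc k \<in> {1..n}" using assms by auto
  show "E k * Z i i = Z i i * E k" if "i \<in> {1..n} - {k, Suc k}" for i
    using Z_E[of i i k] assms that by (auto simp: dl_def)
  have 1: "sc v (E k * Z k k) = sc v (Z k k * E k) - Z (Suc k) k"
    using Z_E[OF k(1) k(1) assms] by (simp add: dl_def algebra_simps)
  have 2: "sc (inverse v) (E k * Z (Suc k) (Suc k)) = sc (inverse v) (Z (Suc k) (Suc k) * E k) + Z (Suc k) k"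
    using Z_E[OF k(2) k(2) assms] by (simp add: dl_def algebra_simps power_int_minus)
  show "sc (v * v) (E k * Z k k) + E k * Z (Suc k) (Suc k) = sc (v * v) (Z k k * E k) + Z (Suc k) (Suc k) * E k"
    using arg_cong[OF 1, of "sc v"] arg_cong[OF 2, of "sc v"] by (simp add: sc_add_right sc_minus)
qed

lemma F_C:
  assumes "k \<in> {1..<n}"
  shows "F k * C = C * F k"
proof (rule C_commute[OF assms])
  have k: "k \<in> {1..n}" "Suc k \<in> {1..n}" using assms by auto
  show "F k * Z i i = Z i i * F k" if "i \<in> {1..n} - {k, Suc k}" for i
    using Z_F[of i i k] assms that by auto
  have "K a * Z k (Suc k) = sc (v powi (dl a (Suc k) - dl a k)) (Z k (Suc k) * K a)" if "a \<in> {1..n}" for a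
    by (rule K_Z[OF that k])
  hence c: "kk' k * Z k (Suc k) = sc (v * v) (Z k (Suc k) * kk' k)"
    using kk_weight(2)[OF assms, of "Z k (Suc k)" "\<lambda>a. dl a (Suc k) - dl a k"]
    by (simp add: dl_def power_int_def eval_nat_numeral)
  have 1: "F k * Z k k = Z k k * F k + Z k (Suc k) * kk' k"
    using Z_F[OF k(1) k(1) assms] by (simp add: dl_def)
  have 2: "F k * Z (Suc k) (Suc k) = Z (Suc k) (Suc k) * F k - sc (v * v) (Z k (Suc k) * kk' k)"
    using Z_F[OF k(2) k(2) assms] by (simp add: dl_def c algebra_simps)
  show "sc (v * v) (F k * Z k k) + F k * Z (Suc k) (Suc k) = sc (v * v) (Z k k * F k) + Z (Suc k) (Suc k) * F k"
    by (simp add: 1 2 sc_add_right)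
qed

section \<open>Eigenvalues of the Casimir element on singular vectors\<close>

definition cval :: "(nat \<Rightarrow> int) \<Rightarrow> qv" where
  "cval w = (\<Sum>i=1..n. v ^ (2 * (n - i)) * (v powi w i * v powi w i))"

lemma Z_diag: "i \<in> {1..n} \<Longrightarrow> Z i i = K i * K i + (\<Sum>r\<in>{i<..n}. L i r * M r i)"
proof -
  assume i: "i \<in> {1..n}"
  have "Z i i = (\<Sum>r\<in>{i..n}. L i r * M r i)"
    unfolding Z_def by (rule sum.mono_neutral_right) (use i in \<open>auto simp: L_zero\<close>)
  also have "{i..n} = insert i {i<..n}" using i by auto
  finally show ?thesis using i by simp
qed

lemma C_singular_left:
  assumes "\<And>k. k \<in> {1..<n} \<Longrightarrow> E k * x = 0" "\<And>a. a \<in> {1..n} \<Longrightarrow> K a * x = sc (v powi w a) x"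
  shows "C * x = sc (cval w) x"
proof -
  have "Z i i * x = sc (v powi w i * v powi w i) x" if i: "i \<in> {1..n}" for i
  proof -
    have "M r i * x = 0" if "r \<in> {i<..n}" for r
      using M_annihilates_left[OF assms] i that by simp
    thus ?thesis using assms(2)[OF i] by (simp add: Z_diag[OF i] distrib_right sum_distrib_right mult.assoc)
  qed
  thus ?thesis by (simp add: C_def cval_def sum_distrib_right vs.scale_sum_left)
qed

text \<open>With L on the left of M, the part of \<open>Z i i\<close> off the diagonal dies on both
  kinds of singular vectors, so left and right eigenvalues are the same function of the weight. This
  is what allows left and right weights to be compared in \<open>nonzero_ideal\<close>.\<close>

lemma C_singular_right:
  assumes "\<And>k. k \<in> {1..<n} \<Longrightarrow> x * F k = 0" "\<And>a. a \<in> {1..n} \<Longrightarrow> x * K a = sc (v powi w a) x"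
  shows "x * C = sc (cval w) x"
proof -
  have "x * Z i i = sc (v powi w i * v powi w i) x" if i: "i \<in> {1..n}" for i
  proof -
    have "x * L i r = 0" if "r \<in> {i<..n}" for r
      using L_annihilates_right[OF assms] i that by simp
    thus ?thesis using assms(2)[OF i]
      by (simp add: Z_diag[OF i] distrib_left sum_distrib_left flip: mult.assoc)
  qed
  thus ?thesis by (simp add: C_def cval_def sum_distrib_left vs.scale_sum_left)
qed

end

section \<open>Weights\<close>

text \<open>A linear functional with value 1 on every simple root. It stands in for the dominance
  order in the inductions that climb by the E_k.\<close>

definition height :: "nat \<Rightarrow> (nat \<Rightarrow> int) \<Rightarrow> int" where
  "height n w = (\<Sum>i=1..n. int (n - i) * w i)"

definition raise :: "(nat \<Rightarrow> int) \<Rightarrow> nat \<Rightarrow> nat \<Rightarrow> int" where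
  "raise w k a = w a + (dl a k - dl a (k + 1))"

definition lower :: "(nat \<Rightarrow> int) \<Rightarrow> nat \<Rightarrow> nat \<Rightarrow> int" where
  "lower w k a = w a - (dl a k - dl a (k + 1))"

lemma sum_root:
  assumes "k \<in> {1..<n}"
  shows "(\<Sum>i=1..n. f i * (dl i k - dl i (k + 1))) = f k - f (k + 1)"
proof -
  have "(\<Sum>i=1..n. f i * (dl i k - dl i (k + 1))) =
      (\<Sum>i=1..n. (if i = k then f k else 0) - (if i = k + 1 then f (k + 1) else 0))"
    by (intro sum.cong) (auto simp: dl_def)
  thus ?thesis using assms by (simp add: sum_subtractf)
qed

lemma height_raise: "k \<in> {1..<n} \<Longrightarrow> height n (raise w k) = height n w + 1"
  using sum_root[of k n "\<lambda>i. int (n - i)"]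
  by (simp add: height_def raise_def algebra_simps sum.distrib flip: of_nat_diff)
     (simp add: algebra_simps sum.distrib sum_subtractf of_nat_diff)

lemma height_lower: "k \<in> {1..<n} \<Longrightarrow> height n (lower w k) = height n w - 1"
proof -
  have "raise (lower w k) k = w" by (rule ext) (simp add: raise_def lower_def)
  thus "k \<in> {1..<n} \<Longrightarrow> ?thesis" using height_raise[of k n "lower w k"] by simp
qed

definition qint :: "int \<Rightarrow> qv" where
  "qint a = (v powi a - v powi (- a)) / (v - inverse v)"

definition partition :: "nat \<Rightarrow> nat \<Rightarrow> (nat \<Rightarrow> int) \<Rightarrow> bool" where
  "partition n d w \<longleftrightarrow> (\<forall>a\<in>{1..n}. 0 \<le> w a \<and> w a \<le> int d) \<and> (\<forall>k\<in>{1..<n}. w (Suc k) \<le> w k)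
     \<and> (\<Sum>a=1..n. w a) = int d"

lemma v_powi_mult_v: "v powi a * v = v powi (a + 1)" "v powi a * inverse v = v powi (a - 1)"
  "v * v powi a = v powi (a + 1)" "inverse v * v powi a = v powi (a - 1)"
  by (simp_all add: power_int_add power_int_diff divide_inverse)

text \<open>In quantum integers this reads [a] + [a-2] + ... + [a-2m] = [m+1][a-m]. The sum is the
  coefficient that arises when E_k is moved through the power F_k^{m+1}.\<close>

lemma sum_qint:
  "(\<Sum>j\<le>m. qint (a - 2 * int j)) * ((v - inverse v) * (v - inverse v)) =
     (v powi (int m + 1) - v powi (- int m - 1)) * (v powi (a - int m) - v powi (int m - a))"
proof (induction m)
  case 0
  then show ?case by (simp add: qint_def power_int_minus)
next
  case (Suc m)
  have q: "qint (a - 2 * int (Suc m)) * ((v - inverse v) * (v - inverse v)) =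
      (v powi (a - 2 * int (Suc m)) - v powi (2 * int (Suc m) - a)) * (v - inverse v)"
    by (simp add: qint_def)
  show ?case unfolding sum.atMost_Suc distrib_right Suc q
    by (simp add: algebra_simps v_powi_mult_v minus_diff_commute flip: power_int_add)
qed

lemma sum_qint_nonzero:
  assumes "a < 0" shows "(\<Sum>j\<le>m. qint (a - 2 * int j)) \<noteq> 0"
proof
  assume "(\<Sum>j\<le>m. qint (a - 2 * int j)) = 0"
  hence "(v powi (int m + 1) - v powi (- int m - 1)) * (v powi (a - int m) - v powi (int m - a)) = 0"
    using sum_qint[of a m] by simp
  thus False using assms by (simp add: v_powi_inj)
qed

text \<open>Selects the last nonzero vector before a chain of operators reaches zero. For the
  factors of (Q7) this vector is an eigenvector of K_a.\<close>

lemma foldr_vanish: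
  assumes "foldr f ts x = 0" "x \<noteq> 0"
  obtains t us where "t \<in> set ts" "set us \<subseteq> set ts" "foldr f us x \<noteq> 0" "f t (foldr f us x) = (0::'a::zero)"
  using assms
proof (induction ts arbitrary: thesis)
  case (Cons t ts)
  show ?case
  proof (cases "foldr f ts x = 0")
    case True
    show ?thesis by (rule Cons.IH[OF _ True Cons.prems(3)], rule Cons.prems(1)) auto
  next
    case False
    thus ?thesis using Cons.prems(1)[of t ts] Cons.prems(2) by auto
  qed
qed simp

text \<open>Left and right multiplication both make an ideal of the algebra into such a module; for
  right multiplication \<open>E\<close> and \<open>F\<close> exchange their roles.\<close>

locale weight_module = vector_space sc
  for sc :: "qv \<Rightarrow> 'a \<Rightarrow> 'a::ab_group_add" +
  fixes n d :: nat and J :: "'a set" and \<kappa> \<epsilon> \<phi> :: "nat \<Rightarrow> 'a \<Rightarrow> 'a"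
  assumes linear: "\<kappa> a (sc c x) = sc c (\<kappa> a x)" "\<kappa> a (x - y) = \<kappa> a x - \<kappa> a y"
      "\<phi> a (sc c x) = sc c (\<phi> a x)" "\<phi> a 0 = 0" "\<epsilon> a 0 = 0"
    and closed: "x \<in> J \<Longrightarrow> a \<in> {1..n} \<Longrightarrow> \<kappa> a x - sc c x \<in> J"
      "x \<in> J \<Longrightarrow> k \<in> {1..<n} \<Longrightarrow> \<epsilon> k x \<in> J" "x \<in> J \<Longrightarrow> k \<in> {1..<n} \<Longrightarrow> \<phi> k x \<in> J"
    and commute: "x \<in> J \<Longrightarrow> a \<in> {1..n} \<Longrightarrow> b \<in> {1..n} \<Longrightarrow> \<kappa> a (\<kappa> b x) = \<kappa> b (\<kappa> a x)"
    and annihilate: "x \<in> J \<Longrightarrow> a \<in> {1..n} \<Longrightarrow> foldr (\<lambda>t z. \<kappa> a z - sc (v ^ t) z) [0..<d+1] x = 0"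
    and weight_eps: "x \<in> J \<Longrightarrow> k \<in> {1..<n} \<Longrightarrow> (\<And>a. a \<in> {1..n} \<Longrightarrow> \<kappa> a x = sc (v powi w a) x) \<Longrightarrow>
       a \<in> {1..n} \<Longrightarrow> \<kappa> a (\<epsilon> k x) = sc (v powi raise w k a) (\<epsilon> k x)"
    and weight_phi: "x \<in> J \<Longrightarrow> k \<in> {1..<n} \<Longrightarrow> (\<And>a. a \<in> {1..n} \<Longrightarrow> \<kappa> a x = sc (v powi w a) x) \<Longrightarrow>
       a \<in> {1..n} \<Longrightarrow> \<kappa> a (\<phi> k x) = sc (v powi lower w k a) (\<phi> k x)"
    and eps_phi: "x \<in> J \<Longrightarrow> k \<in> {1..<n} \<Longrightarrow> (\<And>a. a \<in> {1..n} \<Longrightarrow> \<kappa> a x = sc (v powi w a) x) \<Longrightarrow>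
       \<epsilon> k (\<phi> k x) = \<phi> k (\<epsilon> k x) + sc (qint (w k - w (Suc k))) x"
begin

definition wt :: "'a \<Rightarrow> (nat \<Rightarrow> int) \<Rightarrow> bool" where
  "wt x w \<longleftrightarrow> (\<forall>a\<in>{1..n}. \<kappa> a x = sc (v powi w a) x)"

lemma wtD: "wt x w \<Longrightarrow> a \<in> {1..n} \<Longrightarrow> \<kappa> a x = sc (v powi w a) x"
  by (simp add: wt_def)

lemma wt_range:
  assumes "x \<in> J" "x \<noteq> 0" "wt x w" "a \<in> {1..n}"
  shows "0 \<le> w a \<and> w a \<le> int d"
proof -
  let ?z = "\<lambda>us. foldr (\<lambda>t z. \<kappa> a z - sc (v ^ t) z) us x"
  obtain t us where t: "t \<in> set [0..<d+1]" "foldr (\<lambda>t z. \<kappa> a z - sc (v ^ t) z) us x \<noteq> 0"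
    "\<kappa> a (?z us) - sc (v ^ t) (?z us) = 0"
    by (rule foldr_vanish[OF annihilate[OF assms(1,4)] assms(2)])
  have "\<kappa> a (?z us) = sc (v powi w a) (?z us)"
    by (induction us) (use wtD[OF assms(3,4)] in \<open>auto simp: linear scale_right_diff_distrib mult.commute\<close>)
  hence "v powi w a = v powi int t" using t by auto
  thus ?thesis using t(1) by (auto simp: v_powi_inj simp del: power_int_of_nat)
qed

text \<open>The K_a are treated one at a time. The factors of (Q7) for the next index commute with
  the earlier K's, so passing to an eigenvector of the next one keeps the eigenvalues already
  obtained.\<close>

lemma exists_wt:
  assumes "x \<in> J" "x \<noteq> 0"
  shows "\<exists>y\<in>J. y \<noteq> 0 \<and> (\<exists>w. wt y w)"
proof -
  have "m \<le> n \<Longrightarrow> \<exists>y\<in>J. y \<noteq> 0 \<and> (\<exists>w. \<forall>a\<in>{1..m}. \<kappa> a y = sc (v powi w a) y)" for m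
  proof (induction m)
    case 0
    then show ?case using assms by auto
  next
    case (Suc m)
    then obtain y w where y: "y \<in> J" "y \<noteq> 0" "\<forall>a\<in>{1..m}. \<kappa> a y = sc (v powi w a) y" by auto
    have m: "Suc m \<in> {1..n}" using Suc by auto
    let ?z = "\<lambda>us. foldr (\<lambda>t z. \<kappa> (Suc m) z - sc (v ^ t) z) us y"
  obtain t us where t: "t \<in> set [0..<d+1]" "foldr (\<lambda>t z. \<kappa> (Suc m) z - sc (v ^ t) z) us y \<noteq> 0"
      "\<kappa> (Suc m) (?z us) - sc (v ^ t) (?z us) = 0"
      by (rule foldr_vanish[OF annihilate[OF y(1) m] y(2)])
    have z: "?z us \<in> J \<and> (\<forall>a\<in>{1..m}. \<kappa> a (?z us) = sc (v powi w a) (?z us))"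
    proof (induction us)
      case (Cons u us)
      have "\<kappa> a (\<kappa> (Suc m) (?z us)) = \<kappa> (Suc m) (\<kappa> a (?z us))" if "a \<in> {1..m}" for a
        by (rule commute) (use Cons that m in auto)
      then show ?case using Cons closed(1)[of "?z us" "Suc m" "v ^ u"] m
        by (auto simp: linear scale_right_diff_distrib mult.commute)
    qed (use y in simp)
    have "\<kappa> a (?z us) = sc (v powi (w(Suc m := int t)) a) (?z us)" if "a \<in> {1..Suc m}" for a
      using z t(3) that by (cases "a = Suc m") auto
    then show ?case using z t(2) by blast
  qed
  from this[of n] show ?thesis unfolding wt_def by auto
qed

lemma height_bounds:
  assumes "x \<in> J" "x \<noteq> 0" "wt x w"
  shows "0 \<le> height n w \<and> height n w \<le> int (n * n * d)"
proof
  have r: "0 \<le> w a \<and> w a \<le> int d" if "a \<in> {1..n}" for a using wt_range[OF assms] that .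
  show "0 \<le> height n w" unfolding height_def using r by (intro sum_nonneg) auto
  have "height n w \<le> (\<Sum>i=1..n. int n * int d)" unfolding height_def
    by (intro sum_mono mult_mono) (use r in auto)
  thus "height n w \<le> int (n * n * d)" by simp
qed

lemma wt_eps: "x \<in> J \<Longrightarrow> k \<in> {1..<n} \<Longrightarrow> wt x w \<Longrightarrow> wt (\<epsilon> k x) (raise w k)"
  using weight_eps unfolding wt_def by blast

lemma wt_phi: "x \<in> J \<Longrightarrow> k \<in> {1..<n} \<Longrightarrow> wt x w \<Longrightarrow> wt (\<phi> k x) (lower w k)"
  using weight_phi unfolding wt_def by blast

text \<open>This is sl_2 theory: if \<open>a = w k - w (Suc k)\<close> were negative, then
  \<epsilon>_k \<phi>_k^{m+1} x would be the nonzero multiple [m+1][a-m] of \<phi>_k^m x. No power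
  of \<phi>_k would kill x, although \<phi>_k lowers the k-th exponent, which cannot become
  negative.\<close>

lemma singular_dominant:
  assumes "x \<in> J" "x \<noteq> 0" "wt x w" "\<epsilon> k x = 0" "k \<in> {1..<n}"
  shows "w (Suc k) \<le> w k"
proof (rule ccontr)
  define a where "a = w k - w (Suc k)"
  assume "\<not> ?thesis"
  hence a: "a < 0" by (simp add: a_def)
  define y where "y m = (\<phi> k ^^ m) x" for m
  define l where "l m = ((\<lambda>w. lower w k) ^^ m) w" for m
  have y: "y m \<in> J \<and> wt (y m) (l m)" for m
    by (induction m) (use assms closed wt_phi in \<open>auto simp: y_def l_def\<close>)
  have l: "l m k = w k - int m" "l m (Suc k) = w (Suc k) + int m" for m
    by (induction m) (auto simp: l_def lower_def dl_def)
  have ey: "\<epsilon> k (y (Suc m)) = sc (\<Sum>j\<le>m. qint (a - 2 * int j)) (y m)" for m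
  proof (induction m)
    case 0
    show ?case using eps_phi[of x k w] assms by (auto simp: y_def linear a_def wt_def)
  next
    case (Suc m)
    have "\<epsilon> k (\<phi> k (y (Suc m))) = \<phi> k (\<epsilon> k (y (Suc m))) + sc (qint (l (Suc m) k - l (Suc m) (Suc k))) (y (Suc m))"
      using y[of "Suc m"] assms by (intro eps_phi) (auto simp: wt_def)
    moreover have "l (Suc m) k - l (Suc m) (Suc k) = a - 2 * int (Suc m)" by (simp add: l a_def)
    moreover have "\<phi> k (y m) = y (Suc m)" for m by (simp add: y_def)
    ultimately show ?case by (simp add: Suc linear scale_left_distrib)
  qed
  have "y m \<noteq> 0" for m
  proof (induction m)
    case (Suc m)
    then show ?case using ey[of m] sum_qint_nonzero[OF a, of m] by (auto simp: linear)
  qed (use assms in \<open>simp add: y_def\<close>)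
  \<comment> \<open>After \<open>w k + 1\<close> steps the k-th exponent would be -1.\<close>
  hence "0 \<le> l (Suc (nat (w k))) k" using y wt_range[of "y (Suc (nat (w k)))"] assms by auto
  thus False using wt_range[OF assms(1-3), of k] assms(5) by (simp add: l)
qed

text \<open>Applying an \<epsilon>_k that does not kill the vector raises the height by 1, and the
  height of a nonzero weight vector in \<open>J\<close> is bounded.\<close>

lemma exists_singular:
  assumes "x \<in> J" "x \<noteq> 0"
  shows "\<exists>y\<in>J. y \<noteq> 0 \<and> (\<forall>k\<in>{1..<n}. \<epsilon> k y = 0) \<and> (\<exists>w. wt y w)"
proof -
  have "\<exists>y\<in>J. y \<noteq> 0 \<and> (\<forall>k\<in>{1..<n}. \<epsilon> k y = 0) \<and> (\<exists>w. wt y w)"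
    if "y \<in> J" "y \<noteq> 0" "wt y w" for y w
    using that
  proof (induction "nat (int (n * n * d) - height n w)" arbitrary: y w rule: less_induct)
    case less
    show ?case
    proof (cases "\<forall>k\<in>{1..<n}. \<epsilon> k y = 0")
      case False
      then obtain k where k: "k \<in> {1..<n}" "\<epsilon> k y \<noteq> 0" by auto
      have J: "\<epsilon> k y \<in> J" "wt (\<epsilon> k y) (raise w k)" using wt_eps closed less k by auto
      show ?thesis
        by (rule less.hyps[OF _ J(1) k(2) J(2)])
           (use height_bounds[OF J(1) k(2) J(2)] height_raise[OF k(1)] in auto)
    qed (use less in auto)
  qed
  thus ?thesis using exists_wt[OF assms] by blast
qed

end

section \<open>Separation of partitions by the Casimir eigenvalue\<close>

lemma strict_antimono_unique:
  fixes f g :: "nat \<Rightarrow> nat"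
  assumes "strict_antimono_on {1..n} f" "strict_antimono_on {1..n} g" "f ` {1..n} = g ` {1..n}" "a \<in> {1..n}"
  shows "f a = g a"
proof -
  have s: "sorted_wrt (<) (map h (rev [1..<n+1]))" if "strict_antimono_on {1..n} h" for h :: "nat \<Rightarrow> nat"
    unfolding sorted_wrt_map sorted_wrt_rev
    by (rule sorted_wrt_mono_rel[OF _ sorted_wrt_upt]) (use that in \<open>auto simp: monotone_on_def simp del: upt_Suc\<close>)
  have "set [1..<n+1] = {1..n}" by auto
  hence "map f (rev [1..<n+1]) = map g (rev [1..<n+1])"
    using strict_sorted_equal[OF s[OF assms(2)] s[OF assms(1)]] assms(3) by (simp del: upt_Suc)
  thus ?thesis using assms(4) by (auto simp del: upt_Suc)
qed

context quantum_gl
begin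

text \<open>The exponents of v in \<open>cval w\<close> are 2(n - i + w_i). For a partition they
  strictly decrease in i, so the set of exponents determines their sequence and hence w.\<close>

lemma cval_inj:
  assumes "partition n d \<mu>" "partition n d' \<nu>" "cval \<mu> = cval \<nu>" "a \<in> {1..n}"
  shows "\<mu> a = \<nu> a"
proof -
  define f where "f w i = n - i + nat (w i)" for w :: "nat \<Rightarrow> int" and i
  have c: "cval w = Fract (\<Sum>i=1..n. monom 1 (2 * f w i)) 1" and s: "strict_antimono_on {1..n} (f w)"
    if p: "partition n d w" for w d
  proof -
    have "v ^ (2 * (n - i)) * (v powi w i * v powi w i) = v ^ (2 * f w i)" if "i \<in> {1..n}" for i
    proof -
      have "v powi w i = v ^ nat (w i)" using p that by (auto simp: partition_def power_int_def)
      thus ?thesis by (simp add: f_def power_add mult_2)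
    qed
    thus "cval w = Fract (\<Sum>i=1..n. monom 1 (2 * f w i)) 1"
      by (simp add: cval_def flip: sum_v_power)
    have step: "k \<in> {1..<n} \<Longrightarrow> f w (Suc k) < f w k" for k
      using p nat_mono[of "w (Suc k)" "w k"] by (force simp: partition_def f_def Suc_diff_Suc)
    have "f w j < f w i" if i: "i \<in> {1..n}" and "Suc i \<le> j" "j \<le> n" for i j
      using that(2,3)
    proof (induction j rule: dec_induct)
      case base
      then show ?case using step[of i] i by auto
    next
      case (step j)
      then show ?case using \<open>j \<in> {1..<n} \<Longrightarrow> f w (Suc j) < f w j\<close> i by auto
    qed
    thus "strict_antimono_on {1..n} (f w)" by (auto simp: monotone_on_def)
  qed
  have eq: "(\<Sum>i=1..n. monom (1::rat) (2 * f \<mu> i)) = (\<Sum>i=1..n. monom 1 (2 * f \<nu> i))"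
    using assms(3) unfolding c[OF assms(1)] c[OF assms(2)] by (simp add: eq_fract)
  \<comment> \<open>The coefficient counts the indices i with \<open>f w i = m\<close>, and such a
    count cannot cancel in characteristic 0.\<close>
  have co: "coeff (\<Sum>i=1..n. monom (1::rat) (2 * f w i)) (2 * m) \<noteq> 0 \<longleftrightarrow> m \<in> f w ` {1..n}" for w m
  proof -
    have "coeff (\<Sum>i=1..n. monom (1::rat) (2 * f w i)) (2 * m) = (\<Sum>i=1..n. if f w i = m then 1 else 0)"
      by (simp add: coeff_sum)
    also have "\<dots> = 0 \<longleftrightarrow> (\<forall>i\<in>{1..n}. f w i \<noteq> m)"
      by (subst sum_nonneg_eq_0_iff) auto
    finally show ?thesis by auto
  qed
  have "f \<mu> ` {1..n} = f \<nu> ` {1..n}" using co[of \<mu>] co[of \<nu>] eq by auto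
  hence "f \<mu> a = f \<nu> a" by (rule strict_antimono_unique[OF s[OF assms(1)] s[OF assms(2)] _ assms(4)])
  moreover have "0 \<le> \<mu> a" "0 \<le> \<nu> a" using assms by (auto simp: partition_def)
  ultimately show ?thesis by (simp add: f_def)
qed

end

section \<open>Quotients with bounded weights\<close>

lemma (in scaled_algebra) prod_list_eigen_left:
  assumes "\<And>t. t \<in> set ts \<Longrightarrow> f t * x = sc (g t) x"
  shows "prod_list (map f ts) * x = sc (prod_list (map g ts)) x"
  using assms by (induction ts) (simp_all add: mult.assoc mult.commute)

lemma (in scaled_algebra) prod_list_eigen_right:
  assumes "\<And>t. t \<in> set ts \<Longrightarrow> x * f t = sc (g t) x"
  shows "x * prod_list (map f ts) = sc (prod_list (map g ts)) x"
  using assms by (induction ts) (simp_all flip: mult.assoc)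

lemma prod_list_commute:
  fixes y :: "'a::monoid_mult"
  assumes "\<And>t. t \<in> set ts \<Longrightarrow> f t * y = y * f t"
  shows "prod_list (map f ts) * y = y * prod_list (map f ts)"
  using assms
proof (induction ts)
  case (Cons t ts)
  have "f t * prod_list (map f ts) * y = f t * (y * prod_list (map f ts))" using Cons by (simp add: mult.assoc)
  also have "\<dots> = y * f t * prod_list (map f ts)" using Cons.prems[of t] by (simp flip: mult.assoc)
  finally show ?case by (simp add: mult.assoc)
qed simp

lemma prod_list_map_zero: "a \<in> set xs \<Longrightarrow> f a = 0 \<Longrightarrow> prod_list (map f xs) = (0::'a::semiring_1)"
  by (induction xs) auto

text \<open>Candidates for the highest weights reached by climbing from height h. By
  \<open>Casimir_annihilates\<close>, a weight vector of height h is killed by a product of factors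
  \<open>C - cval \<nu>\<close> with \<nu> in such a list.\<close>

definition partitions_from :: "nat \<Rightarrow> nat \<Rightarrow> int \<Rightarrow> (nat \<Rightarrow> int) list \<Rightarrow> bool" where
  "partitions_from n d h ws \<longleftrightarrow> (\<forall>\<nu>\<in>set ws. partition n d \<nu> \<and> h \<le> height n \<nu>)"

text \<open>The eigenvalue of \<open>qproj w\<close>, defined below, on vectors of weight
  \<open>w'\<close>: nonzero if the two weights agree, and zero at every other weight with entries
  between 0 and d.\<close>

definition qscalar :: "nat \<Rightarrow> nat \<Rightarrow> (nat \<Rightarrow> int) \<Rightarrow> (nat \<Rightarrow> int) \<Rightarrow> qv" where
  "qscalar n d w w' = (\<Prod>a\<leftarrow>[1..<n+1]. \<Prod>t\<leftarrow>filter (\<lambda>t. int t \<noteq> w a) [0..<d+1]. v powi w' a - v ^ t)"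

lemma qscalar_nonzero:
  assumes "\<And>a. a \<in> {1..n} \<Longrightarrow> w' a = w a"
  shows "qscalar n d w w' \<noteq> 0"
proof -
  have "v powi w' a - v ^ t \<noteq> 0" if "int t \<noteq> w a" "a \<in> {1..n}" for a t
    using that assms v_powi_inj[of "w' a" "int t"] by auto
  thus ?thesis by (auto simp: qscalar_def prod_list_zero_iff image_iff simp del: upt_Suc)
qed

lemma qscalar_zero:
  assumes "a \<in> {1..n}" "0 \<le> w' a" "w' a \<le> int d" "w' a \<noteq> w a"
  shows "qscalar n d w w' = 0"
proof -
  have "v powi w' a - v ^ nat (w' a) = 0" using assms by (simp add: power_int_def)
  moreover have "nat (w' a) \<in> set (filter (\<lambda>t. int t \<noteq> w a) [0..<d+1])" using assms by auto
  ultimately have "(\<Prod>t\<leftarrow>filter (\<lambda>t. int t \<noteq> w a) [0..<d+1]. v powi w' a - v ^ t) = 0"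
    by (rule prod_list_map_zero[rotated])
  moreover have "a \<in> set [1..<n+1]" using assms by auto
  ultimately show ?thesis unfolding qscalar_def by (rule prod_list_map_zero[rotated])
qed

text \<open>The algebra of interest is the corner belonging to the idempotent \<open>e\<close>,
  which is its unit. Therefore (Q6) and (Q7) are multiplied by \<open>e\<close>, whereas (Q1)-(Q5)
  are assumed in the whole ring.\<close>

locale schur_quotient = quantum_gl sc n E F K K'
  for sc :: "qv \<Rightarrow> 'a \<Rightarrow> 'a::ring_1" and n E F K K' +
  fixes d :: nat and e :: 'a
  assumes e_idem: "e * e = e"
    and e_comm: "k \<in> {1..<n} \<Longrightarrow> e * E k = E k * e" "k \<in> {1..<n} \<Longrightarrow> e * F k = F k * e"
      "a \<in> {1..n} \<Longrightarrow> e * K a = K a * e"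
    and Q6: "prod_list (map K [1..<n+1]) * e = sc (v ^ d) e"
    and Q7: "a \<in> {1..n} \<Longrightarrow> prod_list (map (\<lambda>t. K a - sc (v ^ t) 1) [0..<d+1]) * e = 0"
begin

lemma e_K': "a \<in> {1..n} \<Longrightarrow> e * K' a = K' a * e"
  using inv_comm[of a e 1] e_comm(3)[of a] by simp

section \<open>Left and right weight vectors\<close>

definition wtl where "wtl x w \<longleftrightarrow> (\<forall>a\<in>{1..n}. K a * x = sc (v powi w a) x)"
definition wtr where "wtr x w \<longleftrightarrow> (\<forall>a\<in>{1..n}. x * K a = sc (v powi w a) x)"

lemma wtl_E: "wtl x w \<Longrightarrow> k \<in> {1..<n} \<Longrightarrow> wtl (E k * x) (raise w k)"
  using KE[THEN qcomm_assoc, of _ k x] unfolding wtl_def raise_def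
  by (simp add: algebra_simps flip: power_int_add)

lemma wtl_F: "wtl x w \<Longrightarrow> k \<in> {1..<n} \<Longrightarrow> wtl (F k * x) (lower w k)"
  using KF[THEN qcomm_assoc, of _ k x] unfolding wtl_def lower_def
  by (simp add: algebra_simps flip: power_int_add)

lemma wtr_F: "wtr x w \<Longrightarrow> k \<in> {1..<n} \<Longrightarrow> wtr (x * F k) (raise w k)"
proof -
  assume w: "wtr x w" and k: "k \<in> {1..<n}"
  have "F k * K a = sc (v powi (dl a k - dl a (k + 1))) (K a * F k)" if "a \<in> {1..n}" for a
    using qcomm_flip[OF KF[OF that k]] by (simp flip: power_int_minus)
  thus ?thesis using w unfolding wtr_def raise_def
    by (simp add: mult.assoc) (simp add: algebra_simps flip: power_int_add mult.assoc)
qed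

lemma wtr_E: "wtr x w \<Longrightarrow> k \<in> {1..<n} \<Longrightarrow> wtr (x * E k) (lower w k)"
proof -
  assume w: "wtr x w" and k: "k \<in> {1..<n}"
  have "E k * K a = sc (v powi (- (dl a k - dl a (k + 1)))) (K a * E k)" if "a \<in> {1..n}" for a
    using qcomm_flip[OF KE[OF that k]] by (simp flip: power_int_minus)
  thus ?thesis using w unfolding wtr_def lower_def
    by (simp add: mult.assoc) (simp add: algebra_simps flip: power_int_add mult.assoc)
qed

lemma K'_wtl: "wtl x w \<Longrightarrow> a \<in> {1..n} \<Longrightarrow> K' a * x = sc (v powi (- w a)) x"
proof -
  assume "wtl x w" "a \<in> {1..n}"
  hence "K' a * (K a * x) = sc (v powi w a) (K' a * x)" by (simp add: wtl_def)
  hence "x = sc (v powi w a) (K' a * x)" using K'K \<open>a \<in> {1..n}\<close> by (simp flip: mult.assoc)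
  hence "sc (v powi (- w a)) x = sc (v powi (- w a) * v powi w a) (K' a * x)" by (metis sc_sc)
  thus ?thesis by (simp flip: power_int_add)
qed

lemma K'_wtr: "wtr x w \<Longrightarrow> a \<in> {1..n} \<Longrightarrow> x * K' a = sc (v powi (- w a)) x"
proof -
  assume "wtr x w" "a \<in> {1..n}"
  hence "x * K a * K' a = sc (v powi w a) (x * K' a)" by (simp add: wtr_def)
  hence "x = sc (v powi w a) (x * K' a)" using KK' \<open>a \<in> {1..n}\<close> by (simp add: mult.assoc)
  hence "sc (v powi (- w a)) x = sc (v powi (- w a) * v powi w a) (x * K' a)" by (metis sc_sc)
  thus ?thesis by (simp flip: power_int_add)
qed

lemma EF_qint_left:
  assumes "wtl x w" "k \<in> {1..<n}"
  shows "E k * (F k * x) = F k * (E k * x) + sc (qint (w k - w (Suc k))) x"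
proof -
  have k: "k \<in> {1..n}" "Suc k \<in> {1..n}" using assms by auto
  have "kk k * x = sc (v powi (w k - w (Suc k))) x" "kk' k * x = sc (v powi (- (w k - w (Suc k)))) x"
    using K'_wtl[OF assms(1)] assms(1) k
    by (simp_all add: kk_def kk'_def mult.assoc wtl_def flip: power_int_add)
  hence "sc (1 / (v - inverse v)) (kk k - kk' k) * x = sc (qint (w k - w (Suc k))) x"
    by (simp add: qint_def left_diff_distrib divide_inverse mult.commute flip: sc_minus)
  thus ?thesis using arg_cong[OF EF'[OF assms(2) assms(2)], of "\<lambda>t. t * x"]
    by (simp add: distrib_right mult.assoc)
qed

lemma EF_qint_right:
  assumes "wtr x w" "k \<in> {1..<n}"
  shows "x * E k * F k = x * F k * E k + sc (qint (w k - w (Suc k))) x"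
proof -
  have k: "k \<in> {1..n}" "Suc k \<in> {1..n}" using assms by auto
  have "x * kk k = sc (v powi (w k - w (Suc k))) x" "x * kk' k = sc (v powi (- (w k - w (Suc k)))) x"
    using K'_wtr[OF assms(1)] assms(1) k
    by (simp_all add: kk_def kk'_def wtr_def flip: power_int_add mult.assoc)
  hence "x * sc (1 / (v - inverse v)) (kk k - kk' k) = sc (qint (w k - w (Suc k))) x"
    by (simp add: qint_def right_diff_distrib divide_inverse mult.commute flip: sc_minus)
  thus ?thesis using arg_cong[OF EF'[OF assms(2) assms(2)], of "\<lambda>t. x * t"]
    by (simp add: distrib_left flip: mult.assoc)
qed

lemma foldr_left: "foldr (\<lambda>t z. K a * z - sc (v ^ t) z) ts x = prod_list (map (\<lambda>t. K a - sc (v ^ t) 1) ts) * x"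
  by (induction ts) (simp_all add: algebra_simps)

text \<open>Iterated right multiplication applies the factors in the opposite order; all of them are
  polynomials in the single element \<open>K a\<close> and commute.\<close>

lemma foldr_right: "foldr (\<lambda>t z. z * K a - sc (v ^ t) z) ts x = x * prod_list (map (\<lambda>t. K a - sc (v ^ t) 1) ts)"
proof (induction ts)
  case (Cons t ts)
  have "prod_list (map (\<lambda>t. K a - sc (v ^ t) 1) ts) * (K a - sc (v ^ t) 1) = (K a - sc (v ^ t) 1) * prod_list (map (\<lambda>t. K a - sc (v ^ t) 1) ts)"
    by (rule prod_list_commute) (simp add: algebra_simps)
  moreover have "y * K a - sc (v ^ t) y = y * (K a - sc (v ^ t) 1)" for y by (simp add: algebra_simps)
  ultimately show ?case using Cons by (simp add: mult.assoc)
qed simp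

lemma left_module:
  assumes J: "\<And>x. x \<in> J \<Longrightarrow> e * x = x" "\<And>x y. x \<in> J \<Longrightarrow> y \<in> J \<Longrightarrow> x - y \<in> J" "\<And>x c. x \<in> J \<Longrightarrow> sc c x \<in> J"
    "\<And>x k. x \<in> J \<Longrightarrow> k \<in> {1..<n} \<Longrightarrow> E k * x \<in> J" "\<And>x k. x \<in> J \<Longrightarrow> k \<in> {1..<n} \<Longrightarrow> F k * x \<in> J"
    "\<And>x a. x \<in> J \<Longrightarrow> a \<in> {1..n} \<Longrightarrow> K a * x \<in> J"
  shows "weight_module sc n d J (\<lambda>a x. K a * x) (\<lambda>k x. E k * x) (\<lambda>k x. F k * x)"
proof unfold_locales
  fix x a assume "x \<in> J" "a \<in> {1..n}"
  moreover from this have "prod_list (map (\<lambda>t. K a - sc (v ^ t) 1) [0..<d + 1]) * e * x = 0"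
    by (simp only: Q7 mult_zero_left)
  ultimately show "foldr (\<lambda>t z. K a * z - sc (v ^ t) z) [0..<d + 1] x = 0"
    unfolding foldr_left by (simp only: mult.assoc J(1))
next
  fix x a b assume "x \<in> J" "a \<in> {1..n}" "b \<in> {1..n}"
  thus "K a * (K b * x) = K b * (K a * x)" by (intro comm_assoc KK)
next
  fix x k w a assume "x \<in> J" "k \<in> {1..<n}" "\<And>a. a \<in> {1..n} \<Longrightarrow> K a * x = sc (v powi w a) x" "a \<in> {1..n}"
  thus "K a * (E k * x) = sc (v powi raise w k a) (E k * x)" "K a * (F k * x) = sc (v powi lower w k a) (F k * x)"
    using wtl_E[of x w k] wtl_F[of x w k] unfolding wtl_def by blast+
next
  fix x k w assume "x \<in> J" "k \<in> {1..<n}" "\<And>a. a \<in> {1..n} \<Longrightarrow> K a * x = sc (v powi w a) x"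
  thus "E k * (F k * x) = F k * (E k * x) + sc (qint (w k - w (Suc k))) x"
    using EF_qint_left[of x w k] unfolding wtl_def by blast
qed (use J in \<open>simp_all add: right_diff_distrib\<close>)

lemma right_module:
  assumes J: "\<And>x. x \<in> J \<Longrightarrow> x * e = x" "\<And>x y. x \<in> J \<Longrightarrow> y \<in> J \<Longrightarrow> x - y \<in> J" "\<And>x c. x \<in> J \<Longrightarrow> sc c x \<in> J"
    "\<And>x k. x \<in> J \<Longrightarrow> k \<in> {1..<n} \<Longrightarrow> x * E k \<in> J" "\<And>x k. x \<in> J \<Longrightarrow> k \<in> {1..<n} \<Longrightarrow> x * F k \<in> J"
    "\<And>x a. x \<in> J \<Longrightarrow> a \<in> {1..n} \<Longrightarrow> x * K a \<in> J"
  shows "weight_module sc n d J (\<lambda>a x. x * K a) (\<lambda>k x. x * F k) (\<lambda>k x. x * E k)"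
proof unfold_locales
  fix x a assume xa: "x \<in> J" "a \<in> {1..n}"
  let ?P = "prod_list (map (\<lambda>t. K a - sc (v ^ t) 1) [0..<d + 1])"
  have "?P * e = e * ?P" by (rule prod_list_commute) (use e_comm(3)[of a] xa in \<open>simp add: algebra_simps\<close>)
  hence "e * ?P = 0" using Q7[OF xa(2)] by simp
  hence "x * e * ?P = 0" by (simp only: mult.assoc mult_zero_right)
  hence "x * ?P = 0" by (simp only: J(1)[OF xa(1)])
  thus "foldr (\<lambda>t z. z * K a - sc (v ^ t) z) [0..<d + 1] x = 0"
    unfolding foldr_right .
next
  fix x a b assume "x \<in> J" "a \<in> {1..n}" "b \<in> {1..n}"
  thus "x * K b * K a = x * K a * K b" by (simp only: mult.assoc KK)
next
  fix x k w a assume "x \<in> J" "k \<in> {1..<n}" "\<And>a. a \<in> {1..n} \<Longrightarrow> x * K a = sc (v powi w a) x" "a \<in> {1..n}"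
  thus "x * F k * K a = sc (v powi raise w k a) (x * F k)" "x * E k * K a = sc (v powi lower w k a) (x * E k)"
    using wtr_F[of x w k] wtr_E[of x w k] unfolding wtr_def by blast+
next
  fix x k w assume "x \<in> J" "k \<in> {1..<n}" "\<And>a. a \<in> {1..n} \<Longrightarrow> x * K a = sc (v powi w a) x"
  thus "x * E k * F k = x * F k * E k + sc (qint (w k - w (Suc k))) x"
    using EF_qint_right[of x w k] unfolding wtr_def by blast
qed (use J in \<open>simp_all add: left_diff_distrib\<close>)

lemma prod_list_powi: "prod_list (map (\<lambda>a. v powi w a) [1..<n+1]) = v powi (\<Sum>a=1..n. w a)"
proof -
  have "prod_list (map (\<lambda>a. v powi w a) ts) = v powi (sum_list (map w ts))" for ts
    by (induction ts) (simp_all add: power_int_add)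
  thus ?thesis
    by (simp add: sum_list_distinct_conv_sum_set atLeastLessThanSuc_atLeastAtMost del: upt_Suc)
qed

lemma wtl_sum:
  assumes "x \<noteq> 0" "e * x = x" "wtl x w"
  shows "(\<Sum>a=1..n. w a) = int d"
proof -
  have "prod_list (map K [1..<n+1]) * x = sc (v powi (\<Sum>a=1..n. w a)) x"
    unfolding prod_list_powi[symmetric]
    by (rule prod_list_eigen_left) (use assms(3) in \<open>auto simp: wtl_def\<close>)
  hence "sc (v powi (\<Sum>a=1..n. w a)) x = prod_list (map K [1..<n+1]) * e * x"
    by (simp add: assms(2) mult.assoc)
  also have "\<dots> = sc (v powi int d) x" unfolding Q6 by (simp add: assms(2))
  finally show ?thesis using assms(1) by (simp add: v_powi_inj del: power_int_of_nat)
qed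

lemma wtr_sum:
  assumes "x \<noteq> 0" "x * e = x" "wtr x w"
  shows "(\<Sum>a=1..n. w a) = int d"
proof -
  let ?P = "prod_list (map K [1..<n+1])"
  have "x * ?P = sc (v powi (\<Sum>a=1..n. w a)) x"
    unfolding prod_list_powi[symmetric]
    by (rule prod_list_eigen_right) (use assms(3) in \<open>auto simp: wtr_def\<close>)
  hence "sc (v powi (\<Sum>a=1..n. w a)) x = x * e * ?P"
    by (simp add: assms(2))
  also have "?P * e = e * ?P"
    by (rule prod_list_commute) (use e_comm(3) in \<open>auto simp del: upt_Suc\<close>)
  hence "x * e * ?P = x * (?P * e)" by (simp only: mult.assoc)
  also have "\<dots> = sc (v powi int d) x" unfolding Q6 by (simp add: assms(2))
  finally show ?thesis using assms(1) by (simp add: v_powi_inj del: power_int_of_nat)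
qed

lemma left_regular: "weight_module sc n d {x. e * x = x} (\<lambda>a x. K a * x) (\<lambda>k x. E k * x) (\<lambda>k x. F k * x)"
  by (rule left_module) (simp_all add: right_diff_distrib comm_assoc[OF e_comm(1)] comm_assoc[OF e_comm(2)] comm_assoc[OF e_comm(3)])

interpretation left: weight_module sc n d "{x. e * x = x}" "\<lambda>a x. K a * x" "\<lambda>k x. E k * x" "\<lambda>k x. F k * x"
  by (rule left_regular)

lemma left_wt: "left.wt = wtl"
  by (intro ext) (simp add: left.wt_def wtl_def)

section \<open>Products of linear factors in the Casimir element\<close>

definition PC :: "(nat \<Rightarrow> int) list \<Rightarrow> 'a" where
  "PC ws = prod_list (map (\<lambda>w. C - sc (cval w) 1) ws)"

lemma PC_comm: "y * C = C * y \<Longrightarrow> PC ws * y = y * PC ws"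
  unfolding PC_def by (rule prod_list_commute) (simp add: algebra_simps)

lemma PC_append: "PC (xs @ ys) = PC xs * PC ys"
  by (simp add: PC_def)

lemma PC_append': "PC (xs @ ys) = PC ys * PC xs"
proof -
  have "PC ys * C = C * PC ys" by (rule PC_comm) simp
  thus ?thesis unfolding PC_append by (rule PC_comm)
qed

lemma PC_concat: "ys \<in> set xss \<Longrightarrow> PC ys * x = 0 \<Longrightarrow> PC (concat xss) * x = 0"
proof (induction xss)
  case (Cons xs xss)
  show ?case
  proof (cases "ys = xs")
    case True
    then show ?thesis using Cons by (simp add: PC_append' mult.assoc)
  next
    case False
    then show ?thesis using Cons by (simp add: PC_append mult.assoc)
  qed
qed simp

lemma e_PC: "e * PC ws = PC ws * e"
proof -
  interpret rev: quantum_gl sc n "\<lambda>i. F (n - i)" "\<lambda>i. E (n - i)" "\<lambda>i. K (Suc n - i)" "\<lambda>i. K' (Suc n - i)"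
    by (rule reversed)
  have L: "e * L i j = L i j * e" if "i \<in> {1..n}" "j \<in> {1..n}" for i j
    by (cases "i \<le> j", rule comm_L) (use that e_comm L_zero in auto)
  have M: "e * M i j = M i j * e" if "i \<in> {1..n}" "j \<in> {1..n}" for i j
    unfolding M_rev by (cases "Suc n - i \<le> Suc n - j", rule rev.comm_L) (use that e_comm rev.L_zero in auto)
  have "e * (L i r * M r j) = L i r * M r j * e" if "i \<in> {1..n}" "j \<in> {1..n}" "r \<in> {1..n}" for i j r
    using comm_assoc[OF L[OF that(1,3)], of "M r j"] M[OF that(3,2)] by (simp only: mult.assoc)
  hence "e * Z i i = Z i i * e" if "i \<in> {1..n}" for i
    using that by (simp add: Z_def sum_distrib_left sum_distrib_right)
  hence "e * C = C * e" by (simp add: C_def sum_distrib_left sum_distrib_right)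
  thus ?thesis by (rule PC_comm[symmetric])
qed

lemma wtl_PC:
  assumes "wtl x w" shows "wtl (PC ws * x) w"
  unfolding wtl_def
proof
  fix a assume a: "a \<in> {1..n}"
  have "K a * (PC ws * x) = PC ws * (K a * x)"
    by (rule comm_assoc[OF PC_comm[OF K_C[OF a], symmetric]])
  thus "K a * (PC ws * x) = sc (v powi w a) (PC ws * x)" using assms a by (simp add: wtl_def)
qed

lemma singular_partition_left:
  assumes "x \<noteq> 0" "e * x = x" "wtl x w" "\<And>k. k \<in> {1..<n} \<Longrightarrow> E k * x = 0"
  shows "partition n d w"
  using assms left.wt_range[of x w] left.singular_dominant[of x w] wtl_sum[of x w]
  unfolding partition_def left_wt by auto

text \<open>Induction from large heights downwards. The vectors \<open>E k * x\<close> are higher,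
  so factors of this kind kill them; since C commutes with E_k, the product of all these factors
  turns x into a singular vector. C acts on it by \<open>cval w\<close>, and unless it is zero
  already, one more factor kills it.\<close>

lemma Casimir_annihilates:
  assumes "e * x = x" "wtl x w"
  shows "\<exists>ws. partitions_from n d (height n w) ws \<and> PC ws * x = 0"
  using assms
proof (induction "nat (int (n * n * d) - height n w)" arbitrary: x w rule: less_induct)
  case less
  show ?case
  proof (cases "x = 0")
    case True
    then show ?thesis by (intro exI[of _ "[]"]) (simp add: partitions_from_def)
  next
    case False
    have hb: "height n w \<le> int (n * n * d)" using left.height_bounds[of x w] less False by (simp add: left_wt)
    have "\<exists>ws. partitions_from n d (height n w) ws \<and> PC ws * (E k * x) = 0" if k: "k \<in> {1..<n}" for k
    proof (cases "E k * x = 0")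
      case True
      then show ?thesis by (intro exI[of _ "[]"]) (simp add: partitions_from_def)
    next
      case False
      have ek: "e * (E k * x) = E k * x" using comm_assoc[OF e_comm(1)[OF k], of x] less(2) by simp
      have "height n (raise w k) \<le> int (n * n * d)"
        using left.height_bounds[of "E k * x" "raise w k"] wtl_E[OF less(3) k] ek False by (simp add: left_wt)
      then show ?thesis using less(1)[of "raise w k" "E k * x"] ek wtl_E[OF less(3) k] height_raise[OF k, of w]
        by (fastforce simp: partitions_from_def)
    qed
    then obtain f where f: "\<And>k. k \<in> {1..<n} \<Longrightarrow> (partitions_from n d (height n w) (f k)) \<and> PC (f k) * (E k * x) = 0"
      by metis
    define ws where "ws = concat (map f [1..<n])"
    have ws: "partitions_from n d (height n w) ws" using f by (auto simp: ws_def partitions_from_def)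
    define y where "y = PC ws * x"
    have Ey: "E k * y = 0" if k: "k \<in> {1..<n}" for k
    proof -
      have "E k * y = PC ws * (E k * x)" unfolding y_def by (rule comm_assoc[OF PC_comm[OF E_C[OF k], symmetric]])
      also have "\<dots> = 0" unfolding ws_def by (rule PC_concat[of "f k"]) (use f k in auto)
      finally show ?thesis .
    qed
    have y: "wtl y w" "e * y = y"
      using wtl_PC[OF less(3)] comm_assoc[OF e_PC, of ws x] less(2) unfolding y_def by simp_all
    show ?thesis
    proof (cases "y = 0")
      case True
      show ?thesis by (rule exI[of _ ws], rule conjI, rule ws) (use True in \<open>simp add: y_def\<close>)
    next
      case False
      have "partition n d w" by (rule singular_partition_left[OF False y(2,1) Ey])
      moreover have "C * y = sc (cval w) y" by (rule C_singular_left) (use y Ey in \<open>auto simp: wtl_def\<close>)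
      hence "PC (w # ws) * x = 0" unfolding y_def by (simp add: PC_def left_diff_distrib mult.assoc)
      ultimately show ?thesis using ws by (intro exI[of _ "w # ws"]) (simp add: partitions_from_def)
    qed
  qed
qed

text \<open>Lagrange interpolation in \<open>K a\<close> without the normalizing denominator: of the
  possible eigenvalues 1, v, ..., v^d it annihilates all except the one belonging to
  \<open>w a\<close>.\<close>

definition qfactor :: "(nat \<Rightarrow> int) \<Rightarrow> nat \<Rightarrow> 'a" where
  "qfactor w a = prod_list (map (\<lambda>t. K a - sc (v ^ t) 1) (filter (\<lambda>t. int t \<noteq> w a) [0..<d+1]))"

definition qproj :: "(nat \<Rightarrow> int) \<Rightarrow> 'a" where
  "qproj w = prod_list (map (qfactor w) [1..<n+1])"

lemma qfactor_comm: "x * K a = K a * x \<Longrightarrow> qfactor w a * x = x * qfactor w a"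
  unfolding qfactor_def by (rule prod_list_commute) (simp add: algebra_simps)

text \<open>\<open>K a - v ^ w a\<close> is the factor of (Q7) that \<open>qfactor w a\<close>
  omits, so restoring it gives zero after multiplication with \<open>e\<close>.\<close>

lemma qfactor_eigen:
  assumes "a \<in> {1..n}" "0 \<le> w a" "w a \<le> int d"
  shows "K a * (qfactor w a * e) = sc (v powi w a) (qfactor w a * e)"
proof -
  define m where "m = nat (w a)"
  have m: "w a = int m" "m \<le> d" using assms by (auto simp: m_def)
  let ?P = "\<lambda>ts. prod_list (map (\<lambda>t. K a - sc (v ^ t) 1) ts)"
  have "[0..<d+1] = [0..<m] @ m # [Suc m..<d+1]"
    using m upt_add_eq_append[of 0 m "d + 1 - m"] upt_conv_Cons[of m "d+1"] by (simp del: upt_Suc)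
  hence s: "?P [0..<d+1] = ?P [0..<m] * ((K a - sc (v ^ m) 1) * ?P [Suc m..<d+1])"
     "qfactor w a = ?P [0..<m] * ?P [Suc m..<d+1]"
    unfolding qfactor_def by (simp_all del: upt_Suc add: m filter_id_conv)
  have "?P [0..<m] * (K a - sc (v ^ m) 1) = (K a - sc (v ^ m) 1) * ?P [0..<m]"
    by (rule prod_list_commute) (simp add: algebra_simps)
  hence "(K a - sc (v ^ m) 1) * qfactor w a = ?P [0..<d+1]"
    unfolding s by (simp only: mult.assoc[symmetric])
  hence "(K a - sc (v ^ m) 1) * (qfactor w a * e) = 0"
    using Q7[OF assms(1)] by (simp only: mult.assoc[symmetric])
  thus ?thesis by (simp add: m left_diff_distrib)
qed

lemma e_qfactor: "a \<in> {1..n} \<Longrightarrow> e * qfactor w a = qfactor w a * e"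
  by (rule qfactor_comm[symmetric]) (rule e_comm)

lemma e_qproj: "e * qproj w = qproj w * e"
  unfolding qproj_def by (rule prod_list_commute[symmetric]) (use e_qfactor in \<open>auto simp del: upt_Suc\<close>)

lemma wtl_qproj:
  assumes "\<And>a. a \<in> {1..n} \<Longrightarrow> 0 \<le> w a \<and> w a \<le> int d"
  shows "wtl (qproj w * e) w"
proof -
  have "set as \<subseteq> {1..n} \<Longrightarrow> a \<in> set as \<Longrightarrow>
      K a * (prod_list (map (qfactor w) as) * e) = sc (v powi w a) (prod_list (map (qfactor w) as) * e)" for a as
  proof (induction as)
    case (Cons b bs)
    let ?R = "prod_list (map (qfactor w) bs)"
    show ?case
    proof (cases "a = b")
      case True
      have "?R * e = e * ?R" by (rule prod_list_commute) (use Cons e_qfactor in auto)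
      hence *: "prod_list (map (qfactor w) (b # bs)) * e = qfactor w b * e * ?R" by (simp add: mult.assoc)
      show ?thesis unfolding * using qfactor_eigen[of a w] Cons assms True
        by (simp flip: mult.assoc)
    next
      case False
      have "K a * (qfactor w b * (?R * e)) = qfactor w b * (K a * (?R * e))"
        by (rule comm_assoc) (use qfactor_comm[of "K a" b w] KK Cons in auto)
      thus ?thesis using Cons False by (simp add: mult.assoc)
    qed
  qed simp
  note * = this
  show ?thesis unfolding wtl_def qproj_def
    by (intro ballI *) (auto simp del: upt_Suc)
qed

lemma qproj_wtl:
  assumes "wtl x w'"
  shows "qproj w * x = sc (qscalar n d w w') x"
  unfolding qproj_def qscalar_def
proof (rule prod_list_eigen_left)
  fix a assume "a \<in> set [1..<n+1]"
  thus "qfactor w a * x = sc (\<Prod>t\<leftarrow>filter (\<lambda>t. int t \<noteq> w a) [0..<d+1]. v powi w' a - v ^ t) x"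
    unfolding qfactor_def using assms
    by (intro prod_list_eigen_left) (auto simp: wtl_def left_diff_distrib sc_minus simp del: upt_Suc)
qed

lemma qproj_wtr:
  assumes "wtr x w'"
  shows "x * qproj w = sc (qscalar n d w w') x"
  unfolding qproj_def qscalar_def
proof (rule prod_list_eigen_right)
  fix a assume "a \<in> set [1..<n+1]"
  thus "x * qfactor w a = sc (\<Prod>t\<leftarrow>filter (\<lambda>t. int t \<noteq> w a) [0..<d+1]. v powi w' a - v ^ t) x"
    unfolding qfactor_def using assms
    by (intro prod_list_eigen_right) (auto simp: wtr_def right_diff_distrib sc_minus simp del: upt_Suc)
qed

end

section \<open>Singular elements of two-sided ideals\<close>

context schur_quotient
begin

text \<open>The ring type is larger than the algebra under study, so the centrality of C has to be
  stated relative to the subalgebra of the generators and \<open>e\<close>.\<close>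

inductive_set generated :: "'a set" where
  "1 \<in> generated"
| "e \<in> generated"
| "k \<in> {1..<n} \<Longrightarrow> E k \<in> generated"
| "k \<in> {1..<n} \<Longrightarrow> F k \<in> generated"
| "a \<in> {1..n} \<Longrightarrow> K a \<in> generated"
| "a \<in> {1..n} \<Longrightarrow> K' a \<in> generated"
| "x \<in> generated \<Longrightarrow> sc c x \<in> generated"
| "x \<in> generated \<Longrightarrow> y \<in> generated \<Longrightarrow> x + y \<in> generated"
| "x \<in> generated \<Longrightarrow> y \<in> generated \<Longrightarrow> x * y \<in> generated"

lemma e_C: "e * C = C * e"
  using e_PC[of "[\<lambda>_. 0]"] by (simp add: PC_def algebra_simps)

lemma C_central: "x \<in> generated \<Longrightarrow> x * C = C * x"
proof (induction rule: generated.induct)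
  case (9 x y)
  show ?case using comm_assoc[OF 9(3), of y] 9(4) by (simp add: mult.assoc)
qed (use e_C E_C F_C K_C K'_C in \<open>simp_all add: distrib_left distrib_right\<close>)

inductive_set F_orbit :: "'a \<Rightarrow> 'a set" for y where
  "y \<in> F_orbit y"
| "z \<in> F_orbit y \<Longrightarrow> k \<in> {1..<n} \<Longrightarrow> F k * z \<in> F_orbit y"

lemma F_span: "z \<in> vs.span (F_orbit y) \<Longrightarrow> k \<in> {1..<n} \<Longrightarrow> F k * z \<in> vs.span (F_orbit y)"
proof (induction rule: vs.span_induct_alt)
  case (step c x z)
  then show ?case
    by (simp add: distrib_left vs.span_add vs.span_scale vs.span_base F_orbit.intros)
qed (simp add: vs.span_zero)

lemma F_orbit_wtl:
  assumes "wtl y w" "z \<in> F_orbit y"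
  shows "\<exists>w'. wtl z w' \<and> (z = y \<and> w' = w \<or> height n w' < height n w)"
  using assms(2)
proof induction
  case (2 z k)
  then obtain w' where w': "wtl z w'" "height n w' \<le> height n w" by auto
  thus ?case using wtl_F[OF w'(1) 2(2)] height_lower[OF 2(2), of w'] by (intro exI[of _ "lower w' k"]) simp
qed (use assms in auto)

text \<open>The argument for highest weight modules: E_k moves to the right through the F's, leaving
  scalars on weight vectors, until it reaches y and kills it.\<close>

lemma generated_span:
  assumes y: "wtl y w" "e * y = y" "\<And>k. k \<in> {1..<n} \<Longrightarrow> E k * y = 0"
    and x: "x \<in> generated" and z: "z \<in> vs.span (F_orbit y)"
  shows "x * z \<in> vs.span (F_orbit y)"
proof -
  have base: "x * z \<in> vs.span (F_orbit y)" if z: "z \<in> vs.span (F_orbit y)"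
    and b: "\<And>z. z \<in> F_orbit y \<Longrightarrow> x * z \<in> vs.span (F_orbit y)" for x z
    using z
  proof (induction rule: vs.span_induct_alt)
    case (step c u z)
    then show ?case using b by (simp add: distrib_left vs.span_add vs.span_scale)
  qed (simp add: vs.span_zero)
  have E: "E k * z \<in> vs.span (F_orbit y)" if k: "k \<in> {1..<n}" and "z \<in> F_orbit y" for k z
    using that(2)
  proof induction
    case 1
    then show ?case using y k by (simp add: vs.span_zero)
  next
    case (2 z j)
    obtain w' where w': "wtl z w'" using F_orbit_wtl[OF y(1) 2(1)] by auto
    have FE: "F j * (E k * z) \<in> vs.span (F_orbit y)" by (rule F_span[OF 2(3,2)])
    show ?case
    proof (cases "k = j")
      case True
      thus ?thesis using EF_qint_left[OF w' k] FE 2(1) by (simp add: vs.span_add vs.span_scale vs.span_base)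
    next
      case False
      have "E k * F j = F j * E k" using EF[OF k 2(2)] False by simp
      thus ?thesis using FE comm_assoc[of "E k" "F j" z] by simp
    qed
  qed
  show ?thesis using x z
  proof (induction arbitrary: z rule: generated.induct)
    case 2
    have "e * z = z" if "z \<in> F_orbit y" for z
      using that by induction (use y comm_assoc[OF e_comm(2)] in simp_all)
    hence "e * z \<in> vs.span (F_orbit y)" if "z \<in> F_orbit y" for z
      using that by (simp add: vs.span_base)
    thus ?case by (rule base[OF 2])
  next
    case (5 a)
    have "K a * z \<in> vs.span (F_orbit y)" if z: "z \<in> F_orbit y" for z
      using F_orbit_wtl[OF y(1) z] 5 z by (auto simp: wtl_def vs.span_scale vs.span_base)
    thus ?case by (rule base[OF 5(2)])
  next
    case (6 a)
    have "K' a * z \<in> vs.span (F_orbit y)" if z: "z \<in> F_orbit y" for z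
      using F_orbit_wtl[OF y(1) z] K'_wtl[of z _ a] 6 z by (auto simp: vs.span_scale vs.span_base)
    thus ?case by (rule base[OF 6(2)])
  next
    case (9 x y')
    then show ?case by (simp add: mult.assoc)
  next
    case (3 k)
    show ?case by (rule base[OF 3(2) E[OF 3(1)]])
  qed (simp_all add: distrib_right vs.span_add vs.span_scale F_span)
qed

text \<open>Every word of positive length in the F's strictly lowers the height, so its image of y
  has a weight other than w and is killed by \<open>qproj w\<close>; only the multiples of y
  survive.\<close>

lemma qproj_span:
  assumes y: "wtl y w" "e * y = y" and z: "z \<in> vs.span (F_orbit y)"
  shows "\<exists>c. qproj w * z = sc c y"
  using z
proof (induction rule: vs.span_induct_alt)
  case base
  show ?case by (intro exI[of _ 0]) simp
next
  case (step c x z)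
  then obtain b where b: "qproj w * z = sc b y" by auto
  obtain w' where w': "wtl x w'" "x = y \<and> w' = w \<or> height n w' < height n w"
    using F_orbit_wtl[OF y(1) step(1)] by auto
  have ex: "e * x = x" using step(1)
    by induction (use y comm_assoc[OF e_comm(2)] in simp_all)
  have "\<exists>b. qproj w * x = sc b y"
  proof (cases "x = 0 \<or> x = y")
    case True
    then show ?thesis
    proof
      assume "x = 0"
      thus ?thesis by (intro exI[of _ 0]) simp
    next
      assume "x = y"
      thus ?thesis using qproj_wtl[OF w'(1), of w] by blast
    qed
  next
    case False
    interpret left: weight_module sc n d "{x. e * x = x}" "\<lambda>a x. K a * x" "\<lambda>k x. E k * x" "\<lambda>k x. F k * x"
      by (rule left_regular)
    have r: "0 \<le> w' a \<and> w' a \<le> int d" if "a \<in> {1..n}" for a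
      using left.wt_range[of x w' a] ex False w'(1) that by (simp add: left.wt_def wtl_def)
    have "\<exists>a\<in>{1..n}. w' a \<noteq> w a"
    proof (rule ccontr)
      assume "\<not> ?thesis"
      hence "height n w' = height n w" unfolding height_def by (intro sum.cong) auto
      thus False using w'(2) False by auto
    qed
    hence "qproj w * x = 0" using qproj_wtl[OF w'(1), of w] qscalar_zero r by fastforce
    then show ?thesis by (intro exI[of _ 0]) simp
  qed
  then obtain b' where "qproj w * x = sc b' y" by auto
  thus ?case using b by (intro exI[of _ "c * b' + b"]) (simp add: distrib_left sc_add_left)
qed

lemma PC_right: "x * C = sc c x \<Longrightarrow> x * PC ws = sc (prod_list (map (\<lambda>w. c - cval w) ws)) x"
  unfolding PC_def by (rule prod_list_eigen_right) (simp add: right_diff_distrib sc_minus)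

text \<open>A nonzero two-sided ideal contains an element that is singular from both sides, of the same
  weight \<open>\<mu>\<close> because the Casimir element is central; such an element is a multiple of the
  projection of \<open>1\<close> to the \<open>\<mu>\<close>-isotypic part of the weight space \<open>\<mu>\<close>.\<close>

lemma nonzero_ideal:
  assumes J: "\<And>x y. x \<in> J \<Longrightarrow> y \<in> J \<Longrightarrow> x - y \<in> J" "\<And>x c. x \<in> J \<Longrightarrow> sc c x \<in> J"
      "\<And>x y. x \<in> J \<Longrightarrow> y \<in> generated \<Longrightarrow> x * y \<in> J" "\<And>x y. x \<in> J \<Longrightarrow> y \<in> generated \<Longrightarrow> y * x \<in> J"
      "J \<subseteq> generated" "\<And>x. x \<in> J \<Longrightarrow> x * e = x"
    and x: "x \<in> J" "x \<noteq> 0"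
  shows "\<exists>\<mu> ws. partition n d \<mu> \<and> partitions_from n d (height n \<mu> + 1) ws \<and>
     PC ws * (qproj \<mu> * e) \<in> J"
proof -
  have J': "e * x = x" if "x \<in> J" for x
  proof -
    have "x \<in> generated" using J(5) that by auto
    hence "e * x = x * e"
    proof induction
      case (9 x y)
      show ?case using comm_assoc[OF 9(3), of y] 9(4) by (simp add: mult.assoc)
    qed (use e_comm e_K' in \<open>simp_all add: distrib_left distrib_right\<close>)
    thus ?thesis using J(6) that by simp
  qed
  interpret left: weight_module sc n d J "\<lambda>a x. K a * x" "\<lambda>k x. E k * x" "\<lambda>k x. F k * x"
    by (rule left_module) (simp_all add: J(1,2,4) J' generated.intros)
  obtain u \<mu> where u: "u \<in> J" "u \<noteq> 0" "\<forall>k\<in>{1..<n}. E k * u = 0" "left.wt u \<mu>"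
    using left.exists_singular[OF x] by auto
  \<comment> \<open>Left singular elements of weight \<mu> are stable under right multiplication. A
    right singular vector found inside this space is therefore singular from both sides.\<close>
  define J1 where "J1 = {z \<in> J. wtl z \<mu> \<and> (\<forall>k\<in>{1..<n}. E k * z = 0)}"
  have u1: "u \<in> J1" using u by (auto simp: J1_def left.wt_def wtl_def)
  have J1_mult: "z * a \<in> J1" if "z \<in> J1" "a \<in> generated" for z a
    using that J(3)[of z a] unfolding J1_def wtl_def by (simp flip: mult.assoc)
  interpret right: weight_module sc n d J1 "\<lambda>a x. x * K a" "\<lambda>k x. x * F k" "\<lambda>k x. x * E k"
  proof (rule right_module)
    show "x - y \<in> J1" if "x \<in> J1" "y \<in> J1" for x y
      using that J(1) by (auto simp: J1_def wtl_def right_diff_distrib sc_minus)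
    show "sc c x \<in> J1" if "x \<in> J1" for x c
      using that J(2) by (auto simp: J1_def wtl_def mult.commute)
    show "x * e = x" if "x \<in> J1" for x using that J(6) by (simp add: J1_def)
  qed (simp_all add: J1_mult generated.intros)
  obtain u \<nu> where u: "u \<in> J1" "u \<noteq> 0" "\<forall>k\<in>{1..<n}. u * F k = 0" "right.wt u \<nu>"
    using right.exists_singular[OF u1 u(2)] by auto
  have uJ: "u \<in> J" "wtl u \<mu>" "\<And>k. k \<in> {1..<n} \<Longrightarrow> E k * u = 0" and ur: "wtr u \<nu>"
    using u by (auto simp: J1_def right.wt_def wtr_def)
  have p: "partition n d \<mu>"
    by (rule singular_partition_left[OF u(2) J'[OF uJ(1)] uJ(2)]) (use uJ(3) in auto)
  have p': "partition n d \<nu>"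
    using right.wt_range[OF u(1,2,4)] right.singular_dominant[OF u(1,2,4)] u(3) wtr_sum[OF u(2) J(6)[OF uJ(1)] ur]
    unfolding partition_def by auto
  have Cu: "C * u = sc (cval \<mu>) u" "u * C = sc (cval \<nu>) u"
    using C_singular_left[of u \<mu>] C_singular_right[of u \<nu>] uJ ur u(3) by (auto simp: wtl_def wtr_def)
  have "u * C = C * u" by (rule C_central) (use J(5) uJ(1) in auto)
  hence "cval \<mu> = cval \<nu>" using Cu u(2) by simp
  hence \<mu>\<nu>: "\<And>a. a \<in> {1..n} \<Longrightarrow> \<nu> a = \<mu> a" using cval_inj[OF p p'] by simp
  hence ur: "wtr u \<mu>" using ur by (simp add: wtr_def)
  have uC: "u * C = sc (cval \<mu>) u" using Cu \<open>cval \<mu> = cval \<nu>\<close> by simp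

  define y0 where "y0 = qproj \<mu> * e"
  have y0: "wtl y0 \<mu>" unfolding y0_def by (rule wtl_qproj) (use p in \<open>auto simp: partition_def\<close>)
  have ey0: "e * y0 = y0" unfolding y0_def using comm_assoc[OF e_qproj, of \<mu> e] by (simp add: e_idem)
  have "\<exists>ws. partitions_from n d (height n \<mu> + 1) ws \<and> PC ws * (E k * y0) = 0" if k: "k \<in> {1..<n}" for k
    using Casimir_annihilates[of "E k * y0" "raise \<mu> k"] wtl_E[OF y0 k] comm_assoc[OF e_comm(1)[OF k], of y0] ey0
      height_raise[OF k, of \<mu>] by simp
  then obtain f where f: "\<And>k. k \<in> {1..<n} \<Longrightarrow> partitions_from n d (height n \<mu> + 1) (f k) \<and> PC (f k) * (E k * y0) = 0"
    by metis
  \<comment> \<open>The list collects, for all k, factors that kill \<open>E k * y0\<close>, so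
    \<open>PC ws * y0\<close> is singular. All partitions in it are strictly higher than \<mu>;
    hence \<open>PC ws\<close> acts on u from the right by a nonzero scalar, called \<open>h\<close>
    below.\<close>
  define ws where "ws = concat (map f [1..<n])"
  have ws: "partitions_from n d (height n \<mu> + 1) ws" using f by (auto simp: ws_def partitions_from_def)
  define y where "y = PC ws * y0"
  have Ey: "E k * y = 0" if k: "k \<in> {1..<n}" for k
  proof -
    have "E k * y = PC ws * (E k * y0)" unfolding y_def by (rule comm_assoc[OF PC_comm[OF E_C[OF k], symmetric]])
    also have "\<dots> = 0" unfolding ws_def by (rule PC_concat[of "f k"]) (use f k in auto)
    finally show ?thesis .
  qed
  have y: "wtl y \<mu>" "e * y = y"
    using wtl_PC[OF y0] comm_assoc[OF e_PC, of ws y0] ey0 unfolding y_def by simp_all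
  define g where "g = qscalar n d \<mu> \<mu>"
  define h where "h = prod_list (map (\<lambda>w. cval \<mu> - cval w) ws)"
  have g: "g \<noteq> 0" unfolding g_def by (rule qscalar_nonzero) simp
  have h: "h \<noteq> 0"
  proof -
    have "cval \<mu> \<noteq> cval w" if "w \<in> set ws" for w
    proof
      assume "cval \<mu> = cval w"
      hence "height n \<mu> = height n w" unfolding height_def
        using cval_inj[OF p, of d w] ws that by (intro sum.cong) (auto simp: partitions_from_def)
      thus False using ws that by (auto simp: partitions_from_def)
    qed
    thus ?thesis unfolding h_def by (auto simp: prod_list_zero_iff image_iff)
  qed
  have uy: "u * y = sc (h * g) u"
  proof -
    have "u * y = u * PC ws * qproj \<mu> * e" by (simp add: y_def y0_def mult.assoc)
    also have "\<dots> = sc (h * g) (u * e)" using PC_right[OF uC] qproj_wtr[OF ur, of \<mu>]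
      by (simp add: g_def h_def del: upt_Suc)
    finally show ?thesis using J(6)[OF uJ(1)] by simp
  qed
  have "u * y \<in> vs.span (F_orbit y)"
    by (rule generated_span[OF y Ey]) (use J(5) uJ(1) vs.span_base F_orbit.intros in auto)
  then obtain c where c: "qproj \<mu> * (u * y) = sc c y" using qproj_span[OF y] by auto
  moreover have "qproj \<mu> * u = sc g u" unfolding g_def by (rule qproj_wtl[OF uJ(2)])
  ultimately have c: "sc (g * h * g) u = sc c y" by (simp add: uy mult_ac)
  have "c \<noteq> 0" using c u(2) g h by auto
  hence "y = sc (inverse c * (g * h * g)) u" using arg_cong[OF c, of "sc (inverse c)"] by simp
  hence "y \<in> J" using J(2) uJ(1) by simp
  thus ?thesis using p ws unfolding y_def y0_def by (intro exI[of _ \<mu>] exI[of _ ws] conjI)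
qed

end

section \<open>Endomorphisms of free vector spaces\<close>

lemma lookup_scale [simp]: "lookup (scale c x) b = c * lookup x b"
  unfolding scale_def by (simp add: Poly_Mapping.map.rep_eq when_def)

lemma scale_single [simp]: "scale c (single b a) = single b (c * a)"
  by (rule poly_mapping_eqI) (simp add: lookup_single when_def)

interpretation pm: vector_space scale
  by standard (rule poly_mapping_eqI; simp add: lookup_add algebra_simps)+

lemma keys_scale: "keys (scale c x) \<subseteq> keys x"
  by (auto simp: in_keys_iff)

lemma lin_ext_superset:
  assumes "finite S" "keys x \<subseteq> S"
  shows "lin_ext f x = (\<Sum>b\<in>S. scale (lookup x b) (f b))"
  unfolding lin_ext_def by (rule sum.mono_neutral_left) (use assms in \<open>auto simp: in_keys_iff\<close>)

lemma lin_ext_add: "lin_ext f (x + y) = lin_ext f x + lin_ext f y"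
proof -
  let ?S = "keys x \<union> keys y"
  have "lin_ext f z = (\<Sum>b\<in>?S. scale (lookup z b) (f b))" if "z \<in> {x, y, x + y}" for z
    by (rule lin_ext_superset) (use that keys_add[of x y] in auto)
  thus ?thesis by (simp add: lookup_add pm.scale_left_distrib sum.distrib)
qed

lemma lin_ext_scale: "lin_ext f (scale c x) = scale c (lin_ext f x)"
proof -
  have "lin_ext f (scale c x) = (\<Sum>b\<in>keys x. scale (lookup (scale c x) b) (f b))"
    by (rule lin_ext_superset) (auto simp: keys_scale[THEN subsetD])
  thus ?thesis by (simp add: lin_ext_def pm.scale_sum_right ac_simps)
qed

lemma lin_ext_single [simp]: "lin_ext f (single b c) = scale c (f b)"
  using lin_ext_superset[of "{b}" "single b c" f] by simp

lemma lin_ext_id: "lin_ext (\<lambda>b. single b 1) x = x"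
proof (rule poly_mapping_eqI)
  fix k
  have "lookup (lin_ext (\<lambda>b. single b 1) x) k = (\<Sum>b\<in>keys x. if b = k then lookup x k else 0)"
    unfolding lin_ext_def lookup_sum by (intro sum.cong) (auto simp: lookup_single when_def)
  thus "lookup (lin_ext (\<lambda>b. single b 1) x) k = lookup x k"
    by (simp add: in_keys_iff)
qed

definition is_linear :: "(('b \<Rightarrow>\<^sub>0 qv) \<Rightarrow> ('c \<Rightarrow>\<^sub>0 qv)) \<Rightarrow> bool" where
  "is_linear f \<longleftrightarrow> (\<forall>x y. f (x + y) = f x + f y) \<and> (\<forall>c x. f (scale c x) = scale c (f x))"

lemma is_linearD: "is_linear f \<Longrightarrow> f (x + y) = f x + f y" "is_linear f \<Longrightarrow> f (scale c x) = scale c (f x)"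
  by (simp_all add: is_linear_def)

lemma is_linear_simps:
  assumes "is_linear f"
  shows "f 0 = 0" "f (- x) = - f x" "f (x - y) = f x - f y" "f (sum g A) = (\<Sum>a\<in>A. f (g a))"
proof -
  have m: "f (- z) = - f z" for z using is_linearD(2)[OF assms, of "- 1" z] by simp
  show z: "f 0 = 0" using is_linearD(2)[OF assms, of 0 0] by simp
  show "f (- x) = - f x" by (rule m)
  show "f (x - y) = f x - f y" using is_linearD(1)[OF assms, of x "- y"] m[of y] by simp
  show "f (sum g A) = (\<Sum>a\<in>A. f (g a))"
    by (induction A rule: infinite_finite_induct) (simp_all add: z is_linearD[OF assms])
qed

lemma is_linear_lin_ext [simp]: "is_linear (lin_ext f)"
  by (simp add: is_linear_def lin_ext_add lin_ext_scale)

text \<open>Agreement is only asked on the support of x, because operators such as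
  \<open>gen_act d g\<close> and \<open>T_gen g\<close> are compared only on tensors of length
  d.\<close>

lemma is_linear_eqI:
  assumes "is_linear f" "is_linear g" "\<And>b. b \<in> keys x \<Longrightarrow> f (single b 1) = g (single b 1)"
  shows "f x = g x"
proof -
  have "h x = (\<Sum>b\<in>keys x. scale (lookup x b) (h (single b 1)))" if "is_linear h" for h :: "('a \<Rightarrow>\<^sub>0 qv) \<Rightarrow> ('b \<Rightarrow>\<^sub>0 qv)"
  proof -
    have "h x = h (lin_ext (\<lambda>b. single b 1) x)" by (simp add: lin_ext_id)
    also have "\<dots> = (\<Sum>b\<in>keys x. h (scale (lookup x b) (single b 1)))"
      unfolding lin_ext_def is_linear_simps(4)[OF that] ..
    finally show ?thesis by (simp only: is_linearD[OF that])
  qed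
  from this[OF assms(1)] this[OF assms(2)] show ?thesis using assms(3) by simp
qed

text \<open>Supplies the ring type for the locales above, once with words of indices (tensor space)
  and once with words of generators (the regular representation of the quotient).\<close>

typedef 'b endo = "{f :: ('b \<Rightarrow>\<^sub>0 qv) \<Rightarrow> ('b \<Rightarrow>\<^sub>0 qv). is_linear f}"
  morphisms app Endo
  by (rule exI[of _ id]) (simp add: is_linear_def)

setup_lifting type_definition_endo

instantiation endo :: (type) ring_1
begin

lift_definition zero_endo :: "'a endo" is "\<lambda>x. 0" by (simp add: is_linear_def)
lift_definition one_endo :: "'a endo" is "\<lambda>x. x" by (simp add: is_linear_def)
lift_definition plus_endo :: "'a endo \<Rightarrow> 'a endo \<Rightarrow> 'a endo" is "\<lambda>f g x. f x + g x"
  by (simp add: is_linear_def pm.scale_right_distrib algebra_simps)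
lift_definition minus_endo :: "'a endo \<Rightarrow> 'a endo \<Rightarrow> 'a endo" is "\<lambda>f g x. f x - g x"
  by (simp add: is_linear_def pm.scale_right_diff_distrib algebra_simps)
lift_definition uminus_endo :: "'a endo \<Rightarrow> 'a endo" is "\<lambda>f x. - f x"
  by (simp add: is_linear_def)
lift_definition times_endo :: "'a endo \<Rightarrow> 'a endo \<Rightarrow> 'a endo" is "\<lambda>f g x. f (g x)"
  by (simp add: is_linear_def)

lemma app_ring [simp]: "app 0 x = 0" "app 1 x = x" "app (f + g) x = app f x + app g x"
  "app (f - g) x = app f x - app g x" "app (- f) x = - app f x" "app (f * g) x = app f (app g x)"
  by (simp_all add: zero_endo.rep_eq one_endo.rep_eq plus_endo.rep_eq minus_endo.rep_eq
      uminus_endo.rep_eq times_endo.rep_eq)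

lemma app_linear [simp]: "is_linear (app f)"
  using app[of f] by simp

lemmas app_lin [simp] = is_linearD[OF app_linear] is_linear_simps[OF app_linear]

lemma app_eqI: "(\<And>x. app f x = app g x) \<Longrightarrow> f = g"
  by (metis app_inject ext)

instance
proof
  show "(0::'a endo) \<noteq> 1"
  proof
    assume "(0::'a endo) = 1"
    hence "app (0::'a endo) (single undefined 1) = app 1 (single undefined 1)" by simp
    thus False by (metis app_ring(1,2) lookup_single_eq lookup_zero one_neq_zero)
  qed
qed (rule app_eqI, simp add: algebra_simps)+

end

lift_definition escale :: "qv \<Rightarrow> 'a endo \<Rightarrow> 'a endo" is "\<lambda>c f x. scale c (f x)"
  by (simp add: is_linear_def pm.scale_right_distrib mult.commute)

lemma app_escale [simp]: "app (escale c f) x = scale c (app f x)"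
  by (simp add: escale.rep_eq)

lemma app_Endo [simp]: "is_linear f \<Longrightarrow> app (Endo f) = f"
  by (simp add: Endo_inverse)

lemma endo_eqI: "(\<And>b. app f (single b 1) = app g (single b 1)) \<Longrightarrow> f = g"
  by (metis app_inject app_linear ext is_linear_eqI)

interpretation en: scaled_algebra "escale :: qv \<Rightarrow> 'b endo \<Rightarrow> 'b endo"
  by unfold_locales (auto intro!: endo_eqI simp: pm.scale_right_distrib pm.scale_left_distrib)

section \<open>The action on tensor space\<close>

definition cons_map :: "nat \<Rightarrow> nat list endo" where
  "cons_map j = Endo (lin_ext (\<lambda>js. single (j # js) 1))"

lemma cons_map_single [simp]: "app (cons_map j) (single js c) = single (j # js) c"
  by (simp add: cons_map_def)

abbreviation cnt :: "nat \<Rightarrow> nat list \<Rightarrow> int" where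
  "cnt i js \<equiv> int (count_list js i)"

text \<open>The comultiplication formula on basis words, for all tensor degrees and all indices at
  once. The power of v is the action of K_i K_{i+1}^{-1} on the remaining letters.\<close>

primrec E_basis :: "nat \<Rightarrow> nat list \<Rightarrow> (nat list \<Rightarrow>\<^sub>0 qv)" where
  "E_basis i [] = 0"
| "E_basis i (j # js) = (if j = i + 1 then single (i # js) (v powi (cnt i js - cnt (i + 1) js)) else 0)
     + app (cons_map j) (E_basis i js)"

primrec F_basis :: "nat \<Rightarrow> nat list \<Rightarrow> (nat list \<Rightarrow>\<^sub>0 qv)" where
  "F_basis i [] = 0"
| "F_basis i (j # js) = (if j = i then single ((i + 1) # js) 1 else 0)
     + scale (v powi (dl j (i + 1) - dl j i)) (app (cons_map j) (F_basis i js))"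

definition "TE i = Endo (lin_ext (E_basis i))"
definition "TF i = Endo (lin_ext (F_basis i))"
definition "TK i = Endo (lin_ext (\<lambda>js. single js (v powi cnt i js)))"
definition "TK' i = Endo (lin_ext (\<lambda>js. single js (v powi (- cnt i js))))"

fun T_gen :: "gl_gen \<Rightarrow> nat list endo" where
  "T_gen (GenE i) = TE i"
| "T_gen (GenF i) = TF i"
| "T_gen (GenK i) = TK i"
| "T_gen (GenKinv i) = TK' i"

lemma TE_single: "app (TE i) (single js c) = scale c (E_basis i js)"
  by (simp add: TE_def)
lemma TF_single: "app (TF i) (single js c) = scale c (F_basis i js)"
  by (simp add: TF_def)
lemma TK_single [simp]: "app (TK i) (single js c) = single js (c * v powi cnt i js)"
  by (simp add: TK_def)
lemma TK'_single [simp]: "app (TK' i) (single js c) = single js (c * v powi (- cnt i js))"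
  by (simp add: TK'_def)

lemma TE_cons [simp]: "app (TE i) (app (cons_map j) x) =
    (if j = i + 1 then app (cons_map i) (app (TK i) (app (TK' (i + 1)) x)) else 0) + app (cons_map j) (app (TE i) x)"
proof -
  have "TE i * cons_map j = (if j = i + 1 then cons_map i * TK i * TK' (i + 1) else 0) + cons_map j * TE i"
    by (rule endo_eqI) (auto simp: TE_single simp del: power_int_of_nat simp flip: power_int_add)
  from arg_cong[OF this, of "\<lambda>f. app f x"] show ?thesis by (simp split: if_splits)
qed

lemma TF_cons [simp]: "app (TF i) (app (cons_map j) x) =
    (if j = i then app (cons_map (i + 1)) x else 0) + scale (v powi (dl j (i + 1) - dl j i)) (app (cons_map j) (app (TF i) x))"
proof -
  have "TF i * cons_map j = (if j = i then cons_map (i + 1) else 0) + escale (v powi (dl j (i + 1) - dl j i)) (cons_map j * TF i)"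
    by (rule endo_eqI) (auto simp: TF_single)
  from arg_cong[OF this, of "\<lambda>f. app f x"] show ?thesis by (simp split: if_splits)
qed

lemma TK_cons [simp]: "app (TK i) (app (cons_map j) x) = scale (v powi dl i j) (app (cons_map j) (app (TK i) x))"
proof -
  have "TK i * cons_map j = escale (v powi dl i j) (cons_map j * TK i)"
    by (rule endo_eqI) (auto simp: dl_def)
  from arg_cong[OF this, of "\<lambda>f. app f x"] show ?thesis by simp
qed

lemma TK'_cons [simp]: "app (TK' i) (app (cons_map j) x) = scale (v powi (- dl i j)) (app (cons_map j) (app (TK' i) x))"
proof -
  have "TK' i * cons_map j = escale (v powi (- dl i j)) (cons_map j * TK' i)"
    by (rule endo_eqI) (auto simp: dl_def power_int_minus power_int_diff divide_inverse)
  from arg_cong[OF this, of "\<lambda>f. app f x"] show ?thesis by simp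
qed

lemma TEF_Nil [simp]: "app (TE i) (single [] c) = 0" "app (TF i) (single [] c) = 0"
  by (simp_all add: TE_single TF_single)

text \<open>Relations between operators are proved by induction on the tensor degree: the rules for
  \<open>cons_map\<close> move the operators past the first tensor factor, where the relation for
  the rest applies.\<close>

lemma endo_list_induct:
  assumes "app f (single [] 1) = app g (single [] 1)"
    "\<And>j x. app f x = app g x \<Longrightarrow> app f (app (cons_map j) x) = app g (app (cons_map j) x)"
  shows "f = (g :: nat list endo)"
proof (rule endo_eqI)
  fix js show "app f (single js 1) = app g (single js 1)"
  proof (induction js)
    case (Cons j js)
    show ?case using assms(2)[OF Cons, of j] by simp
  qed (rule assms(1))
qed

section \<open>The relations (Q1)-(Q5) on tensor space\<close>

lemma TK_comm: "TK a * TK b = TK b * TK a" "TK a * TK' b = TK' b * TK a" "TK' a * TK' b = TK' b * TK' a"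
  by (rule endo_eqI; simp add: mult_ac)+

lemma TK_TK': "TK a * TK' a = 1" "TK' a * TK a = 1"
  by (rule endo_eqI; simp del: power_int_of_nat flip: power_int_add mult.assoc)+

lemma TK_comm_app: "app (TK a) (app (TK b) x) = app (TK b) (app (TK a) x)"
  "app (TK' a) (app (TK b) x) = app (TK b) (app (TK' a) x)" "app (TK' a) (app (TK' b) x) = app (TK' b) (app (TK' a) x)"
  using TK_comm by (metis app_ring(6))+

lemma TK_TE: "TK a * TE k = escale (v powi (dl a k - dl a (k + 1))) (TE k * TK a)" (is "?l = ?r")
proof (rule endo_list_induct)
  fix j x assume "app ?l x = app ?r x"
  thus "app ?l (app (cons_map j) x) = app ?r (app (cons_map j) x)"
    by (simp add: TK_comm_app pm.scale_right_distrib algebra_simps flip: power_int_add)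
qed simp

lemma TK'_TE: "TK' a * TE k = escale (v powi (- (dl a k - dl a (k + 1)))) (TE k * TK' a)"
  using en.inverse_qcomm[OF TK_TK' TK_TE] by (simp only: power_int_minus power_int_eq_0_iff v_nonzero not_False_eq_True simp_thms)

lemma TK_TF: "TK a * TF k = escale (v powi (dl a (k + 1) - dl a k)) (TF k * TK a)" (is "?l = ?r")
proof (rule endo_list_induct)
  fix j x assume "app ?l x = app ?r x"
  thus "app ?l (app (cons_map j) x) = app ?r (app (cons_map j) x)"
    by (simp add: pm.scale_right_distrib algebra_simps flip: power_int_add)
qed simp

lemma TK'_TF: "TK' a * TF k = escale (v powi (- (dl a (k + 1) - dl a k))) (TF k * TK' a)"
  using en.inverse_qcomm[OF TK_TK' TK_TF] by (simp only: power_int_minus power_int_eq_0_iff v_nonzero not_False_eq_True simp_thms)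

lemma TK_app:
  "app (TK a) (app (TE k) x) = scale (v powi (dl a k - dl a (k + 1))) (app (TE k) (app (TK a) x))"
  "app (TK' a) (app (TE k) x) = scale (v powi (- (dl a k - dl a (k + 1)))) (app (TE k) (app (TK' a) x))"
  "app (TK a) (app (TF k) x) = scale (v powi (dl a (k + 1) - dl a k)) (app (TF k) (app (TK a) x))"
  "app (TK' a) (app (TF k) x) = scale (v powi (- (dl a (k + 1) - dl a k))) (app (TF k) (app (TK' a) x))"
  using arg_cong[OF TK_TE, of "\<lambda>f. app f x"] arg_cong[OF TK'_TE, of "\<lambda>f. app f x"]
    arg_cong[OF TK_TF, of "\<lambda>f. app f x"] arg_cong[OF TK'_TF, of "\<lambda>f. app f x"] by simp_all

lemma TE_TF: "TE i * TF j = TF j * TE i +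
   (if i = j then escale (1 / (v - inverse v)) (TK i * TK' (i + 1) - TK' i * TK (i + 1)) else 0)" (is "?l = ?r")
proof (rule endo_list_induct)
  fix l x assume "app ?l x = app ?r x"
  hence IH: "app (TE i) (app (TF j) x) = app (TF j) (app (TE i) x) + (if i = j then scale (1 / (v - inverse v))
      (app (TK i) (app (TK' (i + 1)) x) - app (TK' i) (app (TK (i + 1)) x)) else 0)" by (simp split: if_splits)
  show "app ?l (app (cons_map l) x) = app ?r (app (cons_map l) x)"
  proof (cases "i = j")
    case False
    thus ?thesis by (auto simp: IH TK_app dl_def pm.scale_right_distrib)
  next
    case True
    consider "l = i" | "l = i + 1" | "l \<noteq> i" "l \<noteq> i + 1" by auto
    thus ?thesis
    proof cases
      case 1
      then show ?thesis using True by (simp add: IH[unfolded True] TK_app dl_def pm.scale_right_distrib pm.scale_right_diff_distrib pm.scale_left_distrib v_quotient)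
    next
      case 2
      then show ?thesis using True by (simp add: IH[unfolded True] TK_app dl_def pm.scale_right_distrib pm.scale_right_diff_distrib pm.scale_left_distrib v_quotient)
    next
      case 3
      then show ?thesis using True by (simp add: IH[unfolded True] TK_app dl_def pm.scale_right_distrib pm.scale_right_diff_distrib)
    qed
  qed
qed (auto simp: TK_TK')

lemma TE_comm:
  assumes "\<bar>int i - int j\<bar> \<noteq> 1" shows "TE i * TE j = TE j * TE i" (is "?l = ?r")
proof (rule endo_list_induct)
  fix l x assume "app ?l x = app ?r x"
  thus "app ?l (app (cons_map l) x) = app ?r (app (cons_map l) x)"
    using assms by (cases "i = j") (auto simp: TK_app dl_def)
qed simp

lemma TF_comm:
  assumes "\<bar>int i - int j\<bar> \<noteq> 1" shows "TF i * TF j = TF j * TF i" (is "?l = ?r")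
proof (rule endo_list_induct)
  fix l x assume "app ?l x = app ?r x"
  thus "app ?l (app (cons_map l) x) = app ?r (app (cons_map l) x)"
    using assms by (cases "i = j") (auto simp: TK_app dl_def)
qed simp

lemma TE_serre:
  assumes "\<bar>int i - int j\<bar> = 1"
  shows "TE i * (TE i * TE j) + TE j * (TE i * TE i) = escale (v + inverse v) (TE i * (TE j * TE i))" (is "?l = ?r")
proof (rule endo_list_induct)
  fix l x assume "app ?l x = app ?r x"
  hence IH: "app (TE i) (app (TE i) (app (TE j) x)) = scale (v + inverse v) (app (TE i) (app (TE j) (app (TE i) x)))
     - app (TE j) (app (TE i) (app (TE i) x))" by (simp add: algebra_simps)
  consider "j = i + 1" | "i = j + 1" using assms by linarith
  thus "app ?l (app (cons_map l) x) = app ?r (app (cons_map l) x)"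
  proof cases
    case 1
    show ?thesis unfolding 1
      by (cases "l = i + 1"; cases "l = Suc (Suc i)")
        (simp_all add: IH[unfolded 1, simplified] TK_app dl_def pm.scale_right_distrib pm.scale_left_distrib pm.scale_right_diff_distrib algebra_simps)
  next
    case 2
    show ?thesis unfolding 2
      by (cases "l = j + 1"; cases "l = Suc (Suc j)")
        (simp_all add: IH[unfolded 2, simplified] TK_app dl_def pm.scale_right_distrib pm.scale_left_distrib pm.scale_right_diff_distrib algebra_simps)
  qed
qed simp

lemma TF_serre:
  assumes "\<bar>int i - int j\<bar> = 1"
  shows "TF i * (TF i * TF j) + TF j * (TF i * TF i) = escale (v + inverse v) (TF i * (TF j * TF i))" (is "?l = ?r")
proof (rule endo_list_induct)
  fix l x assume "app ?l x = app ?r x"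
  hence IH: "app (TF i) (app (TF i) (app (TF j) x)) = scale (v + inverse v) (app (TF i) (app (TF j) (app (TF i) x)))
     - app (TF j) (app (TF i) (app (TF i) x))" by (simp add: algebra_simps)
  consider "j = i + 1" | "i = j + 1" using assms by linarith
  thus "app ?l (app (cons_map l) x) = app ?r (app (cons_map l) x)"
  proof cases
    case 1
    show ?thesis unfolding 1
      by (cases "l = i"; cases "l = i + 1"; cases "l = Suc (Suc i)")
        (simp_all add: IH[unfolded 1, simplified] dl_def pm.scale_right_distrib pm.scale_left_distrib pm.scale_right_diff_distrib algebra_simps)
  next
    case 2
    show ?thesis unfolding 2
      by (cases "l = j"; cases "l = j + 1"; cases "l = Suc (Suc j)")
        (simp_all add: IH[unfolded 2, simplified] dl_def pm.scale_right_distrib pm.scale_left_distrib pm.scale_right_diff_distrib algebra_simps)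
  qed
qed simp

interpretation tensor: quantum_gl escale n TE TF TK TK'
  by unfold_locales (use TK_comm TK_TK' TE_TF TK_TE TK_TF TE_serre TF_serre TE_comm TF_comm in auto)

text \<open>The quantum exterior product of the basis vectors with indices in \<open>S\<close>, tensored with \<open>y\<close>.\<close>

function wedge :: "nat set \<Rightarrow> (nat list \<Rightarrow>\<^sub>0 qv) \<Rightarrow> (nat list \<Rightarrow>\<^sub>0 qv)" where
  "wedge S y = (if finite S \<and> S \<noteq> {} then
     (\<Sum>j\<in>S. scale ((- inverse v) ^ card {i\<in>S. i < j}) (app (cons_map j) (wedge (S - {j}) y))) else y)"
  by auto
termination
  by (relation "measure (\<lambda>(S, y). card S)") (auto simp: card_gt_0_iff)

declare wedge.simps [simp del]

lemma wedge_empty [simp]: "wedge {} y = y"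
  by (simp add: wedge.simps)

lemma wedge_step: "finite S \<Longrightarrow> S \<noteq> {} \<Longrightarrow>
    wedge S y = (\<Sum>j\<in>S. scale ((- inverse v) ^ card {i\<in>S. i < j}) (app (cons_map j) (wedge (S - {j}) y)))"
  by (subst wedge.simps) simp

lemma wedge_induct [consumes 1, case_names empty step]:
  assumes "finite S" "P {}" "\<And>S. finite S \<Longrightarrow> S \<noteq> {} \<Longrightarrow> (\<And>j. j \<in> S \<Longrightarrow> P (S - {j})) \<Longrightarrow> P S"
  shows "P (S :: nat set)"
  using assms(1)
proof (induction "card S" arbitrary: S)
  case (Suc m)
  show ?case by (rule assms(3)) (use Suc in auto)
qed (use assms(2) in auto)

lemma TK_wedge:
  assumes "finite S" "app (TK a) y = scale (v powi w) y"
  shows "app (TK a) (wedge S y) = scale (v powi (w + (if a \<in> S then 1 else 0))) (wedge S y)"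
  using assms(1)
proof (induction rule: wedge_induct)
  case (step S)
  have "app (TK a) (app (cons_map j) (wedge (S - {j}) y)) =
      scale (v powi (w + (if a \<in> S then 1 else 0))) (app (cons_map j) (wedge (S - {j}) y))" if "j \<in> S" for j
    using step(3)[OF that] that by (auto simp: dl_def power_int_add)
  then show ?case using step(1,2) by (simp add: wedge_step pm.scale_sum_right mult.commute)
qed (use assms in simp)

lemma TK'_eigen:
  assumes "app (TK a) y = scale (v powi w) y"
  shows "app (TK' a) y = scale (v powi (- w)) y"
proof -
  have "y = app (TK' a) (app (TK a) y)" using TK_TK'(2) by (metis app_ring(2,6))
  hence "scale (v powi (- w)) y = scale (v powi (- w) * v powi w) (app (TK' a) y)" using assms
    by (metis app_lin(2) pm.scale_scale)
  thus ?thesis by (simp flip: power_int_add)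
qed

text \<open>E_i replaces i + 1 by i. If i and i + 1 both lie in S, the two surviving summands, with
  first letters i + 1 and i, give the same vector with coefficients v c(i+1) and c(i) up to a common
  factor. The base \<open>- inverse v\<close> in \<open>wedge\<close> makes c(i+1) = -v^{-1} c(i),
  so that they cancel.\<close>

lemma TE_wedge:
  assumes "finite S" "app (TE i) y = 0" "\<And>a. a \<in> {i, i + 1} \<Longrightarrow> app (TK a) y = scale (v powi (w a)) y"
  shows "app (TE i) (wedge S y) = (if i + 1 \<in> S \<and> i \<notin> S
      then scale (v powi (w i - w (i + 1))) (wedge (insert i (S - {i + 1})) y) else 0)"
  using assms(1)
proof (induction rule: wedge_induct)
  case (step S)
  define c where "c j = (- inverse v) ^ card {i\<in>S. i < j}" for j
  define W where "W j = wedge (S - {j}) y" for j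
  have TKi: "app (TK i) (app (TK' (i + 1)) (W (i + 1))) = scale (v powi (w i - w (i + 1) + (if i \<in> S then 1 else 0))) (W (i + 1))"
    using TK_wedge[of "S - {i+1}" i y "w i"] TK'_eigen[OF TK_wedge[of "S - {i+1}" "i+1" y "w (i+1)"]] assms step(1)
    by (simp add: W_def flip: power_int_add) (simp add: algebra_simps)
  have E: "app (TE i) (wedge S y) = (\<Sum>j\<in>S. scale (c j) (app (TE i) (app (cons_map j) (W j))))"
    unfolding wedge_step[OF step(1,2)] by (simp add: c_def W_def)
  show ?case
  proof (cases "i + 1 \<in> S")
    case False
    have "app (TE i) (app (cons_map j) (W j)) = 0" if "j \<in> S" for j
      using step(3)[OF that] that False by (auto simp: W_def)
    thus ?thesis unfolding E using False by simp
  next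
    case True
    show ?thesis
    proof (cases "i \<in> S")
      case i: True
      have z: "app (TE i) (app (cons_map j) (W j)) = 0" if "j \<in> S - {i, i + 1}" for j
        using step(3)[of j] that i by (auto simp: W_def)
      have "{k\<in>S. k < i + 1} = insert i {k\<in>S. k < i}" using i by auto
      hence c: "c (i + 1) = - inverse v * c i" using step(1) unfolding c_def by simp
      have W: "app (TE i) (W i) = scale (v powi (w i - w (i + 1))) (W (i + 1))"
      proof -
        have "insert i (S - {i} - {i + 1}) = S - {i + 1}" using i by auto
        thus ?thesis using step(3)[OF i] True by (simp add: W_def)
      qed
      have "app (TE i) (W (i + 1)) = 0" using step(3)[OF True] by (simp add: W_def)
      hence 1: "app (TE i) (app (cons_map (i + 1)) (W (i + 1))) = scale (v powi (w i - w (i + 1) + 1)) (app (cons_map i) (W (i + 1)))"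
        using TKi i by simp
      have 2: "app (TE i) (app (cons_map i) (W i)) = scale (v powi (w i - w (i + 1))) (app (cons_map i) (W (i + 1)))"
        using W by simp
      have "app (TE i) (wedge S y) = scale (c (i + 1)) (app (TE i) (app (cons_map (i + 1)) (W (i + 1)))) + scale (c i) (app (TE i) (app (cons_map i) (W i)))"
        unfolding E using step(1) True i z by (subst sum.remove[of _ "i + 1"], simp, simp, subst sum.remove[of _ i]) auto
      also have "\<dots> = 0" unfolding 1 2 c by (simp add: power_int_add mult_ac)
      finally show ?thesis using i by simp
    next
      case i: False
      define S' where "S' = insert i (S - {i + 1})"
      have S': "finite S'" "S' \<noteq> {}" using step by (auto simp: S'_def)
      \<comment> \<open>Replacing i + 1 by i, which is missing from S, preserves the order; hence
        the numbers of smaller elements, and with them the coefficients, stay the same.\<close>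
      define g where "g j = (if j = i + 1 then i else j)" for j
      have g: "bij_betw g S S'" unfolding bij_betw_def inj_on_def g_def S'_def using i True by auto
      have "wedge S' y = (\<Sum>j\<in>S. scale ((- inverse v) ^ card {k\<in>S'. k < g j}) (app (cons_map (g j)) (wedge (S' - {g j}) y)))"
        unfolding wedge_step[OF S'] by (rule sum.reindex_bij_betw[OF g, symmetric])
      also have "scale (v powi (w i - w (i + 1))) \<dots> = (\<Sum>j\<in>S. scale (c j) (app (TE i) (app (cons_map j) (W j))))"
        unfolding pm.scale_sum_right
      proof (rule sum.cong)
        fix j assume j: "j \<in> S"
        have "bij_betw g {k\<in>S. k < j} {k\<in>S'. k < g j}"
          unfolding bij_betw_def inj_on_def g_def S'_def using i True j by (auto split: if_splits simp: less_Suc_eq)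
        hence c: "(- inverse v) ^ card {k\<in>S'. k < g j} = c j" by (simp add: bij_betw_same_card c_def)
        show "scale (v powi (w i - w (i + 1))) (scale ((- inverse v) ^ card {k\<in>S'. k < g j}) (app (cons_map (g j)) (wedge (S' - {g j}) y)))
           = scale (c j) (app (TE i) (app (cons_map j) (W j)))"
        proof (cases "j = i + 1")
          case True
          have "S' - {i} = S - {i + 1}" using i by (auto simp: S'_def)
          moreover have "app (TE i) (W (i + 1)) = 0" using step(3)[OF \<open>i + 1 \<in> S\<close>] by (simp add: W_def)
          ultimately show ?thesis unfolding c using True TKi i by (simp add: g_def W_def mult.commute)
        next
          case False
          have "insert i (S - {j} - {i + 1}) = S' - {j}" using i j False by (auto simp: S'_def)
          hence "app (TE i) (W j) = scale (v powi (w i - w (i + 1))) (wedge (S' - {j}) y)"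
            using step(3)[OF j] True i False by (simp add: W_def)
          thus ?thesis unfolding c using False by (simp add: g_def mult.commute)
        qed
      qed simp
      finally show ?thesis using E True i by (simp add: S'_def)
    qed
  qed
qed (use assms in simp)

text \<open>Words with first letter j come from the j-th summand alone, so the summands cannot
  cancel.\<close>

lemma wedge_nonzero:
  assumes "finite S" "y \<noteq> 0" shows "wedge S y \<noteq> 0"
  using assms(1)
proof (induction rule: wedge_induct)
  case (step S)
  obtain j where j: "j \<in> S" using step by auto
  obtain js where js: "lookup (wedge (S - {j}) y) js \<noteq> 0"
    using step(3)[OF j] by (metis lookup_zero poly_mapping_eqI)
  have lk: "lookup (app (cons_map i) x) (j # js) = (if i = j then lookup x js else 0)" for i x
  proof -
    have "lookup (app (cons_map i) x) (j # js) =
        (if i = j then \<Sum>b\<in>keys x. if b = js then lookup x js else 0 else 0)"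
      by (cases "i = j") (auto simp: cons_map_def lin_ext_def lookup_sum lookup_single when_def intro!: sum.cong sum.neutral)
    thus ?thesis by (simp add: in_keys_iff)
  qed
  have "lookup (wedge S y) (j # js) = (\<Sum>i\<in>S. if i = j then (- inverse v) ^ card {i\<in>S. i < j} * lookup (wedge (S - {j}) y) js else 0)"
    unfolding wedge_step[OF step(1,2)] by (simp add: lookup_sum lk) (intro sum.cong; auto)
  also have "\<dots> \<noteq> 0" using j js step(1) by simp
  finally show ?case by auto
qed (use assms in simp)

section \<open>Membership in the d-th tensor power and singular vectors in it\<close>

lemma keys_cons_map: "keys (app (cons_map j) x) \<subseteq> (#) j ` keys x"
proof -
  have "keys (app (cons_map j) x) \<subseteq> (\<Union>b\<in>keys x. keys (scale (lookup x b) (single (j # b) 1)))"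
    unfolding cons_map_def app_Endo[OF is_linear_lin_ext] lin_ext_def by (rule keys_sum)
  thus ?thesis by (auto split: if_splits)
qed

lemma tensor_space_sum: "(\<And>a. a \<in> A \<Longrightarrow> f a \<in> tensor_space n d) \<Longrightarrow> sum f A \<in> tensor_space n d"
  unfolding tensor_space_def using keys_sum[of f A] by fastforce

lemma tensor_space_scale: "x \<in> tensor_space n d \<Longrightarrow> scale c x \<in> tensor_space n d"
  unfolding tensor_space_def using keys_scale[of c x] by blast

lemma tensor_space_add: "x \<in> tensor_space n d \<Longrightarrow> y \<in> tensor_space n d \<Longrightarrow> x + y \<in> tensor_space n d"
  unfolding tensor_space_def using keys_add[of x y] by blast

lemma tensor_space_zero: "0 \<in> tensor_space n d"
  by (simp add: tensor_space_def)

lemma tensor_space_cons: "x \<in> tensor_space n d \<Longrightarrow> j \<in> {1..n} \<Longrightarrow> app (cons_map j) x \<in> tensor_space n (Suc d)"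
  unfolding tensor_space_def using keys_cons_map[of j x] by fastforce

lemma wedge_tensor_space:
  assumes "finite S" "S \<subseteq> {1..n}" "y \<in> tensor_space n d"
  shows "wedge S y \<in> tensor_space n (card S + d)"
  using assms(1,2)
proof (induction rule: wedge_induct)
  case (step S)
  have "app (cons_map j) (wedge (S - {j}) y) \<in> tensor_space n (card S + d)" if "j \<in> S" for j
  proof -
    have "card S + d = Suc (card (S - {j}) + d)" using card_Suc_Diff1[OF step(1) that] by simp
    moreover have "S - {j} \<subseteq> {1..n}" "j \<in> {1..n}" using step(4) that by auto
    ultimately show ?thesis using tensor_space_cons[OF step(3)[OF that]] by simp
  qed
  thus ?case unfolding wedge_step[OF step(1,2)] by (intro tensor_space_sum tensor_space_scale)
qed (use assms in simp)

lemma exists_singular_vector: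
  assumes "partition n d w"
  shows "\<exists>y\<in>tensor_space n d. y \<noteq> 0 \<and> (\<forall>a\<in>{1..n}. app (TK a) y = scale (v powi w a) y) \<and> (\<forall>k\<in>{1..<n}. app (TE k) y = 0)"
  using assms
proof (induction d arbitrary: w rule: less_induct)
  case (less d)
  note p = less(2)[unfolded partition_def]
  \<comment> \<open>S is the first column of the Young diagram. Since w is decreasing, S contains k
    whenever it contains k + 1, so by \<open>TE_wedge\<close> the exterior product over S is
    singular again; the remaining columns are the partition \<open>w'\<close> of d - |S|.\<close>
  define S where "S = {a\<in>{1..n}. 0 < w a}"
  show ?case
  proof (cases "S = {}")
    case True
    hence "w a = 0" if "a \<in> {1..n}" for a using p that by (force simp: S_def)
    moreover from this have "d = 0" using p by simp
    ultimately show ?thesis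
      by (intro bexI[of _ "single [] 1"]) (auto simp: tensor_space_def poly_mapping_eq_iff fun_eq_iff lookup_single)
  next
    case False
    define w' where "w' a = (if a \<in> S then w a - 1 else w a)" for a
    have S: "finite S" "S \<subseteq> {1..n}" by (auto simp: S_def)
    have "(\<Sum>a=1..n. w' a) = (\<Sum>a=1..n. w a - (if a \<in> S then 1 else 0))"
      by (intro sum.cong) (auto simp: w'_def)
    also have "\<dots> = int d - int (card S)"
      using p S by (simp add: sum_subtractf Int_absorb1 flip: sum.inter_restrict)
    finally have sum: "(\<Sum>a=1..n. w' a) = int d - int (card S)" .
    have nn: "0 \<le> w' a" if "a \<in> {1..n}" for a using p that by (auto simp: w'_def S_def)
    have c: "0 < card S" "card S \<le> d" using S False sum sum_nonneg[of "{1..n}" w'] nn by (auto simp: card_gt_0_iff)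
    have "w' a \<le> int (d - card S)" if "a \<in> {1..n}" for a
    proof -
      have "w' a \<le> (\<Sum>a=1..n. w' a)" by (rule member_le_sum) (use that nn in auto)
      thus ?thesis using sum c by simp
    qed
    moreover have "w' (Suc k) \<le> w' k" if "k \<in> {1..<n}" for k
      using p that by (auto simp: w'_def S_def) force+
    ultimately have "partition n (d - card S) w'" unfolding partition_def using nn sum c by auto
    then obtain y where y: "y \<in> tensor_space n (d - card S)" "y \<noteq> 0"
      "\<And>a. a \<in> {1..n} \<Longrightarrow> app (TK a) y = scale (v powi w' a) y" "\<And>k. k \<in> {1..<n} \<Longrightarrow> app (TE k) y = 0"
      using less(1)[of "d - card S" w'] c by auto
    have "wedge S y \<in> tensor_space n d" using wedge_tensor_space[OF S y(1)] c by simp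
    moreover have "app (TK a) (wedge S y) = scale (v powi w a) (wedge S y)" if "a \<in> {1..n}" for a
      using TK_wedge[OF S(1) y(3)[OF that]] by (simp add: w'_def)
    moreover have "app (TE k) (wedge S y) = 0" if k: "k \<in> {1..<n}" for k
    proof -
      have "k + 1 \<in> S \<Longrightarrow> k \<in> S" using p k by (force simp: S_def)
      moreover have "app (TE k) (wedge S y) = (if k + 1 \<in> S \<and> k \<notin> S
          then scale (v powi (w' k - w' (k + 1))) (wedge (insert k (S - {k + 1})) y) else 0)"
        by (rule TE_wedge[OF S(1) y(4)[OF k]]) (use y(3) k in auto)
      ultimately show ?thesis by auto
    qed
    ultimately show ?thesis using wedge_nonzero[OF S(1) y(2)] by blast
  qed
qed

section \<open>Agreement with the action defined through the comultiplication\<close>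

definition word_length :: "nat \<Rightarrow> (nat list \<Rightarrow>\<^sub>0 qv) \<Rightarrow> bool" where
  "word_length d x \<longleftrightarrow> (\<forall>js\<in>keys x. length js = d)"

lemma tensor_vec_cons: "tensor_vec x y = lin_ext (\<lambda>j. app (cons_map j) y) x"
  by (simp add: tensor_vec_def cons_map_def)

lemma is_linear_tensor_op: "is_linear (tensor_op f g)"
  by (simp add: tensor_op_def)

lemma tensor_op_single: "tensor_op f g (single (j # js) 1) =
    lin_ext (\<lambda>j. app (cons_map j) (g (single js 1))) (f (single j 1))"
  by (simp add: tensor_op_def tensor_vec_cons)

lemma lin_ext_zero [simp]: "lin_ext f 0 = 0"
  by (simp add: is_linear_simps)

lemma gen_act_linear: "is_linear (gen_act d g)"
proof (cases d)
  case 0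
  then show ?thesis by (simp add: is_linear_def pm.scale_right_distrib mult.commute)
next
  case (Suc d)
  then show ?thesis
    by (cases g) (simp_all add: is_linear_tensor_op, simp_all add: is_linear_def is_linearD[OF is_linear_tensor_op] pm.scale_right_distrib algebra_simps)
qed

lemma gen_act_T_gen: "word_length d x \<Longrightarrow> gen_act d g x = app (T_gen g) x"
proof (induction d arbitrary: g x)
  case 0
  show ?case
  proof (rule is_linear_eqI[OF gen_act_linear app_linear])
    fix js assume "js \<in> keys x"
    hence "js = []" using 0 by (simp add: word_length_def)
    thus "gen_act 0 g (single js 1) = app (T_gen g) (single js 1)" by (cases g) simp_all
  qed
next
  case (Suc d)
  show ?case
  proof (rule is_linear_eqI[OF gen_act_linear app_linear])
    fix js assume "js \<in> keys x"
    then obtain j ks where js: "js = j # ks" "length ks = d"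
      using Suc.prems by (cases js) (auto simp: word_length_def)
    have IH: "gen_act d g (single ks c) = app (T_gen g) (single ks c)" for g c
      by (rule Suc.IH) (simp add: word_length_def js)
    show "gen_act (Suc d) g (single js 1) = app (T_gen g) (single js 1)"
      by (cases g) (auto simp: js tensor_op_single nat_act_def IH TE_single TF_single dl_def power_int_minus power_int_diff divide_inverse
           power_int_add mult_ac)
  qed
qed

lemma tensor_space_single: "single js c \<in> tensor_space n d \<longleftrightarrow> c = 0 \<or> length js = d \<and> set js \<subseteq> {1..n}"
  by (simp add: tensor_space_def)

lemma basis_tensor_space:
  assumes "i \<in> {1..<n}" "set js \<subseteq> {1..n}"
  shows "E_basis i js \<in> tensor_space n (length js)" "F_basis i js \<in> tensor_space n (length js)"
  using assms(2)
proof (induction js)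
  case (Cons j js)
  {
    case 1
    then show ?case using Cons assms(1)
      by (auto intro!: tensor_space_add tensor_space_cons tensor_space_zero simp: tensor_space_single)
  next
    case 2
    then show ?case using Cons assms(1)
      by (auto intro!: tensor_space_add tensor_space_scale tensor_space_cons tensor_space_zero simp: tensor_space_single)
  }
qed (simp_all add: tensor_space_zero)

lemma T_gen_tensor_space:
  assumes "g \<in> gl_gens n" "x \<in> tensor_space n d"
  shows "app (T_gen g) x \<in> tensor_space n d"
proof -
  have "app (T_gen g) x = (\<Sum>js\<in>keys x. scale (lookup x js) (app (T_gen g) (single js 1)))"
  proof -
    have "app (T_gen g) x = app (T_gen g) (lin_ext (\<lambda>b. single b 1) x)" by (simp add: lin_ext_id)
    thus ?thesis unfolding lin_ext_def by (simp del: scale_single)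
  qed
  also have "\<dots> \<in> tensor_space n d"
  proof (intro tensor_space_sum tensor_space_scale)
    fix js assume "js \<in> keys x"
    hence js: "length js = d" "set js \<subseteq> {1..n}" using assms(2) by (auto simp: tensor_space_def)
    show "app (T_gen g) (single js 1) \<in> tensor_space n d"
      using assms(1) js basis_tensor_space[of _ n js]
      by (cases g) (auto simp: gl_gens_def TE_single TF_single tensor_space_single)
  qed
  finally show ?thesis .
qed

lemma tensor_space_word_length: "x \<in> tensor_space n d \<Longrightarrow> word_length d x"
  by (auto simp: tensor_space_def word_length_def)

text \<open>The homomorphism from the free algebra given by its universal property. It is used with
  \<open>T_gen\<close> on tensor space and with the counit for the trivial representation.\<close>

definition ev :: "('g \<Rightarrow> 'b endo) \<Rightarrow> ('g free_monoid \<Rightarrow>\<^sub>0 qv) \<Rightarrow> 'b endo" where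
  "ev \<gamma> p = (\<Sum>w\<in>keys p. escale (lookup p w) (prod_list (map \<gamma> (letters w))))"

lemma ev_superset:
  assumes "finite S" "keys p \<subseteq> S"
  shows "ev \<gamma> p = (\<Sum>w\<in>S. escale (lookup p w) (prod_list (map \<gamma> (letters w))))"
  unfolding ev_def by (rule sum.mono_neutral_left) (use assms in \<open>auto simp: in_keys_iff\<close>)

lemma ev_add: "ev \<gamma> (p + q) = ev \<gamma> p + ev \<gamma> q"
proof -
  let ?S = "keys p \<union> keys q"
  have "ev \<gamma> z = (\<Sum>w\<in>?S. escale (lookup z w) (prod_list (map \<gamma> (letters w))))" if "z \<in> {p, q, p + q}" for z
    by (rule ev_superset) (use that keys_add[of p q] in auto)
  thus ?thesis by (simp add: lookup_add en.sc_add_left sum.distrib)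
qed

lemma ev_scale: "ev \<gamma> (scale c p) = escale c (ev \<gamma> p)"
proof -
  have "ev \<gamma> (scale c p) = (\<Sum>w\<in>keys p. escale (lookup (scale c p) w) (prod_list (map \<gamma> (letters w))))"
    by (rule ev_superset) (auto simp: keys_scale[THEN subsetD])
  thus ?thesis by (simp add: ev_def en.vs.scale_sum_right)
qed

lemma ev_single: "ev \<gamma> (single w c) = escale c (prod_list (map \<gamma> (letters w)))"
  using ev_superset[of "{w}" "single w c" \<gamma>] by simp

lemma ev_one: "ev \<gamma> 1 = 1"
  by (simp add: ev_single zero_free_monoid_def flip: single_one)

lemma ev_gen: "ev \<gamma> (gen g) = \<gamma> g"
  by (simp add: gen_def ev_single)

lemma ev_uminus: "ev \<gamma> (- p) = - ev \<gamma> p"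
  using ev_scale[of \<gamma> "- 1" p] by (simp add: en.sc_minus)

lemma ev_diff: "ev \<gamma> (p - q) = ev \<gamma> p - ev \<gamma> q"
  using ev_add[of \<gamma> p "- q"] by (simp add: ev_uminus)

lemma ev_zero: "ev \<gamma> 0 = 0"
  by (simp add: ev_def)

lemma poly_mapping_expand: "(p :: 'b \<Rightarrow>\<^sub>0 qv) = (\<Sum>w\<in>keys p. single w (lookup p w))"
  using lin_ext_id[of p] by (simp add: lin_ext_def)

lemma ev_sum: "ev \<gamma> (sum f A) = (\<Sum>a\<in>A. ev \<gamma> (f a))"
  by (induction A rule: infinite_finite_induct) (simp_all add: ev_zero ev_add)

lemma ev_mult: "ev \<gamma> (p * q) = ev \<gamma> p * ev \<gamma> q"
proof -
  have "p * q = (\<Sum>a\<in>keys p. \<Sum>b\<in>keys q.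
      single (a + b) (lookup p a * lookup q b))"
    by (subst poly_mapping_expand[of p], subst poly_mapping_expand[of q])
       (simp only: sum_product mult_single)
  hence "ev \<gamma> (p * q) = (\<Sum>a\<in>keys p. \<Sum>b\<in>keys q.
      ev \<gamma> (single (a + b) (lookup p a * lookup q b)))"
    by (simp only: ev_sum)
  also have "\<dots> = ev \<gamma> p * ev \<gamma> q"
    unfolding ev_def[of \<gamma> p] ev_def[of \<gamma> q] sum_product
    by (intro sum.cong) (simp_all add: ev_single plus_free_monoid_def mult.commute)
  finally show ?thesis .
qed

lemma app_sum: "app (sum f A) x = (\<Sum>a\<in>A. app (f a) x)"
  by (induction A rule: infinite_finite_induct) simp_all

lemma word_act_T_gen:
  assumes "set gs \<subseteq> gl_gens n" "x \<in> tensor_space n d"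
  shows "foldr (gen_act d) gs x = app (prod_list (map T_gen gs)) x \<and> app (prod_list (map T_gen gs)) x \<in> tensor_space n d"
  using assms(1)
  by (induction gs) (use assms(2) gen_act_T_gen tensor_space_word_length T_gen_tensor_space in auto)

lemma free_act_ev:
  assumes "p \<in> carrier (free_alg (gl_gens n))" "x \<in> tensor_space n d"
  shows "free_act n d p x = app (ev T_gen p) x" "app (ev T_gen p) x \<in> tensor_space n d"
proof -
  have p: "set (letters w) \<subseteq> gl_gens n" if "w \<in> keys p" for w
    using assms(1) that by (auto simp: free_alg_def)
  have e: "app (ev T_gen p) x = (\<Sum>w\<in>keys p. scale (lookup p w) (app (prod_list (map T_gen (letters w))) x))"
    by (simp add: ev_def app_sum)
  show "free_act n d p x = app (ev T_gen p) x"
    unfolding e using assms(2) word_act_T_gen[OF p assms(2)] by (simp add: free_act_def lin_ext_def word_act_def)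
  show "app (ev T_gen p) x \<in> tensor_space n d"
    unfolding e using word_act_T_gen[OF p assms(2)] by (intro tensor_space_sum tensor_space_scale) auto
qed

section \<open>Evaluation of noncommutative polynomials\<close>

abbreviation "gl_free_alg n \<equiv> free_alg (gl_gens n)"

abbreviation fcarrier :: "nat \<Rightarrow> gl_free set" where
  "fcarrier n \<equiv> carrier (gl_free_alg n)"

lemma free_alg_simps [simp]:
  "x \<otimes>\<^bsub>free_alg G\<^esub> y = x * y" "x \<oplus>\<^bsub>free_alg G\<^esub> y = x + y" "\<one>\<^bsub>free_alg G\<^esub> = 1"
  "\<zero>\<^bsub>free_alg G\<^esub> = 0" "c \<odot>\<^bsub>free_alg G\<^esub> x = scale c x"
  by (simp_all add: free_alg_def)

lemma scale_conv_mult: "scale c p = single 0 c * p"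
  by (simp add: scale_def mult_map_scale_conv_mult)

lemma scale_mult_left: "scale c p * q = scale c (p * q)"
  for p q :: "'g free_monoid \<Rightarrow>\<^sub>0 qv"
  by (simp add: scale_conv_mult mult.assoc)

lemma single_zero_comm: "p * single 0 c = single 0 c * p"
  for p :: "'g free_monoid \<Rightarrow>\<^sub>0 qv"
  by (subst (1 2) poly_mapping_expand[of p])
     (simp add: sum_distrib_left sum_distrib_right mult_single mult.commute)

lemma scale_mult_right: "p * scale c q = scale c (p * q)"
  for p q :: "'g free_monoid \<Rightarrow>\<^sub>0 qv"
  by (simp add: scale_conv_mult single_zero_comm flip: mult.assoc)

lemma free_closed:
  "x \<in> carrier (free_alg G) \<Longrightarrow> y \<in> carrier (free_alg G) \<Longrightarrow> x * y \<in> carrier (free_alg G)"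
  "x \<in> carrier (free_alg G) \<Longrightarrow> y \<in> carrier (free_alg G) \<Longrightarrow> x + y \<in> carrier (free_alg G)"
  "x \<in> carrier (free_alg G) \<Longrightarrow> y \<in> carrier (free_alg G) \<Longrightarrow> x - y \<in> carrier (free_alg G)"
  "x \<in> carrier (free_alg G) \<Longrightarrow> scale c x \<in> carrier (free_alg G)"
  "1 \<in> carrier (free_alg G)" "0 \<in> carrier (free_alg G)"
  "x \<in> carrier (free_alg G) \<Longrightarrow> x ^ m \<in> carrier (free_alg G)"
proof -
  interpret A: ring "free_alg G" by (rule ring_free_alg)
  show mult: "x \<in> carrier (free_alg G) \<Longrightarrow> y \<in> carrier (free_alg G) \<Longrightarrow> x * y \<in> carrier (free_alg G)" for x y
    using A.m_closed by simp
  show add: "x \<in> carrier (free_alg G) \<Longrightarrow> y \<in> carrier (free_alg G) \<Longrightarrow> x + y \<in> carrier (free_alg G)" for x y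
    using A.a_closed by simp
  show sc: "x \<in> carrier (free_alg G) \<Longrightarrow> scale c x \<in> carrier (free_alg G)" for x c
    using keys_scale[of c x] by (auto simp: free_alg_def)
  show "x \<in> carrier (free_alg G) \<Longrightarrow> y \<in> carrier (free_alg G) \<Longrightarrow> x - y \<in> carrier (free_alg G)"
    using add[of x "scale (- 1) y"] sc[of y "- 1"] by simp
  show one: "1 \<in> carrier (free_alg G)" using A.one_closed by simp
  show "0 \<in> carrier (free_alg G)" using A.zero_closed by simp
  show "x \<in> carrier (free_alg G) \<Longrightarrow> x ^ m \<in> carrier (free_alg G)"
    by (induction m) (simp_all add: one mult)
qed

lemma gen_carrier: "gen g \<in> carrier (free_alg G) \<longleftrightarrow> g \<in> G"
  by (simp add: gen_def free_alg_def)

lemma gens_mem [simp]: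
  "GenE k \<in> gl_gens n \<longleftrightarrow> k \<in> {1..<n}" "GenF k \<in> gl_gens n \<longleftrightarrow> k \<in> {1..<n}"
  "GenK a \<in> gl_gens n \<longleftrightarrow> a \<in> {1..n}" "GenKinv a \<in> gl_gens n \<longleftrightarrow> a \<in> {1..n}"
  by (auto simp: gl_gens_def)

lemma sum_free_carrier: "(\<And>a. a \<in> S \<Longrightarrow> f a \<in> carrier (free_alg G)) \<Longrightarrow> sum f S \<in> carrier (free_alg G)"
  by (induction S rule: infinite_finite_induct) (simp_all add: free_closed)

lemma prod_list_free_carrier: "(\<And>a. a \<in> set as \<Longrightarrow> f a \<in> carrier (free_alg G)) \<Longrightarrow> prod_list (map f as) \<in> carrier (free_alg G)"
  by (induction as) (simp_all add: free_closed)

lemma inner_prod_alpha: "i \<in> {1..n} \<Longrightarrow> inner_prod n (eps i) (alpha j) = dl i j - dl i (j + 1)"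
proof -
  assume "i \<in> {1..n}"
  have "inner_prod n (eps i) (alpha j) = (\<Sum>k=1..n. if k = i then dl i j - dl i (j + 1) else 0)"
    unfolding inner_prod_def by (intro sum.cong) (auto simp: eps_def alpha_def dl_def)
  thus ?thesis using \<open>i \<in> {1..n}\<close> by simp
qed

definition relations :: "nat \<Rightarrow> gl_free set" where
  "relations n = Q1 n \<union> Q2 n \<union> Q3 n \<union> Q4 n \<union> Q5 n"

lemma relations_carrier: "relations n \<subseteq> fcarrier n"
  unfolding relations_def Q1_def Q2_def Q3_def Q4_def Q5_def serre_def
  by (auto simp: gen_carrier intro!: free_closed)

lemma Q67_carrier: "Q6 n d \<union> Q7 n d \<subseteq> fcarrier n"
  unfolding Q6_def Q7_def scalar_def
  by (auto simp: gen_carrier simp del: upt_Suc intro!: free_closed prod_list_free_carrier)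

text \<open>Instances are \<open>ev T_gen\<close> and the map \<Phi> in
  \<open>acts_zero_imp_ideal_Q\<close>; the latter is shown to be multiplicative only on polynomials
  in the admissible generators. The locale computes the images of \<open>Casimir\<close> and
  \<open>isotypic\<close> for both.\<close>

locale free_hom =
  fixes n :: nat and \<psi> :: "gl_free \<Rightarrow> 'b endo"
  assumes hom: "p \<in> fcarrier n \<Longrightarrow> q \<in> fcarrier n \<Longrightarrow> \<psi> (p * q) = \<psi> p * \<psi> q"
    "p \<in> fcarrier n \<Longrightarrow> q \<in> fcarrier n \<Longrightarrow> \<psi> (p + q) = \<psi> p + \<psi> q"
    "p \<in> fcarrier n \<Longrightarrow> \<psi> (scale c p) = escale c (\<psi> p)"
    "\<psi> 1 = 1"
begin

lemma hom_diff: "p \<in> fcarrier n \<Longrightarrow> q \<in> fcarrier n \<Longrightarrow> \<psi> (p - q) = \<psi> p - \<psi> q"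
  using hom(2)[of p "scale (- 1) q"] hom(3)[of q "- 1"] free_closed(4)[of q "gl_gens n" "- 1"]
  by (simp add: en.sc_minus)

lemma hom_zero: "\<psi> 0 = 0"
  using hom(3)[of 1 0] by (simp add: free_closed)

lemma hom_sum: "(\<And>a. a \<in> S \<Longrightarrow> f a \<in> fcarrier n) \<Longrightarrow> \<psi> (sum f S) = (\<Sum>a\<in>S. \<psi> (f a))"
  by (induction S rule: infinite_finite_induct) (simp_all add: hom hom_zero sum_free_carrier)

lemma hom_prod_list: "(\<And>a. a \<in> set as \<Longrightarrow> f a \<in> fcarrier n) \<Longrightarrow> \<psi> (prod_list (map f as)) = prod_list (map (\<lambda>a. \<psi> (f a)) as)"
  by (induction as) (simp_all add: hom prod_list_free_carrier)

lemma hom_scalar: "\<psi> (scalar c) = escale c 1"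
  by (simp add: scalar_def hom free_closed)

lemma hom_lop:
  assumes "X i \<in> fcarrier n" "\<And>k. i \<le> k \<Longrightarrow> k < i + m \<Longrightarrow> Y k \<in> fcarrier n"
  shows "lop scale X Y i m \<in> fcarrier n \<and> \<psi> (lop scale X Y i m) = lop escale (\<lambda>a. \<psi> (X a)) (\<lambda>a. \<psi> (Y a)) i m"
  using assms(2)
proof (induction m)
  case (Suc m)
  then show ?case by (simp add: free_closed hom hom_diff)
qed (use assms in simp)

lemma hom_Lop:
  assumes "X i \<in> fcarrier n" "\<And>k. i \<le> k \<Longrightarrow> k < j \<Longrightarrow> Y k \<in> fcarrier n"
  shows "Lop scale X Y i j \<in> fcarrier n" "\<psi> (Lop scale X Y i j) = Lop escale (\<lambda>a. \<psi> (X a)) (\<lambda>a. \<psi> (Y a)) i j"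
  using hom_lop[of X i "j - i" Y] assms by (auto simp: Lop_def free_closed hom_zero)

end

text \<open>A lift of \<open>C\<close> to the free algebra: its images on tensor space and in the
  realization of the quotient are the respective elements \<open>C\<close>.\<close>

definition Casimir :: "nat \<Rightarrow> gl_free" where
  "Casimir n = (\<Sum>i=1..n. scale (v ^ (2 * (n - i))) (\<Sum>r=1..n.
     Lop scale Defs.K Defs.F i r * Lop scale (\<lambda>i. Defs.K (Suc n - i)) (\<lambda>i. Defs.E (n - i)) (Suc n - r) (Suc n - i)))"

text \<open>The element \<open>y\<close> of the argument above as a noncommutative polynomial.\<close>

definition isotypic :: "nat \<Rightarrow> nat \<Rightarrow> (nat \<Rightarrow> int) \<Rightarrow> (nat \<Rightarrow> int) list \<Rightarrow> gl_free" where
  "isotypic n d \<mu> ws = prod_list (map (\<lambda>w. Casimir n - scalar (quantum_gl.cval n w)) ws) *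
     prod_list (map (\<lambda>a. prod_list (map (\<lambda>t. Defs.K a - scalar (v ^ t)) (filter (\<lambda>t. int t \<noteq> \<mu> a) [0..<d+1]))) [1..<n+1])"

context free_hom
begin

lemma hom_Casimir:
  "Casimir n \<in> fcarrier n"
  "\<psi> (Casimir n) = (\<Sum>i=1..n. escale (v ^ (2 * (n - i))) (\<Sum>r=1..n.
     Lop escale (\<lambda>i. \<psi> (Defs.K i)) (\<lambda>i. \<psi> (Defs.F i)) i r *
     Lop escale (\<lambda>i. \<psi> (Defs.K (Suc n - i))) (\<lambda>i. \<psi> (Defs.E (n - i))) (Suc n - r) (Suc n - i)))" (is "?C = ?S")
proof -
  note * = hom_Lop[of Defs.K _ _ Defs.F] hom_Lop[of "\<lambda>i. Defs.K (Suc n - i)" "Suc n - _" "Suc n - _" "\<lambda>i. Defs.E (n - i)"]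
  show "Casimir n \<in> fcarrier n" unfolding Casimir_def
    by (intro sum_free_carrier free_closed *) (auto simp: gen_carrier)
  show "?C = ?S"
    unfolding Casimir_def
    by (subst hom_sum, (intro sum_free_carrier free_closed *; auto simp: gen_carrier), intro sum.cong refl,
        subst hom(3), (intro sum_free_carrier free_closed *; auto simp: gen_carrier), intro arg_cong[of _ _ "escale _"],
        subst hom_sum, (intro sum_free_carrier free_closed *; auto simp: gen_carrier), intro sum.cong refl,
        subst hom(1), (intro *; auto simp: gen_carrier), (intro *; auto simp: gen_carrier),
        intro arg_cong2[of _ _ _ _ "(*)"] *; auto simp: gen_carrier)
qed

lemma hom_isotypic:
  "isotypic n d \<mu> ws \<in> fcarrier n"
  "\<psi> (isotypic n d \<mu> ws) = prod_list (map (\<lambda>w. \<psi> (Casimir n) - escale (quantum_gl.cval n w) 1) ws) *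
     prod_list (map (\<lambda>a. prod_list (map (\<lambda>t. \<psi> (Defs.K a) - escale (v ^ t) 1) (filter (\<lambda>t. int t \<noteq> \<mu> a) [0..<d+1]))) [1..<n+1])" (is "?I = ?S")
proof -
  let ?K = "\<lambda>a. prod_list (map (\<lambda>t. Defs.K a - scalar (v ^ t)) (filter (\<lambda>t. int t \<noteq> \<mu> a) [0..<d+1]))"
  have s: "scalar c \<in> fcarrier n" for c by (simp add: scalar_def free_closed)
  have c: "Casimir n - scalar c \<in> fcarrier n" for c by (simp add: free_closed s hom_Casimir)
  have k: "Defs.K a - scalar c \<in> fcarrier n" if "a \<in> set [1..<n+1]" for a c
    using that by (auto intro!: free_closed s simp: gen_carrier)
  have k': "?K a \<in> fcarrier n"
    if "a \<in> set [1..<n+1]" for a by (intro prod_list_free_carrier k that)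
  show "isotypic n d \<mu> ws \<in> fcarrier n" unfolding isotypic_def
    by (intro free_closed prod_list_free_carrier c k')
  have K: "\<psi> (?K a) =
     prod_list (map (\<lambda>t. \<psi> (Defs.K a) - escale (v ^ t) 1) (filter (\<lambda>t. int t \<noteq> \<mu> a) [0..<d+1]))" if a: "a \<in> set [1..<n+1]" for a
  proof -
    have "\<psi> (Defs.K a - scalar c) = \<psi> (Defs.K a) - escale c 1" for c
      using a by (simp add: hom_diff hom_scalar s gen_carrier del: upt_Suc)
    thus ?thesis by (subst hom_prod_list) (simp_all only: k[OF a])
  qed
  have C: "\<psi> (Casimir n - scalar c) = \<psi> (Casimir n) - escale c 1" for c
    by (simp add: hom_diff hom_scalar s hom_Casimir(1))
  show "?I = ?S"
    unfolding isotypic_def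
    by (subst hom(1), intro prod_list_free_carrier c, intro prod_list_free_carrier k', assumption,
        subst hom_prod_list, rule c, subst hom_prod_list, erule k', intro arg_cong2[of _ _ _ _ "(*)"] arg_cong[of _ _ prod_list] map_cong refl C K)
qed

end

section \<open>The defining relations and the kernel of the action on tensor space\<close>

lemma free_hom_ev: "free_hom n (ev \<gamma>)"
  by unfold_locales (simp_all add: ev_mult ev_add ev_scale ev_one)

lemma ev_relations: "r \<in> relations n \<Longrightarrow> ev T_gen r = 0"
proof -
  note ev = ev_add ev_diff ev_mult ev_scale ev_gen ev_one ev_zero T_gen.simps power2_eq_square mult.assoc
  have serre: "r \<in> serre n X \<Longrightarrow> ev T_gen r = 0"
    if "\<And>i j. \<bar>int i - int j\<bar> = 1 \<Longrightarrow> T i * (T i * T j) + T j * (T i * T i) = escale (v + inverse v) (T i * (T j * T i))"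
      "\<And>i j. \<bar>int i - int j\<bar> \<noteq> 1 \<Longrightarrow> T i * T j = T j * T i" "\<And>i. ev T_gen (X i) = T i" for X T
    unfolding serre_def
  proof (elim UnE CollectE exE conjE)
    fix i j assume ij: "\<bar>int i - int j\<bar> = 1"
      and r: "r = X i ^ 2 * X j - scale (v + inverse v) (X i * X j * X i) + X j * X i ^ 2"
    show "ev T_gen r = 0" using that(1)[OF ij] unfolding r ev that(3) by (simp add: algebra_simps)
  next
    fix i j assume ij: "\<bar>int i - int j\<bar> \<noteq> 1" and r: "r = X i * X j - X j * X i"
    show "ev T_gen r = 0" using that(2)[OF ij] unfolding r ev that(3) by simp
  qed
  assume "r \<in> relations n"
  then consider "r \<in> Q1 n" | "r \<in> Q2 n" | "r \<in> Q3 n" | "r \<in> Q4 n" | "r \<in> Q5 n"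
    unfolding relations_def by blast
  thus ?thesis
  proof cases
    case 1
    thus ?thesis unfolding Q1_def using TK_comm(1) by (auto simp: ev TK_TK')
  next
    case 2
    then obtain i j where r: "r = Defs.E i * Defs.F j - Defs.F j * Defs.E i
             - (if i = j then scale (1 / (v - inverse v)) (Defs.K i * Defs.Kinv (i + 1) - Defs.Kinv i * Defs.K (i + 1)) else 0)"
      unfolding Q2_def by auto
    show ?thesis unfolding r by (cases "i = j") (simp_all add: ev TE_TF)
  next
    case 3
    thus ?thesis unfolding Q3_def by (auto simp: ev TK_TE TK_TF inner_prod_alpha)
  next
    case 4
    thus ?thesis unfolding Q4_def by (rule serre[rotated 3]) (use TE_serre TE_comm in \<open>auto simp: ev\<close>)
  next
    case 5
    thus ?thesis unfolding Q5_def by (rule serre[rotated 3]) (use TF_serre TF_comm in \<open>auto simp: ev\<close>)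
  qed
qed

definition acts_zero :: "nat \<Rightarrow> nat \<Rightarrow> gl_free \<Rightarrow> bool" where
  "acts_zero n d p \<longleftrightarrow> (\<forall>x\<in>tensor_space n d. app (ev T_gen p) x = 0)"

lemma prod_list_K_app: "app (prod_list (map TK as)) (single js c) =
    single js (c * v powi (\<Sum>a\<leftarrow>as. cnt a js))"
  by (induction as) (simp_all add: power_int_add mult_ac del: power_int_of_nat)

lemma acts_zeroI:
  assumes "\<And>js. length js = d \<Longrightarrow> set js \<subseteq> {1..n} \<Longrightarrow> app (ev T_gen p) (single js 1) = 0"
  shows "acts_zero n d p"
  unfolding acts_zero_def
proof
  fix x assume x: "x \<in> tensor_space n d"
  have "app (ev T_gen p) x = app 0 x"
    by (rule is_linear_eqI[OF app_linear app_linear]) (use x assms in \<open>auto simp: tensor_space_def\<close>)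
  thus "app (ev T_gen p) x = 0" by simp
qed

lemma acts_zero_Q67: "r \<in> Q6 n d \<union> Q7 n d \<Longrightarrow> acts_zero n d r"
proof (rule acts_zeroI)
  interpret free_hom n "ev T_gen" by (rule free_hom_ev)
  fix js assume r: "r \<in> Q6 n d \<union> Q7 n d" and js: "length js = d" "set js \<subseteq> {1..n}"
  have ev_list: "ev T_gen (prod_list (map f as)) = prod_list (map (\<lambda>a. ev T_gen (f a)) as)" for f and as :: "nat list"
    by (induction as) (simp_all add: ev_one ev_mult)
  from r show "app (ev T_gen r) (single js 1) = 0"
  proof
    assume "r \<in> Q6 n d"
    moreover have "(\<Sum>a\<leftarrow>[1..<n+1]. cnt a js) = int d"
    proof -
      have "(\<Sum>a\<leftarrow>[1..<n+1]. cnt a js) = (\<Sum>a=1..n. cnt a js)"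
        by (simp add: sum_list_distinct_conv_sum_set atLeastLessThanSuc_atLeastAtMost del: upt_Suc)
      thus ?thesis using js by (simp add: sum_count_set flip: of_nat_sum del: upt_Suc)
    qed
    ultimately show ?thesis
      by (simp add: Q6_def ev_diff ev_list ev_gen hom_scalar prod_list_K_app del: upt_Suc)
  next
    assume "r \<in> Q7 n d"
    then obtain i where r: "r = prod_list (map (\<lambda>t. Defs.K i - scalar (v ^ t)) [0..<d+1])" by (auto simp: Q7_def)
    have *: "app (prod_list (map (\<lambda>t. TK i - escale (v ^ t) 1) ts)) (single js 1) =
      scale (prod_list (map (\<lambda>t. v powi cnt i js - v ^ t) ts)) (single js 1)" for ts
      by (induction ts) (simp_all del: power_int_of_nat add: single_diff[symmetric] algebra_simps)
    have "prod_list (map (\<lambda>t. v powi cnt i js - v ^ t) [0..<d+1]) = 0"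
      by (rule prod_list_map_zero[of "count_list js i"]) (use count_le_length[of js i] js in auto)
    thus ?thesis unfolding r by (simp add: ev_list ev_diff ev_gen hom_scalar * del: upt_Suc)
  qed
qed

lemma acts_zero_ideal: "ideal {p \<in> fcarrier n. acts_zero n d p} (gl_free_alg n)" (is "ideal ?J _")
proof (rule idealI[OF ring_free_alg])
  interpret A: ring "gl_free_alg n" by (rule ring_free_alg)
  show "subgroup ?J (add_monoid (gl_free_alg n))"
  proof (rule A.add.subgroupI)
    show "?J \<noteq> {}" using free_closed(6) by (auto simp: acts_zero_def ev_zero)
    fix p q assume pq: "p \<in> ?J"
    have "- p \<in> fcarrier n" using free_closed(4)[of p "gl_gens n" "- 1"] pq by simp
    moreover from this have "\<ominus>\<^bsub>gl_free_alg n\<^esub> p = - p"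
      by (intro A.minus_equality[symmetric, THEN sym]) (use pq in auto)
    ultimately show "\<ominus>\<^bsub>gl_free_alg n\<^esub> p \<in> ?J"
      using pq by (simp add: acts_zero_def ev_uminus)
    assume "q \<in> ?J"
    thus "p \<oplus>\<^bsub>gl_free_alg n\<^esub> q \<in> ?J"
      using pq by (simp add: acts_zero_def ev_add free_closed)
  qed auto
  fix p q assume "p \<in> ?J" "q \<in> fcarrier n"
  thus "q \<otimes>\<^bsub>gl_free_alg n\<^esub> p \<in> ?J"
    "p \<otimes>\<^bsub>gl_free_alg n\<^esub> q \<in> ?J"
    using free_act_ev(2)[of q n _ d] by (auto simp: acts_zero_def ev_mult free_closed)
qed

lemma isotypic_acts_nonzero:
  assumes "partition n d \<mu>" "partitions_from n d (height n \<mu> + 1) ws"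
  shows "\<not> acts_zero n d (isotypic n d \<mu> ws)"
proof -
  interpret free_hom n "ev T_gen" by (rule free_hom_ev)
  let ?C = "quantum_gl.C escale n TE TF TK"
  obtain y where y: "y \<in> tensor_space n d" "y \<noteq> 0" "\<And>a. a \<in> {1..n} \<Longrightarrow> app (TK a) y = scale (v powi \<mu> a) y"
    "\<And>k. k \<in> {1..<n} \<Longrightarrow> app (TE k) y = 0" using exists_singular_vector[OF assms(1)] by auto
  \<comment> \<open>The lemmas on \<open>C\<close> speak of ring elements, not of vectors. An
    operator of rank one with image spanned by y is a ring element that is singular of weight \<mu>
    from the left; applied to the empty word it returns y.\<close>
  define X :: "nat list endo" where "X = Endo (\<lambda>z. scale (lookup z []) y)"
  have X: "app X z = scale (lookup z []) y" for z
    unfolding X_def by (subst app_Endo) (simp_all add: is_linear_def lookup_add pm.scale_left_distrib)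
  have KX: "TK a * X = escale (v powi \<mu> a) X" if "a \<in> {1..n}" for a
    by (rule app_eqI) (simp add: X y(3)[OF that] mult.commute)
  have EX: "TE k * X = 0" if "k \<in> {1..<n}" for k
    by (rule app_eqI) (simp add: X y(4)[OF that])
  have C: "ev T_gen (Casimir n) = ?C"
    unfolding hom_Casimir(2) tensor.C_def tensor.Z_def tensor.L_def tensor.M_def ev_gen by (simp cong: sum.cong)
  have CX: "?C * X = escale (quantum_gl.cval n \<mu>) X" by (rule tensor.C_singular_left[OF EX KX])
  let ?g = "prod_list (map (\<lambda>w. quantum_gl.cval n \<mu> - quantum_gl.cval n w) ws)"
  let ?h = "qscalar n d \<mu> \<mu>"
  have 1: "prod_list (map (\<lambda>w. ?C - escale (quantum_gl.cval n w) 1) ws) * X = escale ?g X"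
    by (rule en.prod_list_eigen_left) (simp add: left_diff_distrib CX en.sc_minus)
  have 2: "prod_list (map (\<lambda>a. prod_list (map (\<lambda>t. TK a - escale (v ^ t) 1) (filter (\<lambda>t. int t \<noteq> \<mu> a) [0..<d+1]))) [1..<n+1]) * X = escale ?h X"
    unfolding qscalar_def by (intro en.prod_list_eigen_left) (auto simp: left_diff_distrib KX en.sc_minus simp del: upt_Suc)
  have "?g \<noteq> 0"
  proof -
    have "quantum_gl.cval n \<mu> \<noteq> quantum_gl.cval n w" if "w \<in> set ws" for w
    proof
      assume eq: "quantum_gl.cval n \<mu> = quantum_gl.cval n w"
      hence "height n \<mu> = height n w" unfolding height_def
        using tensor.cval_inj[OF assms(1) _ eq, of d] assms(2) that
        by (intro sum.cong) (auto simp: partitions_from_def)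
      thus False using assms(2) that by (auto simp: partitions_from_def)
    qed
    thus ?thesis by (auto simp: prod_list_zero_iff image_iff)
  qed
  moreover have "?h \<noteq> 0" by (rule qscalar_nonzero) simp
  moreover have "ev T_gen (isotypic n d \<mu> ws) * X = escale (?g * ?h) X"
    unfolding hom_isotypic(2) C ev_gen T_gen.simps mult.assoc 2 by (simp add: 1 mult.commute del: upt_Suc)
  from arg_cong[OF this, of "\<lambda>f. app f (single [] 1)"]
  have "app (ev T_gen (isotypic n d \<mu> ws)) y = scale (?g * ?h) y" by (simp add: X del: upt_Suc)
  ultimately have "app (ev T_gen (isotypic n d \<mu> ws)) y \<noteq> 0" using y(2) by (simp del: upt_Suc)
  thus ?thesis using y(1) unfolding acts_zero_def by blast
qed

section \<open>Faithfulness\<close>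

text \<open>A linear choice of representatives modulo I, that is, the projection onto a complement
  of I.\<close>

lemma exists_projection:
  assumes "pm.subspace (I :: ('b \<Rightarrow>\<^sub>0 qv) set)"
  shows "\<exists>f. is_linear f \<and> (\<forall>x. f x - x \<in> I) \<and> (\<forall>x\<in>I. f x = 0)"
proof -
  interpret p: vector_space_pair "scale :: qv \<Rightarrow> ('b \<Rightarrow>\<^sub>0 qv) \<Rightarrow> _" "scale :: qv \<Rightarrow> ('b \<Rightarrow>\<^sub>0 qv) \<Rightarrow> _" ..
  obtain g where g: "range g \<subseteq> I" "Vector_Spaces.linear scale scale g" "\<forall>x\<in>I. g (id x) = x"
    using p.linear_exists_left_inverse_on[OF pm.linear_id assms] by auto
  have "is_linear (\<lambda>x. x - g x)"
    using g(2) by (simp add: Vector_Spaces.linear_iff is_linear_def pm.scale_right_diff_distrib)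
  moreover have "x - g x - x \<in> I" for x using g(1) pm.subspace_neg[OF assms, of "g x"] by auto
  ultimately show ?thesis using g(3) by (intro exI[of _ "\<lambda>x. x - g x"]) simp
qed

lemma prod_list_escale: "prod_list (map (\<lambda>g. escale (c g) 1) gs) = escale (prod_list (map c gs)) 1"
  by (induction gs) (simp_all add: mult.commute)

lemma ev_scalar:
  "ev (\<lambda>g. escale (c g) 1) p = escale (\<Sum>w\<in>keys p. lookup p w * prod_list (map c (letters w))) 1"
  by (simp add: ev_def prod_list_escale en.vs.scale_sum_left)

section \<open>The ideal of all relations\<close>

definition ideal_Q :: "nat \<Rightarrow> nat \<Rightarrow> gl_free set" where
  "ideal_Q n d = Idl\<^bsub>gl_free_alg n\<^esub> (relations n \<union> Q6 n d \<union> Q7 n d)"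

lemma relations_Q67_carrier: "relations n \<union> Q6 n d \<union> Q7 n d \<subseteq> fcarrier n"
  using relations_carrier Q67_carrier by blast

lemma ideal_closed:
  assumes "ideal I (gl_free_alg n)"
  shows "I \<subseteq> fcarrier n" "0 \<in> I" "x \<in> I \<Longrightarrow> y \<in> I \<Longrightarrow> x + y \<in> I"
    "x \<in> I \<Longrightarrow> a \<in> fcarrier n \<Longrightarrow> a * x \<in> I" "x \<in> I \<Longrightarrow> a \<in> fcarrier n \<Longrightarrow> x * a \<in> I"
    "x \<in> I \<Longrightarrow> scale c x \<in> I" "x \<in> I \<Longrightarrow> y \<in> I \<Longrightarrow> x - y \<in> I"
proof -
  interpret ideal I "gl_free_alg n" by (rule assms)
  show "I \<subseteq> fcarrier n" by (rule a_subset)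
  show "0 \<in> I" using additive_subgroup.zero_closed[OF ideal.axioms(1)[OF assms]] by simp
  show add: "x \<in> I \<Longrightarrow> y \<in> I \<Longrightarrow> x + y \<in> I" for x y
    using additive_subgroup.a_closed[OF ideal.axioms(1)[OF assms]] by simp
  show mult: "x \<in> I \<Longrightarrow> a \<in> fcarrier n \<Longrightarrow> a * x \<in> I" for x a using I_l_closed by simp
  show "x \<in> I \<Longrightarrow> a \<in> fcarrier n \<Longrightarrow> x * a \<in> I" using I_r_closed by simp
  show sc: "x \<in> I \<Longrightarrow> scale c x \<in> I" for x c
    using mult[OF _ free_closed(4)[OF free_closed(5)], of x c] by (simp add: scale_mult_left)
  show "x \<in> I \<Longrightarrow> y \<in> I \<Longrightarrow> x - y \<in> I" using add[of x "scale (- 1) y"] sc[of y "- 1"] by simp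
qed

lemma ideal_ideal_Q: "ideal (ideal_Q n d) (gl_free_alg n)"
  unfolding ideal_Q_def by (rule ring.genideal_ideal[OF ring_free_alg relations_Q67_carrier])

lemma ideal_Q_acts_zero: "p \<in> ideal_Q n d \<Longrightarrow> acts_zero n d p"
proof -
  have "relations n \<union> Q6 n d \<union> Q7 n d \<subseteq> {p \<in> fcarrier n. acts_zero n d p}"
  proof
    fix r assume r: "r \<in> relations n \<union> Q6 n d \<union> Q7 n d"
    hence "acts_zero n d r"
      using acts_zero_Q67[of r n d] ev_relations[of r n] by (auto simp: acts_zero_def)
    thus "r \<in> {p \<in> fcarrier n. acts_zero n d p}" using r relations_Q67_carrier by blast
  qed
  hence "ideal_Q n d \<subseteq> {p \<in> fcarrier n. acts_zero n d p}"
    unfolding ideal_Q_def by (rule ring.genideal_minimal[OF ring_free_alg acts_zero_ideal])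
  thus "p \<in> ideal_Q n d \<Longrightarrow> acts_zero n d p" by auto
qed

text \<open>The quotient of the free algebra by the relations is realized inside a ring type, namely
  by endomorphisms of the whole space of polynomials: a complement of the ideal carries the
  regular representation, and everything else the trivial one. The idempotent \<open>e\<close> projects to
  the complement, so that the relations (Q6) and (Q7) hold after multiplication with \<open>e\<close>.\<close>

lemma acts_zero_imp_ideal_Q:
  assumes p: "p \<in> fcarrier n" "acts_zero n d p"
  shows "p \<in> ideal_Q n d"
proof (rule ccontr)
  assume notin: "p \<notin> ideal_Q n d"
  define I where "I = ideal_Q n d"
  note I = ideal_closed[OF ideal_ideal_Q[of n d], folded I_def]
  have "pm.subspace I" unfolding pm.subspace_def using I by auto
  then obtain P where P: "is_linear P" "\<And>x. P x - x \<in> I" "\<And>x. x \<in> I \<Longrightarrow> P x = 0"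
    using exists_projection by blast
  \<comment> \<open>The type also contains words with generators outside \<open>gl_gens n\<close>. R
    discards them, so that \<pi> takes its values in the free algebra on the given
    generators.\<close>
  define R where "R = lin_ext (\<lambda>w. if set (letters w) \<subseteq> gl_gens n then single w 1 else (0 :: gl_free))"
  have R_id: "R x = x" if "x \<in> fcarrier n" for x
  proof -
    have "R x = id x" unfolding R_def
      by (rule is_linear_eqI[OF is_linear_lin_ext]) (use that in \<open>auto simp: is_linear_def free_alg_def\<close>)
    thus ?thesis by simp
  qed
  have R_mem: "R x \<in> fcarrier n" for x unfolding R_def lin_ext_def
    by (intro sum_free_carrier free_closed) (auto simp: free_alg_def)
  define \<pi> where "\<pi> x = P (R x)" for x
  have lin: "is_linear \<pi>" using P(1) unfolding \<pi>_def R_def by (simp add: is_linear_def lin_ext_add lin_ext_scale)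
  have \<pi>_mem: "\<pi> x \<in> fcarrier n" for x
    using free_closed(2)[OF subsetD[OF I(1) P(2)[of "R x"]] R_mem[of x]] by (simp add: \<pi>_def)
  have \<pi>_I: "\<pi> x = 0" if "x \<in> I" for x using P(3)[OF that] R_id[of x] I(1) that by (auto simp: \<pi>_def)
  have \<pi>_diff: "\<pi> x - x \<in> I" if "x \<in> fcarrier n" for x using P(2)[of x] R_id[OF that] by (simp add: \<pi>_def)
  have \<pi>_cong: "\<pi> x = \<pi> y" if "x - y \<in> I" for x y using \<pi>_I[OF that] by (simp add: is_linear_simps(3)[OF lin])
  have \<pi>_idem: "\<pi> (\<pi> x) = \<pi> x" for x
    using \<pi>_cong[OF P(2)[of "R x"]] \<pi>_cong[OF \<pi>_diff[OF \<pi>_mem[of x]]] P(2)[of "R x"] P(3) R_id[OF \<pi>_mem[of x]]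
      is_linear_simps(3)[OF P(1), of "P (R x)" "R x"] by (simp add: \<pi>_def)
  define e where "e = Endo \<pi>"
  have e: "app e x = \<pi> x" for x by (simp add: e_def lin)
  \<comment> \<open>Multiplication in the quotient, expressed on representatives. The inner \<pi>
    makes \<open>L p\<close> vanish on the kernel of \<open>e\<close>, and the outer one keeps its
    image in that of \<open>e\<close>.\<close>
  define L where "L p = Endo (\<lambda>x. \<pi> (p * \<pi> x))" for p
  have L: "app (L p) x = \<pi> (p * \<pi> x)" for p x unfolding L_def
    by (subst app_Endo) (simp_all add: is_linear_def is_linearD[OF lin] distrib_left scale_mult_right)
  have \<pi>_mult: "\<pi> (p * \<pi> y) = \<pi> (p * y)" if "p \<in> fcarrier n" "y \<in> fcarrier n" for p y
    by (rule \<pi>_cong) (use I(4)[OF \<pi>_diff[OF that(2)] that(1)] in \<open>simp add: right_diff_distrib\<close>)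
  have ee: "e * e = e" by (rule app_eqI) (simp add: e \<pi>_idem)
  have eL: "e * L p = L p" "L p * e = L p" for p by (rule app_eqI, simp add: e L \<pi>_idem)+
  have L_mult: "L (p * q) = L p * L q" if "p \<in> fcarrier n" "q \<in> fcarrier n" for p q
    by (rule app_eqI) (simp add: L \<pi>_idem \<pi>_mult[OF that(1) free_closed(1)[OF that(2) \<pi>_mem]] mult.assoc)
  have L_add: "L (p + q) = L p + L q" "L (p - q) = L p - L q" "L (scale c p) = escale c (L p)" for p q c
    by (rule app_eqI; simp add: L distrib_right left_diff_distrib is_linearD[OF lin] is_linear_simps[OF lin] scale_mult_left)+
  have L1: "L 1 = e" by (rule app_eqI) (simp add: L e \<pi>_idem)
  have L_I: "L r = 0" if "r \<in> I" for r by (rule app_eqI) (simp add: L \<pi>_I I(5)[OF that \<pi>_mem])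
  have L_inj: "p \<in> I" if "p \<in> fcarrier n" "L p = 0" for p
  proof -
    have "\<pi> (p * \<pi> 1) = 0" using arg_cong[OF that(2), of "\<lambda>f. app f 1"] by (simp add: L)
    hence "\<pi> p = 0" using \<pi>_mult[OF that(1) free_closed(5)] by simp
    thus ?thesis using \<pi>_diff[OF that(1)] I(6)[of "- p" "- 1"] by simp
  qed
  \<comment> \<open>Outside the corner the zero action would violate the invertibility in (Q1). The
    counit respects (Q1)-(Q5) and has scalar values, which commute with everything.\<close>
  define \<Theta> where "\<Theta> = (ev (\<lambda>g. escale (counit g) 1) :: gl_free \<Rightarrow> gl_gen free_monoid endo)"
  have \<Theta>_comm: "\<Theta> p * x = x * \<Theta> p" for p x unfolding \<Theta>_def ev_scalar by simp
  define \<Phi> where "\<Phi> p = L p + \<Theta> p * (1 - e)" for p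
  have orth: "L p * (\<Theta> q * (1 - e)) = 0" "\<Theta> q * (1 - e) * L p = 0" "\<Theta> p * (1 - e) * (\<Theta> q * (1 - e)) = \<Theta> p * \<Theta> q * (1 - e)" for p q
  proof -
    have "L p * (\<Theta> q * (1 - e)) = \<Theta> q * (L p * (1 - e))" by (rule en.comm_assoc[OF \<Theta>_comm[symmetric]])
    thus "L p * (\<Theta> q * (1 - e)) = 0" by (simp add: right_diff_distrib eL)
    show "\<Theta> q * (1 - e) * L p = 0" by (simp add: mult.assoc left_diff_distrib eL)
    have "\<Theta> p * (1 - e) * (\<Theta> q * (1 - e)) = \<Theta> p * (\<Theta> q * ((1 - e) * (1 - e)))"
      unfolding mult.assoc en.comm_assoc[OF \<Theta>_comm[of q "1 - e", symmetric]] ..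
    also have "(1 - e) * (1 - e) = 1 - e" by (simp add: algebra_simps ee)
    finally show "\<Theta> p * (1 - e) * (\<Theta> q * (1 - e)) = \<Theta> p * \<Theta> q * (1 - e)" by (simp add: mult.assoc)
  qed
  interpret \<Phi>: free_hom n \<Phi>
  proof
    fix p q c assume p: "p \<in> fcarrier n"
    show "\<Phi> (scale c p) = escale c (\<Phi> p)" by (simp add: \<Phi>_def L_add \<Theta>_def ev_scale en.sc_add_right)
    assume q: "q \<in> fcarrier n"
    show "\<Phi> (p * q) = \<Phi> p * \<Phi> q"
      by (simp add: \<Phi>_def L_mult[OF p q] distrib_left distrib_right orth) (simp add: \<Theta>_def ev_mult)
    show "\<Phi> (p + q) = \<Phi> p + \<Phi> q" by (simp add: \<Phi>_def L_add \<Theta>_def ev_add distrib_right)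
  next
    show "\<Phi> 1 = 1" by (simp add: \<Phi>_def L1 \<Theta>_def ev_one)
  qed
  have \<Phi>e: "\<Phi> p * e = L p" "e * \<Phi> p = L p" for p
  proof -
    show "\<Phi> p * e = L p" by (simp add: \<Phi>_def distrib_right eL mult.assoc left_diff_distrib ee)
    have "e * (\<Theta> p * (1 - e)) = \<Theta> p * (e * (1 - e))" by (rule en.comm_assoc[OF \<Theta>_comm[symmetric]])
    thus "e * \<Phi> p = L p" by (simp add: \<Phi>_def distrib_left eL right_diff_distrib ee)
  qed
  have gens: "k \<in> {1..<n} \<Longrightarrow> Defs.E k \<in> fcarrier n" "k \<in> {1..<n} \<Longrightarrow> Defs.F k \<in> fcarrier n"
    "a \<in> {1..n} \<Longrightarrow> Defs.K a \<in> fcarrier n" "a \<in> {1..n} \<Longrightarrow> Defs.Kinv a \<in> fcarrier n" for k a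
    by (simp_all add: gen_carrier)
  have relI: "relations n \<union> Q6 n d \<union> Q7 n d \<subseteq> I"
    unfolding I_def ideal_Q_def by (rule ring.genideal_self[OF ring_free_alg relations_Q67_carrier])
  have \<Theta>: "\<Theta> (p * q) = \<Theta> p * \<Theta> q" "\<Theta> (p + q) = \<Theta> p + \<Theta> q" "\<Theta> (p - q) = \<Theta> p - \<Theta> q" "\<Theta> (scale c p) = escale c (\<Theta> p)"
    "\<Theta> 1 = 1" "\<Theta> 0 = 0" "\<Theta> (Defs.E k) = 0" "\<Theta> (Defs.F k) = 0" "\<Theta> (Defs.K k) = 1" "\<Theta> (Defs.Kinv k) = 1" for p q c k
    by (simp_all add: \<Theta>_def ev_add ev_diff ev_mult ev_scale ev_gen ev_one ev_zero)
  \<comment> \<open>The two summands of \<Phi> are compared separately: L kills the ideal, and the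
    counits of both sides of each relation agree.\<close>
  have rel: "\<Phi> p = \<Phi> q" if "p - q \<in> relations n" "\<Theta> p = \<Theta> q" for p q
  proof -
    have "L (p - q) = 0" using L_I relI that by auto
    thus ?thesis using that(2) by (simp add: \<Phi>_def L_add)
  qed
  note ops = \<Phi>.hom \<Phi>.hom_diff free_closed gens
  have serre: "\<Phi> (X i) * (\<Phi> (X i) * \<Phi> (X j)) + \<Phi> (X j) * (\<Phi> (X i) * \<Phi> (X i)) = escale (v + inverse v) (\<Phi> (X i) * (\<Phi> (X j) * \<Phi> (X i)))"
    if "\<bar>int i - int j\<bar> = 1" "i \<in> {1..<n}" "j \<in> {1..<n}" and X: "serre n X \<subseteq> relations n" "\<And>i. i \<in> {1..<n} \<Longrightarrow> X i \<in> fcarrier n" "\<And>i. \<Theta> (X i) = 0" for X i j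
  proof -
    have "X i ^ 2 * X j - scale (v + inverse v) (X i * X j * X i) + X j * X i ^ 2 \<in> relations n"
      using X(1) that(1-3) unfolding serre_def by blast
    hence "(X i * (X i * X j) + X j * (X i * X i)) - scale (v + inverse v) (X i * (X j * X i)) \<in> relations n"
      by (simp add: power2_eq_square mult.assoc algebra_simps)
    from rel[OF this] show ?thesis using that by (simp add: \<Theta> ops)
  qed
  have serre': "\<Phi> (X i) * \<Phi> (X j) = \<Phi> (X j) * \<Phi> (X i)"
    if "\<bar>int i - int j\<bar> \<noteq> 1" "i \<in> {1..<n}" "j \<in> {1..<n}" and X: "serre n X \<subseteq> relations n" "\<And>i. i \<in> {1..<n} \<Longrightarrow> X i \<in> fcarrier n" "\<And>i. \<Theta> (X i) = 0" for X i j
  proof -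
    have "X i * X j - X j * X i \<in> relations n"
      using X(1) that(1-3) unfolding serre_def by blast
    from rel[OF this] show ?thesis using that by (simp add: \<Theta> ops)
  qed
  have serre_sub: "serre n Defs.E \<subseteq> relations n" "serre n Defs.F \<subseteq> relations n"
    by (auto simp: relations_def Q4_def Q5_def)
  have K_pow: "\<Phi> (Defs.K i - scalar c) = \<Phi> (Defs.K i) - escale c 1" if "i \<in> {1..n}" for i c
    using that by (simp add: ops \<Phi>.hom_scalar scalar_def)
  interpret S: schur_quotient escale n "\<lambda>i. \<Phi> (Defs.E i)" "\<lambda>i. \<Phi> (Defs.F i)" "\<lambda>i. \<Phi> (Defs.K i)" "\<lambda>i. \<Phi> (Defs.Kinv i)" d e
  proof (unfold_locales, goal_cases)
    case (1 i j)
    have "Defs.K i * Defs.K j - Defs.K j * Defs.K i \<in> relations n" using 1 by (auto simp: relations_def Q1_def)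
    from rel[OF this] show ?case using 1 by (simp add: \<Theta> ops)
  next
    case (2 i)
    have "Defs.K i * Defs.Kinv i - 1 \<in> relations n" using 2 by (auto simp: relations_def Q1_def)
    from rel[OF this] show ?case using 2 by (simp add: \<Theta> ops)
  next
    case (3 i)
    have "Defs.Kinv i * Defs.K i - 1 \<in> relations n" using 3 by (auto simp: relations_def Q1_def)
    from rel[OF this] show ?case using 3 by (simp add: \<Theta> ops)
  next
    case (4 i j)
    have "(Defs.E i * Defs.F j - Defs.F j * Defs.E i) - (if i = j then scale (1 / (v - inverse v))
        (Defs.K i * Defs.Kinv (i + 1) - Defs.Kinv i * Defs.K (i + 1)) else 0) \<in> relations n"
      using 4 by (auto simp: relations_def Q2_def)
    from rel[OF this] show ?case using 4 by (cases "i = j") (auto simp: \<Theta> ops \<Phi>.hom_zero algebra_simps)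
  next
    case (5 i j)
    have "Defs.K i * Defs.E j - scale (v powi (inner_prod n (eps i) (alpha j))) (Defs.E j * Defs.K i) \<in> relations n"
      using 5 unfolding relations_def Q3_def by blast
    from rel[OF this] show ?case using 5 by (simp add: \<Theta> ops inner_prod_alpha)
  next
    case (6 i j)
    have "Defs.K i * Defs.F j - scale (v powi (- inner_prod n (eps i) (alpha j))) (Defs.F j * Defs.K i) \<in> relations n"
      using 6 unfolding relations_def Q3_def by blast
    from rel[OF this] show ?case using 6 by (simp add: \<Theta> ops inner_prod_alpha)
  next
    case (7 i j)
    show ?case by (rule serre[OF 7(3,1,2) serre_sub(1) gens(1)]) (auto simp: \<Theta>)
  next
    case (8 i j)
    show ?case by (rule serre'[OF 8(3,1,2) serre_sub(1) gens(1)]) (auto simp: \<Theta>)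
  next
    case (9 i j)
    show ?case by (rule serre[OF 9(3,1,2) serre_sub(2) gens(2)]) (auto simp: \<Theta>)
  next
    case (10 i j)
    show ?case by (rule serre'[OF 10(3,1,2) serre_sub(2) gens(2)]) (auto simp: \<Theta>)
  next
    case 11
    show ?case by (rule ee)
  next
    case 15
    have "prod_list (map Defs.K [1..<n+1]) - scalar (v ^ d) \<in> Q6 n d" by (simp add: Q6_def)
    hence "L (prod_list (map Defs.K [1..<n+1]) - scalar (v ^ d)) = 0" using L_I relI by auto
    moreover have "prod_list (map (\<lambda>i. \<Phi> (Defs.K i)) [1..<n+1]) * e = L (prod_list (map Defs.K [1..<n+1]))"
      by (subst \<Phi>.hom_prod_list[symmetric]) (auto simp: gens \<Phi>e simp del: upt_Suc)
    ultimately show ?case by (simp add: L_add L1 scalar_def)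
  next
    case (16 a)
    have "prod_list (map (\<lambda>t. Defs.K a - scalar (v ^ t)) [0..<d+1]) \<in> Q7 n d" using 16 by (auto simp: Q7_def)
    hence "L (prod_list (map (\<lambda>t. Defs.K a - scalar (v ^ t)) [0..<d+1])) = 0" using L_I relI by auto
    moreover have "prod_list (map (\<lambda>t. \<Phi> (Defs.K a) - escale (v ^ t) 1) [0..<d+1]) * e =
        \<Phi> (prod_list (map (\<lambda>t. Defs.K a - scalar (v ^ t)) [0..<d+1])) * e"
      by (subst \<Phi>.hom_prod_list) (use 16 in \<open>simp_all add: gens free_closed scalar_def K_pow[OF 16, unfolded scalar_def] del: upt_Suc\<close>)
    ultimately show ?case by (simp add: \<Phi>e del: upt_Suc)
  qed (simp_all add: \<Phi>e)
  \<comment> \<open>An element of \<open>generated\<close> need not be of the form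
    \<open>L q\<close>, but multiplied by \<open>e\<close> from either side it is. This makes the
    set J below stable under multiplication by \<open>generated\<close>.\<close>
  have gen: "\<exists>q\<in>fcarrier n. y * e = L q \<and> e * y = L q" if "y \<in> S.generated" for y
    using that
  proof induction
    case 1
    show ?case by (rule bexI[of _ 1]) (simp_all add: L1 free_closed)
  next
    case 2
    show ?case by (rule bexI[of _ 1]) (simp_all add: L1 free_closed ee)
  next
    case (7 x c)
    then obtain q where "q \<in> fcarrier n" "x * e = L q" "e * x = L q" by auto
    thus ?case by (intro bexI[of _ "scale c q"]) (simp_all add: L_add free_closed)
  next
    case (8 x y)
    then obtain q r where "q \<in> fcarrier n" "x * e = L q" "e * x = L q" "r \<in> fcarrier n" "y * e = L r" "e * y = L r" by auto
    thus ?case by (intro bexI[of _ "q + r"]) (simp_all add: L_add free_closed distrib_left distrib_right)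
  next
    case (9 x y)
    then obtain q r where qr: "q \<in> fcarrier n" "x * e = L q" "e * x = L q" "r \<in> fcarrier n" "y * e = L r" "e * y = L r" by auto
    have "x * y * e = x * e * L r" using qr(5) by (simp add: mult.assoc eL)
    moreover have "e * (x * y) = L q * e * y" using qr(3) by (simp add: eL flip: mult.assoc)
    hence "e * (x * y) = L q * L r" using qr(6) by (simp add: mult.assoc)
    ultimately show ?case using qr by (intro bexI[of _ "q * r"]) (simp_all add: L_mult free_closed)
  qed (use gens \<Phi>e in blast)+
  have word: "\<Phi> q \<in> S.generated" if q: "q \<in> fcarrier n" for q
  proof -
    have w: "\<Phi> (single (Word gs) 1) \<in> S.generated \<and> single (Word gs) 1 \<in> fcarrier n" if "set gs \<subseteq> gl_gens n" for gs
      using that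
    proof (induction gs)
      case Nil
      have "single (Word []) 1 = (1 :: gl_free)" by (simp add: zero_free_monoid_def flip: single_one)
      thus ?case using S.generated.intros(1) by (simp add: \<Phi>.hom free_closed)
    next
      case (Cons g gs)
      have "single (Word (g # gs)) 1 = gen g * single (Word gs) 1"
        by (simp add: gen_def mult_single plus_free_monoid_def)
      moreover have "\<Phi> (gen g) \<in> S.generated" using Cons.prems S.generated.intros(3-6) by (cases g) auto
      ultimately show ?case using Cons by (simp add: \<Phi>.hom gen_carrier S.generated.intros(9) free_closed)
    qed
    have s: "single x c \<in> fcarrier n \<and> \<Phi> (single x c) \<in> S.generated" if "x \<in> keys q" for x c
    proof -
      have x: "set (letters x) \<subseteq> gl_gens n" using q that by (auto simp: free_alg_def)
      have "single x c = scale c (single (Word (letters x)) 1)" by simp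
      thus ?thesis using w[OF x] by (simp add: \<Phi>.hom free_closed S.generated.intros(7) del: scale_single)
    qed
    have sum: "sum f A \<in> S.generated" if "\<And>a. a \<in> A \<Longrightarrow> f a \<in> S.generated" for A and f :: "gl_gen free_monoid \<Rightarrow> _"
      using that
    proof (induction A rule: infinite_finite_induct)
      case (insert x F)
      then show ?case by (simp add: S.generated.intros(8))
    qed (use S.generated.intros(7)[OF S.generated.intros(1), of 0] in simp_all)
    have "\<Phi> q = (\<Sum>w\<in>keys q. \<Phi> (single w (lookup q w)))"
      by (subst poly_mapping_expand[of q], rule \<Phi>.hom_sum) (use s in blast)
    thus ?thesis using s by (simp add: sum)
  qed
  define J where "J = {L q | q. q \<in> fcarrier n \<and> acts_zero n d q}"
  have az: "acts_zero n d (q - r)" "acts_zero n d (scale c q)" if "acts_zero n d q" "acts_zero n d r" for q r c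
    using that by (simp_all add: acts_zero_def ev_diff ev_scale)
  have az_mult: "acts_zero n d (q * r)" "acts_zero n d (r * q)" if "acts_zero n d q" "q \<in> fcarrier n" "r \<in> fcarrier n" for q r
    using that free_act_ev(2)[of r n _ d] by (auto simp: acts_zero_def ev_mult)
  have "\<exists>\<mu> ws. partition n d \<mu> \<and> partitions_from n d (height n \<mu> + 1) ws \<and>
      S.PC ws * (S.qproj \<mu> * e) \<in> J"
  proof (rule S.nonzero_ideal)
    show "L p \<in> J" using p by (auto simp: J_def)
    show "L p \<noteq> 0" using L_inj[OF p(1)] notin by (auto simp: I_def)
    show "x - y \<in> J" if xy: "x \<in> J" "y \<in> J" for x y
    proof -
      obtain q r where "x = L q" "y = L r" "q \<in> fcarrier n" "r \<in> fcarrier n" "acts_zero n d q" "acts_zero n d r"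
        using xy unfolding J_def by blast
      thus ?thesis unfolding J_def by (auto intro!: exI[of _ "q - r"] simp: L_add free_closed az)
    qed
    show "escale c x \<in> J" if x: "x \<in> J" for x c
    proof -
      obtain q where "x = L q" "q \<in> fcarrier n" "acts_zero n d q" using x by (auto simp: J_def)
      thus ?thesis unfolding J_def by (auto intro!: exI[of _ "scale c q"] simp: L_add free_closed az)
    qed
    show "x * y \<in> J" "y * x \<in> J" if xy: "x \<in> J" "y \<in> S.generated" for x y
    proof -
      obtain q where q: "x = L q" "q \<in> fcarrier n" "acts_zero n d q" using xy by (auto simp: J_def)
      obtain r where r: "r \<in> fcarrier n" "y * e = L r" "e * y = L r" using gen[OF xy(2)] by auto
      have "L q * y = L q * (e * y)" by (simp add: eL flip: mult.assoc)
      hence "x * y = L (q * r)" using q r by (simp add: L_mult)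
      thus "x * y \<in> J" using q r az_mult by (auto simp: J_def free_closed)
      have "y * L q = y * e * L q" by (simp add: eL mult.assoc)
      hence "y * x = L (r * q)" using q r by (simp add: L_mult)
      thus "y * x \<in> J" using q r az_mult by (auto simp: J_def free_closed)
    qed
    show "J \<subseteq> S.generated"
    proof
      fix x assume "x \<in> J"
      then obtain q where "x = \<Phi> q * e" "q \<in> fcarrier n" by (auto simp: J_def \<Phi>e)
      thus "x \<in> S.generated" using word by (simp add: S.generated.intros(2,9))
    qed
    show "x * e = x" if "x \<in> J" for x using that by (auto simp: J_def eL)
  qed
  then obtain \<mu> ws where \<mu>: "partition n d \<mu>" "partitions_from n d (height n \<mu> + 1) ws"
    "S.PC ws * (S.qproj \<mu> * e) \<in> J" by blast
  have C: "\<Phi> (Casimir n) = S.C"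
    unfolding \<Phi>.hom_Casimir(2) S.C_def S.Z_def S.L_def S.M_def by (simp cong: sum.cong)
  have "S.PC ws * (S.qproj \<mu> * e) = \<Phi> (isotypic n d \<mu> ws) * e"
    unfolding \<Phi>.hom_isotypic(2) C S.PC_def S.qproj_def S.qfactor_def by (simp only: mult.assoc)
  also have "\<dots> = L (isotypic n d \<mu> ws)" by (rule \<Phi>e)
  finally obtain q where q: "L (isotypic n d \<mu> ws) = L q" "q \<in> fcarrier n" "acts_zero n d q"
    using \<mu>(3) by (auto simp: J_def)
  \<comment> \<open>Equality under L leads back to polynomials modulo the ideal, and the ideal acts
    by zero. So \<open>isotypic\<close> would act by zero as well.\<close>
  have "isotypic n d \<mu> ws - q \<in> I"
    by (rule L_inj) (use q in \<open>simp_all add: L_add free_closed \<Phi>.hom_isotypic(1)\<close>)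
  hence "acts_zero n d (isotypic n d \<mu> ws - q)" unfolding I_def by (rule ideal_Q_acts_zero)
  hence "acts_zero n d (isotypic n d \<mu> ws)" using q(3) by (simp add: acts_zero_def ev_diff)
  thus False using isotypic_acts_nonzero[OF \<mu>(1,2)] by blast
qed

section \<open>The isomorphism\<close>

lemma free_act_eq_iff:
  assumes "p \<in> fcarrier n" "q \<in> fcarrier n"
  shows "free_act n d p = free_act n d q \<longleftrightarrow> p - q \<in> ideal_Q n d"
proof -
  have "free_act n d p = free_act n d q \<longleftrightarrow> (\<forall>x\<in>tensor_space n d. free_act n d p x = free_act n d q x)"
    by (auto simp: fun_eq_iff free_act_def)
  also have "\<dots> \<longleftrightarrow> acts_zero n d (p - q)"
    using free_act_ev(1)[OF assms(1)] free_act_ev(1)[OF assms(2)] by (simp add: acts_zero_def ev_diff)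
  also have "\<dots> \<longleftrightarrow> p - q \<in> ideal_Q n d"
    using acts_zero_imp_ideal_Q[of "p - q" n d] ideal_Q_acts_zero assms free_closed(3) by blast
  finally show ?thesis .
qed

lemma coset_iff:
  assumes "ideal I (free_alg G)" "p \<in> carrier (free_alg G)"
  shows "I +>\<^bsub>free_alg G\<^esub> p = {q \<in> carrier (free_alg G). q - p \<in> I}"
proof -
  interpret ideal I "free_alg G" by (rule assms(1))
  show ?thesis
  proof
    show "I +>\<^bsub>free_alg G\<^esub> p \<subseteq> {q \<in> carrier (free_alg G). q - p \<in> I}"
      using a_subset assms(2) by (auto simp: a_r_coset_def' free_closed)
    show "{q \<in> carrier (free_alg G). q - p \<in> I} \<subseteq> I +>\<^bsub>free_alg G\<^esub> p"
    proof
      fix q assume "q \<in> {q \<in> carrier (free_alg G). q - p \<in> I}"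
      hence "q - p \<in> I" "q = (q - p) + p" by auto
      thus "q \<in> I +>\<^bsub>free_alg G\<^esub> p" unfolding a_r_coset_def' free_alg_simps by blast
    qed
  qed
qed

lemma coset_free_act:
  assumes "p \<in> fcarrier n"
  shows "ideal_Q n d +>\<^bsub>gl_free_alg n\<^esub> p = {q \<in> fcarrier n. free_act n d q = free_act n d p}"
  unfolding coset_iff[OF ideal_ideal_Q assms] using free_act_eq_iff[OF _ assms] by auto

text \<open>The ideal of (Q1)-(Q5) lies in \<open>ideal_Q\<close>, so \<open>free_act\<close> is
  constant on the cosets that form \<open>U_gl n\<close>, and \<open>U_act\<close> returns the
  common value.\<close>

lemma q_Schur_carrier: "carrier (q_Schur n d) = free_act n d ` fcarrier n"
proof -
  let ?A = "gl_free_alg n"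
  define I where "I = Idl\<^bsub>?A\<^esub> (Q1 n \<union> Q2 n \<union> Q3 n \<union> Q4 n \<union> Q5 n)"
  have I: "ideal I ?A"
    unfolding I_def using ring.genideal_ideal[OF ring_free_alg relations_carrier] by (simp add: relations_def)
  have sub: "I \<subseteq> ideal_Q n d"
    unfolding I_def by (rule ring.genideal_minimal[OF ring_free_alg ideal_ideal_Q])
      (use ring.genideal_self[OF ring_free_alg relations_Q67_carrier] in \<open>auto simp: ideal_Q_def relations_def\<close>)
  have U: "U_act n d (I +>\<^bsub>?A\<^esub> p) = free_act n d p" if p: "p \<in> fcarrier n" for p
  proof -
    have "free_act n d ` (I +>\<^bsub>?A\<^esub> p) = {free_act n d p}"
      unfolding coset_iff[OF I p] using free_act_eq_iff[OF _ p] sub ideal_closed(2)[OF I] p by auto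
    thus ?thesis by (simp add: U_act_def)
  qed
  have "carrier (U_gl n) = (\<lambda>p. I +>\<^bsub>?A\<^esub> p) ` fcarrier n"
    by (auto simp: U_gl_def presented_alg_def quot_alg_def I_def ring.defs FactRing_def A_RCOSETS_def')
  thus ?thesis using U by (simp add: q_Schur_def image_image)
qed

lemma End_alg_ops:
  "f \<otimes>\<^bsub>q_Schur n d\<^esub> g = compose (tensor_space n d) f g"
  "f \<oplus>\<^bsub>q_Schur n d\<^esub> g = (\<lambda>x\<in>tensor_space n d. f x + g x)"
  "\<one>\<^bsub>q_Schur n d\<^esub> = (\<lambda>x\<in>tensor_space n d. x)"
  "c \<odot>\<^bsub>q_Schur n d\<^esub> f = (\<lambda>x\<in>tensor_space n d. scale c (f x))"
  by (simp_all add: q_Schur_def End_alg_def Let_def)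

lemma free_act_hom:
  assumes "p \<in> fcarrier n" "q \<in> fcarrier n"
  shows "free_act n d (p * q) = free_act n d p \<otimes>\<^bsub>q_Schur n d\<^esub> free_act n d q"
    and "free_act n d (p + q) = free_act n d p \<oplus>\<^bsub>q_Schur n d\<^esub> free_act n d q"
    and "free_act n d (scale c p) = c \<odot>\<^bsub>q_Schur n d\<^esub> free_act n d p"
    and "free_act n d 1 = \<one>\<^bsub>q_Schur n d\<^esub>"
proof -
  have e: "f = restrict g (tensor_space n d)"
    if "\<And>x. x \<in> tensor_space n d \<Longrightarrow> f x = g x" "f \<in> extensional (tensor_space n d)" for f g :: "(nat list \<Rightarrow>\<^sub>0 qv) \<Rightarrow> (nat list \<Rightarrow>\<^sub>0 qv)"
    using that by (auto simp: fun_eq_iff extensional_def)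
  have ext: "free_act n d r \<in> extensional (tensor_space n d)" for r by (simp add: free_act_def)
  note ev = free_act_ev(1)[OF assms(1)] free_act_ev(1)[OF assms(2)] free_act_ev(2)[OF assms(2)]
  show "free_act n d (p * q) = free_act n d p \<otimes>\<^bsub>q_Schur n d\<^esub> free_act n d q"
    unfolding End_alg_ops compose_def by (rule e[OF _ ext]) (simp add: ev free_act_ev(1) free_closed assms ev_mult)
  show "free_act n d (p + q) = free_act n d p \<oplus>\<^bsub>q_Schur n d\<^esub> free_act n d q"
    unfolding End_alg_ops by (rule e[OF _ ext]) (simp add: ev free_act_ev(1) free_closed assms ev_add)
  show "free_act n d (scale c p) = c \<odot>\<^bsub>q_Schur n d\<^esub> free_act n d p"
    unfolding End_alg_ops by (rule e[OF _ ext]) (simp add: ev free_act_ev(1) free_closed assms ev_scale)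
  show "free_act n d 1 = \<one>\<^bsub>q_Schur n d\<^esub>"
    unfolding End_alg_ops by (rule e[OF _ ext]) (simp add: free_act_ev(1) free_closed ev_one)
qed

lemma quot_alg_ops:
  "carrier (quot_alg A I) = a_rcosets\<^bsub>A\<^esub> I"
  "X \<otimes>\<^bsub>quot_alg A I\<^esub> Y = rcoset_mult A I X Y"
  "X \<oplus>\<^bsub>quot_alg A I\<^esub> Y = X <+>\<^bsub>A\<^esub> Y"
  "\<one>\<^bsub>quot_alg A I\<^esub> = I +>\<^bsub>A\<^esub> \<one>\<^bsub>A\<^esub>"
  "c \<odot>\<^bsub>quot_alg A I\<^esub> X = (\<Union>x\<in>X. I +>\<^bsub>A\<^esub> (c \<odot>\<^bsub>A\<^esub> x))"
  by (simp_all add: quot_alg_def ring.defs module.defs FactRing_def)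

theorem theorem2p1:
  fixes n d :: nat
  assumes "n \<ge> 1"
  shows "alg_isomorphic (q_Schur n d)
           (presented_alg (gl_gens n)
             (Q1 n \<union> Q2 n \<union> Q3 n \<union> Q4 n \<union> Q5 n \<union> Q6 n d \<union> Q7 n d))"
proof -
  let ?A = "gl_free_alg n"
  let ?I = "ideal_Q n d"
  have P: "presented_alg (gl_gens n) (Q1 n \<union> Q2 n \<union> Q3 n \<union> Q4 n \<union> Q5 n \<union> Q6 n d \<union> Q7 n d) = quot_alg ?A ?I"
    by (simp add: presented_alg_def ideal_Q_def relations_def)
  interpret ideal ?I ?A by (rule ideal_ideal_Q)
  \<comment> \<open>An operator is sent to the fibre of \<open>free_act\<close> over it. By
    \<open>coset_free_act\<close> this fibre is a coset of the ideal, so no choice of a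
    representative enters.\<close>
  define \<psi> where "\<psi> f = {q \<in> fcarrier n. free_act n d q = f}" for f
  have \<psi>: "\<psi> (free_act n d p) = ?I +>\<^bsub>?A\<^esub> p" if "p \<in> fcarrier n" for p
    using coset_free_act[OF that] by (simp add: \<psi>_def)
  have S: "\<exists>p\<in>fcarrier n. f = free_act n d p" if "f \<in> carrier (q_Schur n d)" for f
    using that by (auto simp: q_Schur_carrier)
  have car: "carrier (quot_alg ?A ?I) = (\<lambda>p. ?I +>\<^bsub>?A\<^esub> p) ` fcarrier n"
    by (auto simp: quot_alg_ops A_RCOSETS_def')
  have "\<psi> \<in> ring_hom (q_Schur n d) (quot_alg ?A ?I)"
  proof (rule ring_hom_memI)
    fix f assume "f \<in> carrier (q_Schur n d)"
    then obtain p where p: "p \<in> fcarrier n" "f = free_act n d p" using S by blast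
    thus "\<psi> f \<in> carrier (quot_alg ?A ?I)" by (simp add: \<psi> car)
    fix g assume "g \<in> carrier (q_Schur n d)"
    then obtain q where q: "q \<in> fcarrier n" "g = free_act n d q" using S by blast
    show "\<psi> (f \<otimes>\<^bsub>q_Schur n d\<^esub> g) = \<psi> f \<otimes>\<^bsub>quot_alg ?A ?I\<^esub> \<psi> g"
      using rcoset_mult_add[OF p(1) q(1)] p q
      by (simp add: \<psi> quot_alg_ops free_closed flip: free_act_hom(1))
    show "\<psi> (f \<oplus>\<^bsub>q_Schur n d\<^esub> g) = \<psi> f \<oplus>\<^bsub>quot_alg ?A ?I\<^esub> \<psi> g"
      using a_rcos_sum[OF p(1) q(1)] p q
      by (simp add: \<psi> quot_alg_ops free_closed flip: free_act_hom(2))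
  next
    show "\<psi> \<one>\<^bsub>q_Schur n d\<^esub> = \<one>\<^bsub>quot_alg ?A ?I\<^esub>"
      using \<psi>[OF free_closed(5)] free_act_hom(4)[OF free_closed(5,5)] by (simp add: quot_alg_ops)
  qed
  moreover have "bij_betw \<psi> (carrier (q_Schur n d)) (carrier (quot_alg ?A ?I))"
  proof (rule bij_betw_imageI)
    show "inj_on \<psi> (carrier (q_Schur n d))"
    proof (rule inj_onI)
      fix f g assume f: "f \<in> carrier (q_Schur n d)" and eq: "\<psi> f = \<psi> g"
      then obtain p where "p \<in> fcarrier n" "f = free_act n d p" using S by blast
      hence "p \<in> \<psi> f" by (simp add: \<psi>_def)
      hence "p \<in> \<psi> g" using eq by simp
      thus "f = g" using \<open>f = free_act n d p\<close> by (simp add: \<psi>_def)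
    qed
    show "\<psi> ` carrier (q_Schur n d) = carrier (quot_alg ?A ?I)"
      unfolding car q_Schur_carrier image_image using \<psi> by (rule image_cong[OF refl])
  qed
  moreover have "\<psi> (c \<odot>\<^bsub>q_Schur n d\<^esub> f) = c \<odot>\<^bsub>quot_alg ?A ?I\<^esub> \<psi> f" if f: "f \<in> carrier (q_Schur n d)" for c f
  proof -
    obtain p where p: "p \<in> fcarrier n" "f = free_act n d p" using S[OF f] by blast
    have "?I +>\<^bsub>?A\<^esub> scale c q = ?I +>\<^bsub>?A\<^esub> scale c p" if "q \<in> \<psi> f" for q
      using that free_act_hom(3)[of q n q d c] free_act_hom(3)[of p n p d c] p
      by (simp add: \<psi>_def coset_free_act free_closed)
    moreover have "p \<in> \<psi> f" using p by (simp add: \<psi>_def)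
    ultimately have "(\<Union>q\<in>\<psi> f. ?I +>\<^bsub>?A\<^esub> scale c q) = ?I +>\<^bsub>?A\<^esub> scale c p" by blast
    thus ?thesis using p free_act_hom(3)[of p n p d c] \<psi>[OF free_closed(4)[OF p(1)], of c]
      by (simp add: quot_alg_ops)
  qed
  ultimately have "\<psi> \<in> alg_iso (q_Schur n d) (quot_alg ?A ?I)"
    by (simp add: alg_iso_def ring_iso_def)
  thus ?thesis unfolding alg_isomorphic_def P by blast
qed

end
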